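(* Let $b \ge 1$ be an integer and fix a primitive Dirichlet character $\psi$ modulo $b$ of order $g$. There exist infinitely many primitive Dirichlet characters $\chi$ modulo $q$ (with $q \to \infty$), with parity opposite to that of $\psi$ (i.e. $\chi(-1) = -\psi(-1)$) and of order $\mathrm{lcm}(2,g)$, such that for every integer $a$ coprime to $b$ there is a real $\alpha$ with $|\alpha - a/b| \ll 1/\log q$ and \[ \big|S_\chi(\alpha q) - A(\chi)\big| \ge \frac{\sqrt{q}}{\pi \sqrt{b}}\big(1 + o(1)\big) \log\log q , \] where $o(1)\to 0$ as $q \to \infty$. Moreover, if $\chi$ is odd and $b > 1$, then assuming the Generalized Riemann Hypothesis, these $\chi$ may be taken to satisfy $A(\chi) \ll q^{1/2}$.
   Context: For a Dirichlet character $\chi$ modulo $q$, $S_\chi(x) = \sum_{1 \le n \le x} \chi(n)$, $\tau(\chi) = \sum_{k=1}^{q} \chi(k) e^{2\pi i k/q}$ is the Gauss sum, and \[ A(\chi) = \frac{\big(1 - \chi(-1)\big)\tau(\chi)}{2\pi i} L(1, \overline \chi). \] A character is odd if $\chi(-1)=-1$ and even if $\chi(-1)=1$.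
   Formalization: For x < 0, S_χ(x) is taken as the oriented sum −Σ_{x<n≤0} χ(n), i.e. extended q-periodically; with the literal empty sum the claim fails for negative a (if χ is even, both S_χ(αq) and A(χ) vanish there). *)

theory Defs
  imports "HOL-Complex_Analysis.Complex_Analysis"
begin

definition dirichlet_character :: "nat \<Rightarrow> (int \<Rightarrow> complex) \<Rightarrow> bool" where
  "dirichlet_character m chi \<longleftrightarrow>
     m > 0 \<and>
     (\<forall>x y. chi (x * y) = chi x * chi y) \<and>
     (\<forall>x. chi (x + int m) = chi x) \<and>
     (\<forall>x. chi x \<noteq> 0 \<longleftrightarrow> coprime x (int m))"

definition primitive_character :: "nat \<Rightarrow> (int \<Rightarrow> complex) \<Rightarrow> bool" where
  "primitive_character m chi \<longleftrightarrow>
     dirichlet_character m chi \<and>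
     \<not> (\<exists>d chi'. d dvd m \<and> d < m \<and> dirichlet_character d chi' \<and>
             (\<forall>x. coprime x (int m) \<longrightarrow> chi x = chi' x))"

definition principal_character :: "nat \<Rightarrow> int \<Rightarrow> complex" where
  "principal_character m x = (if coprime x (int m) then 1 else 0)"

definition character_order :: "nat \<Rightarrow> (int \<Rightarrow> complex) \<Rightarrow> nat" where
  "character_order m chi = (LEAST k. k > 0 \<and> (\<forall>x. chi x ^ k = principal_character m x))"

text \<open>
  For \<open>x \<ge> 0\<close> the second sum is empty and this is the sum of \<open>chi n\<close> over \<open>1 \<le> n \<le> x\<close>.
  For \<open>x < 0\<close> the first sum is empty, and the second one gives the usual oriented sum; for a
  non-principal \<open>chi\<close> modulo \<open>q\<close> this makes the function \<open>q\<close>-periodic on the whole real line.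
\<close>

definition char_sum :: "(int \<Rightarrow> complex) \<Rightarrow> real \<Rightarrow> complex" where
  "char_sum chi x = (\<Sum>n\<in>{0<..\<lfloor>x\<rfloor>}. chi n) - (\<Sum>n\<in>{\<lfloor>x\<rfloor><..0}. chi n)"

definition gauss_sum :: "nat \<Rightarrow> (int \<Rightarrow> complex) \<Rightarrow> complex" where
  "gauss_sum q chi = (\<Sum>k=1..q. chi (int k) * exp (2 * of_real pi * \<i> * of_nat k / of_nat q))"

text \<open>
  The value at \<open>s\<close> of the analytic continuation of the Dirichlet series
  to a half-plane containing \<open>s\<close>, where a singularity is allowed only at \<open>1\<close>. The value is unique
  by the identity theorem. For a principal character, which has a pole at \<open>1\<close>, the value at
  \<open>1\<close> is unspecified.
\<close>

definition dirichlet_L :: "(int \<Rightarrow> complex) \<Rightarrow> complex \<Rightarrow> complex" where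
  "dirichlet_L chi s =
     (THE z. \<exists>F c P. P \<subseteq> {1} \<and> s \<in> {w. Re w > c} - P \<and>
        F holomorphic_on ({w. Re w > c} - P) \<and>
        (\<forall>w. Re w > 1 \<longrightarrow> (\<lambda>n. chi (int (Suc n)) / of_nat (Suc n) powr w) sums F w) \<and>
        z = F s)"

definition generalized_riemann_hypothesis :: bool where
  "generalized_riemann_hypothesis \<longleftrightarrow>
     (\<forall>q chi s. dirichlet_character q chi \<longrightarrow> 0 < Re s \<longrightarrow> Re s < 1 \<longrightarrow>
        dirichlet_L chi s = 0 \<longrightarrow> Re s = 1 / 2)"

definition char_A :: "nat \<Rightarrow> (int \<Rightarrow> complex) \<Rightarrow> complex" where
  "char_A q chi = (1 - chi (-1)) * gauss_sum q chi / (2 * of_real pi * \<i>)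
                  * dirichlet_L (\<lambda>n. cnj (chi n)) 1"

end

theory Submission
  imports Defs "HOL-Number_Theory.Number_Theory" "HOL-Computational_Algebra.Squarefree"
    "HOL-Real_Asymp.Real_Asymp"
begin

text \<open>
  Let \<open>s\<close> be the squarefree part of \<open>4 P - 1\<close>, where \<open>P\<close> is the product of the primes up to \<open>y\<close>. By
  quadratic reciprocity the Jacobi symbol modulo \<open>s\<close> is odd and equal to \<open>1\<close> at all positive integers
  up to \<open>y\<close>, while \<open>ln s\<close> is \<open>O(y)\<close>. Let \<open>chi\<close> be its product with \<open>psi\<close>, and \<open>q = b s\<close>.

  Up to the factor \<open>\<tau>(chi) / (2 \<pi> i)\<close>, the Fourier coefficients of \<open>S_chi(\<alpha> q) - A(chi)\<close> are
  conjugates of \<open>chi(n) / n\<close>. Averaging \<open>\<alpha>\<close> over an interval of length about \<open>1 / y\<close> around \<open>a / b\<close>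
  suppresses the terms with \<open>n > y\<close>. For \<open>n \<le> y\<close>, \<open>chi\<close> may be replaced by \<open>psi\<close>; since the parities
  are opposite, the terms \<open>n\<close> and \<open>-n\<close> reinforce each other, and the sum is \<open>2 ln y / sqrt b\<close> in
  absolute value up to \<open>O(1)\<close>, by the evaluation of the Gauss sum of \<open>psi\<close>.

  Under GRH, the logarithm of \<open>L(s, chi) / L(s, psi)\<close> is \<open>O(1)\<close> for \<open>Re s \<ge> 1 + 1 / ln y\<close>, as the Euler
  factors up to \<open>y\<close> cancel, and \<open>O(y)\<close> on a larger disc by the Borel-Caratheodory theorem. Hadamard's
  three circles theorem then bounds it at \<open>s = 1\<close>.
\<close>

section \<open>Dirichlet characters\<close>

text \<open>Nothing is known about chi(n) for n > y, and this shapes both halves. At a single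
  \<alpha>, coefficients of size 1/n beyond y are out of control; integration gains a second factor
  1/n, so the tail is O(1/y), comparable with the length of the interval, and costs O(1) in the
  mean. A large mean forces a large value at some \<alpha>. The growth ln q = O(y) then turns ln y
  into ln ln q and puts the interval within O(1 / ln q) of a / b.

  The number 4 P - 1 is -1 modulo every prime up to y and 7 modulo 8, so reciprocity and both
  supplementary laws give the value 1 without any search for a prime modulus. Its squarefree part
  has the same symbols at these primes, and squarefreeness is what makes the character primitive.

  Under GRH, b > 1 makes psi nonprincipal, so that L(s, psi) has no pole and no zero on the disc
  used. As the hypothesis speaks of 0 < Re s < 1 only, nonvanishing on the relevant part of the line
  Re s = 1, the point 1 included, is proved separately. The characters do not depend on GRH: one
  sequence serves every claim.\<close>

lemma dirichlet_character_cong: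
  assumes "dirichlet_character m chi" "[x = y] (mod int m)"
  shows "chi x = chi y"
proof -
  have per: "chi (x + int m) = chi x" for x
    using assms(1) by (simp add: dirichlet_character_def)
  have *: "chi (x + int m * int k) = chi x" for x k
  proof (induction k)
    case (Suc k)
    have "chi (x + int m * int (Suc k)) = chi ((x + int m * int k) + int m)"
      by (simp add: algebra_simps)
    then show ?case using Suc per by simp
  qed simp
  obtain k where k: "y = x + int m * k"
    using assms(2) by (metis cong_iff_lin)
  show ?thesis
  proof (cases "k \<ge> 0")
    case True
    then show ?thesis using *[of x "nat k"] k by simp
  next
    case False
    then show ?thesis using *[of y "nat (-k)"] k by simp
  qed
qed

lemma dirichlet_character_mult:
  "dirichlet_character m chi \<Longrightarrow> chi (x * y) = chi x * chi y"
  by (simp add: dirichlet_character_def)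

lemma dirichlet_character_eq_0_iff:
  "dirichlet_character m chi \<Longrightarrow> chi x = 0 \<longleftrightarrow> \<not> coprime x (int m)"
  by (metis dirichlet_character_def)

lemma dirichlet_character_one:
  assumes "dirichlet_character m chi"
  shows "chi 1 = 1"
proof -
  have "chi 1 * chi 1 = chi 1 * 1" using dirichlet_character_mult[OF assms, of 1 1] by simp
  moreover have "chi 1 \<noteq> 0" using dirichlet_character_eq_0_iff[OF assms, of 1] by simp
  ultimately show ?thesis using mult_left_cancel by blast
qed

lemma dirichlet_character_power:
  assumes "dirichlet_character m chi"
  shows "chi (x ^ n) = chi x ^ n"
  by (induction n) (simp_all add: dirichlet_character_one[OF assms] dirichlet_character_mult[OF assms])

lemma dirichlet_character_totient:
  assumes "dirichlet_character m chi" "coprime x (int m)"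
  shows "chi x ^ totient m = 1"
proof -
  have m: "m > 0" using assms(1) by (simp add: dirichlet_character_def)
  define y where "y = nat (x mod int m)"
  have y: "int y = x mod int m" using m by (simp add: y_def)
  have "coprime (int y) (int m)" unfolding y using assms(2) m
    by (metis coprime_mod_left_iff of_nat_0_less_iff order_less_irrefl)
  then have "coprime y m" by simp
  then have "[y ^ totient m = 1] (mod m)" by (rule euler_theorem)
  then have "[int y ^ totient m = 1] (mod int m)"
    by (metis cong_int_iff of_nat_1 of_nat_power)
  then have "chi (int y ^ totient m) = 1"
    using dirichlet_character_cong[OF assms(1)] dirichlet_character_one[OF assms(1)] by metis
  moreover have "chi (int y) = chi x"
    by (rule dirichlet_character_cong[OF assms(1)]) (simp add: y cong_def)
  ultimately show ?thesis by (simp add: dirichlet_character_power[OF assms(1)])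
qed

lemma dirichlet_character_norm:
  assumes "dirichlet_character m chi"
  shows "cmod (chi x) = (if coprime x (int m) then 1 else 0)"
proof (cases "coprime x (int m)")
  case True
  have m: "m > 0" using assms(1) by (simp add: dirichlet_character_def)
  have "cmod (chi x) ^ totient m = 1"
    using dirichlet_character_totient[OF assms True] by (metis norm_one norm_power)
  moreover have "totient m > 0" using m by simp
  ultimately have "cmod (chi x) = 1" by (metis norm_ge_zero power_eq_1_iff abs_norm_cancel neq0_conv real_norm_def)
  then show ?thesis using True by simp
next
  case False
  then show ?thesis using dirichlet_character_eq_0_iff[OF assms, of x] by simp
qed

lemma dirichlet_character_norm_le: "dirichlet_character m chi \<Longrightarrow> cmod (chi x) \<le> 1"
  by (simp add: dirichlet_character_norm)

lemma dirichlet_character_cnj: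
  "dirichlet_character m chi \<Longrightarrow> dirichlet_character m (\<lambda>x. cnj (chi x))"
  by (simp add: dirichlet_character_def)

lemma dirichlet_character_mult_cnj:
  assumes "dirichlet_character m chi" "coprime x (int m)"
  shows "chi x * cnj (chi x) = 1"
  using dirichlet_character_norm[OF assms(1), of x] assms(2)
  by (simp add: complex_norm_square[symmetric])

section \<open>A criterion for primitivity, and products of characters\<close>

text \<open>Surjectivity of reduction on units, used to lift residues from a divisor to the full
  modulus. With \<open>k\<close> the product of the primes of \<open>b\<close> not dividing
  \<open>x\<close>, each prime of \<open>b\<close> divides exactly one of \<open>x\<close> and
  \<open>k * d\<close>.\<close>

lemma coprime_translate_exists:
  fixes x d b :: int
  assumes "coprime x d" "b > 0"
  obtains k where "coprime (x + k * d) b"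
proof -
  define k where "k = \<Prod>{p \<in> prime_factors b. \<not> p dvd x}"
  have "coprime (x + k * d) b"
  proof (rule ccontr)
    assume "\<not> coprime (x + k * d) b"
    then have "\<not> is_unit (gcd (x + k * d) b)" by (simp add: coprime_iff_gcd_eq_1)
    moreover have "gcd (x + k * d) b \<noteq> 0" using assms(2) by simp
    ultimately obtain p where "prime p" "p dvd gcd (x + k * d) b"
      using prime_divisor_exists by blast
    then have p: "prime p" "p dvd x + k * d" "p dvd b" by simp_all
    have pf: "p \<in> prime_factors b" using p assms(2) by (simp add: in_prime_factors_iff)
    show False
    proof (cases "p dvd x")
      case True
      then have "p dvd k * d" using p by (simp add: dvd_add_right_iff)
      moreover have "\<not> p dvd d" using True assms(1) p(1) by (meson coprime_common_divisor not_prime_unit)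
      ultimately have "p dvd k" using p(1) by (simp add: prime_dvd_mult_iff)
      then obtain r where r: "r \<in> prime_factors b" "\<not> r dvd x" "p dvd r"
        unfolding k_def using p(1) by (auto simp: prime_dvd_prod_iff)
      have "prime r" using r(1) by (simp add: in_prime_factors_iff)
      then have "p = r" using r(3) p(1) by (simp add: primes_dvd_imp_eq)
      then show False using True r by simp
    next
      case False
      then have "p dvd k" unfolding k_def using pf by (intro dvd_prodI[where f = id, simplified]) auto
      then have "p dvd x" using p by (simp add: dvd_add_left_iff)
      then show False using False by simp
    qed
  qed
  then show ?thesis using that by blast
qed

text \<open>A character that is trivial on the kernel of reduction modulo \<open>d\<close> factors
  through the residues modulo \<open>d\<close>. This form of primitivity is the one used later,
  because it hands over a witness for every proper divisor.\<close>

lemma primitive_character_iff: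
  "primitive_character m chi \<longleftrightarrow> dirichlet_character m chi \<and>
     (\<forall>d. d dvd m \<longrightarrow> d < m \<longrightarrow> (\<exists>x. [x = 1] (mod int d) \<and> coprime x (int m) \<and> chi x \<noteq> 1))"
    (is "_ \<longleftrightarrow> _ \<and> ?K")
proof safe
  assume "primitive_character m chi"
  then show dc: "dirichlet_character m chi" by (simp add: primitive_character_def)
  have m: "m > 0" using dc by (simp add: dirichlet_character_def)
  fix d assume d: "d dvd m" "d < m"
  show "\<exists>x. [x = 1] (mod int d) \<and> coprime x (int m) \<and> chi x \<noteq> 1"
  proof (rule ccontr)
    assume "\<not> ?thesis"
    then have K: "\<And>x. [x = 1] (mod int d) \<Longrightarrow> coprime x (int m) \<Longrightarrow> chi x = 1" by blast
    have d0: "d > 0" using d(1) m by (meson dvd_pos_nat)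
    \<comment> \<open>An inverse \<open>w\<close> of \<open>v\<close> moves the comparison into the
      kernel: both \<open>u * w\<close> and \<open>v * w\<close> are 1 modulo
      \<open>d\<close>.\<close>
    have wd: "chi u = chi v" if uv: "[u = v] (mod int d)" "coprime u (int m)" "coprime v (int m)" for u v
    proof -
      obtain w where w: "[v * w = 1] (mod int m)" using uv(3) cong_solve_coprime_int by blast
      have cw: "coprime w (int m)" using w
        by (metis coprime_iff_invertible_int mult.commute)
      have vw: "[v * w = 1] (mod int d)" using w d(1) by (meson cong_dvd_modulus of_nat_dvd_iff)
      have "[u * w = v * w] (mod int d)" using uv(1) by (simp add: cong_scalar_right)
      then have "[u * w = 1] (mod int d)" using vw cong_trans by blast
      then have "chi (u * w) = 1" using K uv(2) cw by simp
      moreover have "chi (v * w) = 1" using K[OF vw] uv(3) cw by simp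
      moreover have "chi w \<noteq> 0" using cw dirichlet_character_eq_0_iff[OF dc] by blast
      ultimately show ?thesis by (metis dirichlet_character_mult[OF dc] mult_right_cancel)
    qed
    \<comment> \<open>A lift that is a unit modulo \<open>m\<close>; by \<open>wd\<close> the value
      of \<open>chi\<close> does not depend on the lift chosen.\<close>
    define lf where "lf x = (SOME u. [u = x] (mod int d) \<and> coprime u (int m))" for x
    have lf: "[lf x = x] (mod int d)" "coprime (lf x) (int m)" if cx: "coprime x (int d)" for x
    proof -
      obtain k where "coprime (x + k * int d) (int m)"
        using coprime_translate_exists[OF cx, of "int m"] m by auto
      moreover have "[x + k * int d = x] (mod int d)" by (simp add: cong_def)
      ultimately have "\<exists>u. [u = x] (mod int d) \<and> coprime u (int m)" by blast
      from someI_ex[OF this] show "[lf x = x] (mod int d)" "coprime (lf x) (int m)"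
        by (auto simp: lf_def)
    qed
    define chi' where "chi' x = (if coprime x (int d) then chi (lf x) else 0)" for x
    have "dirichlet_character d chi'"
      unfolding dirichlet_character_def
    proof (intro conjI allI)
      show "0 < d" by fact
    next
      fix x y
      show "chi' (x * y) = chi' x * chi' y"
      proof (cases "coprime x (int d) \<and> coprime y (int d)")
        case True
        then have "coprime (x * y) (int d)" by simp
        have "chi (lf (x * y)) = chi (lf x * lf y)"
        proof (rule wd)
          have "[lf x * lf y = x * y] (mod int d)" using lf True by (intro cong_mult) auto
          then show "[lf (x * y) = lf x * lf y] (mod int d)"
            using lf(1)[OF \<open>coprime (x * y) (int d)\<close>] cong_trans cong_sym by blast
        qed (use lf(2) True \<open>coprime (x * y) (int d)\<close> in auto)
        then show ?thesis using True by (simp add: chi'_def dirichlet_character_mult[OF dc])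
      next
        case False
        then show ?thesis by (auto simp: chi'_def)
      qed
    next
      fix x
      have c: "coprime (x + int d) (int d) = coprime x (int d)"
        by (metis add.commute coprime_add_one_left coprime_iff_gcd_eq_1 gcd_add1)
      show "chi' (x + int d) = chi' x"
      proof (cases "coprime x (int d)")
        case True
        have "[lf (x + int d) = lf x] (mod int d)"
          using lf(1)[of x] lf(1)[of "x + int d"] True c
          by (metis cong_def mod_add_self2)
        then have "chi (lf (x + int d)) = chi (lf x)"
          by (rule wd) (use lf(2) True c in auto)
        then show ?thesis using c by (simp add: chi'_def)
      qed (simp add: chi'_def c)
    next
      fix x show "(chi' x \<noteq> 0) = coprime x (int d)"
        using lf(2)[of x] dirichlet_character_eq_0_iff[OF dc] by (auto simp: chi'_def)
    qed
    moreover have "chi x = chi' x" if "coprime x (int m)" for x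
    proof -
      have "coprime x (int d)" using that d(1)
        by (meson coprime_divisors dvd_refl of_nat_dvd_iff)
      then show ?thesis using lf that wd[of x "lf x"] by (simp add: chi'_def cong_sym)
    qed
    ultimately show False using \<open>primitive_character m chi\<close> d
      unfolding primitive_character_def by blast
  qed
next
  assume dc: "dirichlet_character m chi" and K: ?K
  show "primitive_character m chi"
    unfolding primitive_character_def
  proof safe
    fix d chi' assume d: "d dvd m" "d < m" and dc': "dirichlet_character d chi'"
      and eq: "\<forall>x. coprime x (int m) \<longrightarrow> chi x = chi' x"
    obtain x where x: "[x = 1] (mod int d)" "coprime x (int m)" "chi x \<noteq> 1" using K d by blast
    then show False using eq dirichlet_character_cong[OF dc' x(1)] dirichlet_character_one[OF dc']
      by simp
  qed (fact dc)
qed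

lemma dirichlet_character_product:
  assumes "dirichlet_character b psi" "dirichlet_character n xi"
  shows "dirichlet_character (b * n) (\<lambda>x. psi x * xi x)"
  unfolding dirichlet_character_def
proof (intro conjI allI)
  fix x
  have "psi (x + int (b * n)) = psi x"
    by (rule dirichlet_character_cong[OF assms(1)]) (simp add: cong_def)
  moreover have "xi (x + int (b * n)) = xi x"
    by (rule dirichlet_character_cong[OF assms(2)]) (simp add: cong_def)
  ultimately show "psi (x + int (b * n)) * xi (x + int (b * n)) = psi x * xi x" by simp
  show "(psi x * xi x \<noteq> 0) = coprime x (int (b * n))"
    using dirichlet_character_eq_0_iff[OF assms(1)] dirichlet_character_eq_0_iff[OF assms(2)]
    by auto
qed (use assms in \<open>auto simp: dirichlet_character_def\<close>)

text \<open>By the Chinese remainder theorem the arguments of the two factors can be prescribed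
  independently, which separates the factors of a product character.\<close>

lemma dirichlet_character_product_select:
  assumes "dirichlet_character b psi" "dirichlet_character n xi" "coprime b n"
    and "coprime u (int b)" "coprime v (int n)"
  obtains x where "[x = u] (mod int b)" "[x = v] (mod int n)" "coprime x (int (b * n))"
    "psi x * xi x = psi u * xi v"
proof -
  obtain x where x: "[x = u] (mod int b)" "[x = v] (mod int n)"
    using binary_chinese_remainder_int[of "int b" "int n" u v] assms(3) by auto
  have "coprime x (int b)" "coprime x (int n)"
    using x assms(4,5) cong_imp_coprime cong_sym by blast+
  then have "coprime x (int (b * n))" by simp
  moreover have "psi x = psi u" "xi x = xi v"
    using x dirichlet_character_cong assms(1,2) by blast+
  ultimately show ?thesis using that x by simp
qed

text \<open>A proper divisor of \<open>b * n\<close> is a product of divisors of \<open>b\<close>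
  and \<open>n\<close>, at least one of them proper. The witness for that factor is combined with 1
  in the other.\<close>

lemma primitive_character_product:
  assumes "primitive_character b psi" "primitive_character n xi" "coprime b n"
  shows "primitive_character (b * n) (\<lambda>x. psi x * xi x)"
  unfolding primitive_character_iff
proof safe
  have dcp: "dirichlet_character b psi" and dcx: "dirichlet_character n xi"
    using assms by (auto simp: primitive_character_def)
  show "dirichlet_character (b * n) (\<lambda>x. psi x * xi x)"
    using dcp dcx by (rule dirichlet_character_product)
  have b: "b > 0" "n > 0" using dcp dcx by (auto simp: dirichlet_character_def)
  fix d assume d: "d dvd b * n" "d < b * n"
  obtain d1 d2 where d12: "d = d1 * d2" "d1 dvd b" "d2 dvd n"
    using division_decomp[OF d(1)] by blast
  have cop: "coprime (int d1) (int d2)" using d12 assms(3)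
    by (metis coprime_divisors coprime_int_iff)
  have "d1 \<le> b" "d2 \<le> n" using d12 b by (auto intro: dvd_imp_le)
  then consider "d1 < b" | "d2 < n" using d d12(1) by fastforce
  then show "\<exists>x. [x = 1] (mod int d) \<and> coprime x (int (b * n)) \<and> psi x * xi x \<noteq> 1"
  proof cases
    case 1
    obtain u where u: "[u = 1] (mod int d1)" "coprime u (int b)" "psi u \<noteq> 1"
      using assms(1) 1 d12(2) unfolding primitive_character_iff by blast
    obtain x where x: "[x = u] (mod int b)" "[x = 1] (mod int n)" "coprime x (int (b * n))"
      "psi x * xi x = psi u * xi 1"
      using dirichlet_character_product_select[OF dcp dcx assms(3) u(2), of 1] by auto
    have "[x = 1] (mod int d1)" "[x = 1] (mod int d2)"
      using x u(1) d12 by (meson cong_dvd_modulus cong_trans of_nat_dvd_iff)+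
    then have "[x = 1] (mod int d)" using cop by (simp add: d12(1) coprime_cong_mult)
    then show ?thesis using x u dirichlet_character_one[OF dcx] by auto
  next
    case 2
    obtain u where u: "[u = 1] (mod int d2)" "coprime u (int n)" "xi u \<noteq> 1"
      using assms(2) 2 d12(3) unfolding primitive_character_iff by blast
    obtain x where x: "[x = 1] (mod int b)" "[x = u] (mod int n)" "coprime x (int (b * n))"
      "psi x * xi x = psi 1 * xi u"
      using dirichlet_character_product_select[OF dcp dcx assms(3) _ u(2), of 1] by auto
    have "[x = 1] (mod int d1)" "[x = 1] (mod int d2)"
      using x u(1) d12 by (meson cong_dvd_modulus cong_trans of_nat_dvd_iff)+
    then have "[x = 1] (mod int d)" using cop by (simp add: d12(1) coprime_cong_mult)
    then show ?thesis using x u dirichlet_character_one[OF dcp] by auto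
  qed
qed

section \<open>Orders of characters\<close>

text \<open>The LEAST in \<open>character_order\<close> is attained, since Euler's theorem makes
  \<open>totient m\<close> an admissible exponent. Division with remainder then turns minimality
  into divisibility, from which the order of a product is read off as an lcm.\<close>

lemma character_order_properties:
  assumes "dirichlet_character m chi"
  shows "character_order m chi > 0"
    and "(\<forall>x. coprime x (int m) \<longrightarrow> chi x ^ k = 1) \<longleftrightarrow> character_order m chi dvd k"
proof -
  have m: "m > 0" using assms by (simp add: dirichlet_character_def)
  define P where "P k \<longleftrightarrow> k > 0 \<and> (\<forall>x. chi x ^ k = principal_character m x)" for k
  have P_iff: "P k \<longleftrightarrow> k > 0 \<and> (\<forall>x. coprime x (int m) \<longrightarrow> chi x ^ k = 1)" for k
    unfolding P_def principal_character_def
    using dirichlet_character_eq_0_iff[OF assms] by (auto simp: power_0_left)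
  have "P (totient m)" unfolding P_iff using dirichlet_character_totient[OF assms] m by simp
  then have L: "P (character_order m chi)"
    unfolding character_order_def P_def[symmetric] by (rule LeastI)
  have least: "P j \<Longrightarrow> character_order m chi \<le> j" for j
    unfolding character_order_def P_def[symmetric] by (rule Least_le)
  let ?g = "character_order m chi"
  show g0: "?g > 0" using L P_iff by blast
  show "(\<forall>x. coprime x (int m) \<longrightarrow> chi x ^ k = 1) \<longleftrightarrow> ?g dvd k"
  proof
    assume k: "\<forall>x. coprime x (int m) \<longrightarrow> chi x ^ k = 1"
    have "chi x ^ (k mod ?g) = 1" if "coprime x (int m)" for x
    proof -
      have "chi x ^ k = (chi x ^ ?g) ^ (k div ?g) * chi x ^ (k mod ?g)"
        by (simp add: power_mult[symmetric] power_add[symmetric])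
      then show ?thesis using L k that by (simp add: P_iff)
    qed
    then have "k mod ?g = 0" using least[of "k mod ?g"] g0 unfolding P_iff
      by (meson mod_less_divisor not_gr_zero not_less)
    then show "?g dvd k" by auto
  next
    assume "?g dvd k"
    then show "\<forall>x. coprime x (int m) \<longrightarrow> chi x ^ k = 1"
      using L by (auto simp: P_iff power_mult elim!: dvdE)
  qed
qed

lemma character_order_product:
  assumes "dirichlet_character b psi" "dirichlet_character n xi" "coprime b n"
  shows "character_order (b * n) (\<lambda>x. psi x * xi x)
           = lcm (character_order b psi) (character_order n xi)"
proof (rule dvd_antisym)
  let ?o = "character_order (b * n) (\<lambda>x. psi x * xi x)"
  note dc = dirichlet_character_product[OF assms(1,2)]
  have o: "\<And>x. coprime x (int (b * n)) \<Longrightarrow> (psi x * xi x) ^ ?o = 1"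
    using character_order_properties(2)[OF dc, of ?o] by simp
  have "\<forall>u. coprime u (int b) \<longrightarrow> psi u ^ ?o = 1"
  proof safe
    fix u assume "coprime u (int b)"
    then obtain x where "coprime x (int (b * n))" "psi x * xi x = psi u * xi 1"
      using dirichlet_character_product_select[OF assms(1-3), of u 1] by auto
    then show "psi u ^ ?o = 1" using o[of x] dirichlet_character_one[OF assms(2)] by simp
  qed
  moreover have "\<forall>u. coprime u (int n) \<longrightarrow> xi u ^ ?o = 1"
  proof safe
    fix u assume "coprime u (int n)"
    then obtain x where "coprime x (int (b * n))" "psi x * xi x = psi 1 * xi u"
      using dirichlet_character_product_select[OF assms(1-3), of 1 u] by auto
    then show "xi u ^ ?o = 1" using o[of x] dirichlet_character_one[OF assms(1)] by simp
  qed
  ultimately show "lcm (character_order b psi) (character_order n xi) dvd ?o"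
    using character_order_properties(2)[OF assms(1)] character_order_properties(2)[OF assms(2)]
    by (simp add: lcm_least)
  let ?l = "lcm (character_order b psi) (character_order n xi)"
  have "\<forall>x. coprime x (int b) \<longrightarrow> psi x ^ ?l = 1" "\<forall>x. coprime x (int n) \<longrightarrow> xi x ^ ?l = 1"
    using character_order_properties(2)[OF assms(1)] character_order_properties(2)[OF assms(2)]
    by auto
  then have "\<forall>x. coprime x (int (b * n)) \<longrightarrow> (psi x * xi x) ^ ?l = 1"
    by (simp add: power_mult_distrib)
  then show "?o dvd ?l" using character_order_properties(2)[OF dc] by blast
qed


section \<open>Gauss sums\<close>

text \<open>Passes from the range 1..q of \<open>gauss_sum\<close> to the representatives 0..q-1, on
  which multiplication modulo \<open>q\<close> acts; the index \<open>q\<close> becomes 0.\<close>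

lemma sum_period_residues:
  fixes f :: "int \<Rightarrow> complex"
  assumes "q > 0" "\<And>x y. [x = y] (mod int q) \<Longrightarrow> f x = f y"
  shows "(\<Sum>k=1..q. f (int k)) = (\<Sum>x\<in>{0..<int q}. f x)"
proof (rule sum.reindex_bij_witness[where i = "\<lambda>x. if x = 0 then q else nat x"
      and j = "\<lambda>k. if k = q then 0 else int k"])
  fix k assume "k \<in> {1..q}"
  show "f (if k = q then 0 else int k) = f (int k)"
    using assms(2)[of 0 "int q"] by (auto simp: cong_def)
qed (use assms(1) in \<open>auto split: if_splits\<close>)

lemma sum_residues_mult:
  fixes f :: "int \<Rightarrow> complex"
  assumes "q > 0" "\<And>x y. [x = y] (mod int q) \<Longrightarrow> f x = f y" "coprime u (int q)"
  shows "(\<Sum>x\<in>{0..<int q}. f (u * x)) = (\<Sum>x\<in>{0..<int q}. f x)"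
proof -
  obtain w where w: "[u * w = 1] (mod int q)" using assms(3) cong_solve_coprime_int by blast
  have 1: "[w * (u * x) = x] (mod int q)" for x
    using cong_scalar_right[OF w, of x] by (simp add: algebra_simps)
  have 2: "[u * (w * x) = x] (mod int q)" for x
    using cong_scalar_right[OF w, of x] by (simp add: algebra_simps)
  show ?thesis
  proof (rule sum.reindex_bij_witness[where i = "\<lambda>x. (w * x) mod int q"
        and j = "\<lambda>x. (u * x) mod int q"])
    fix x assume x: "x \<in> {0..<int q}"
    show "(w * (u * x mod int q)) mod int q = x"
      using 1[of x] x by (simp add: cong_def mod_mult_right_eq)
    show "(u * (w * x mod int q)) mod int q = x"
      using 2[of x] x by (simp add: cong_def mod_mult_right_eq)
    show "f (u * x mod int q) = f (u * x)"
      by (rule assms(2)) (simp add: cong_def)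
  qed (use assms(1) in auto)
qed

definition unit_exp :: "real \<Rightarrow> complex" where
  "unit_exp t = cis (2 * pi * t)"

lemma unit_exp_add: "unit_exp (s + t) = unit_exp s * unit_exp t"
  by (simp add: unit_exp_def cis_mult ring_distribs)

lemma unit_exp_of_int [simp]: "unit_exp (of_int n) = 1"
  by (simp add: unit_exp_def cis_multiple_2pi)

lemma norm_unit_exp [simp]: "cmod (unit_exp t) = 1"
  by (simp add: unit_exp_def)

lemma cnj_unit_exp: "cnj (unit_exp t) = unit_exp (- t)"
  by (simp add: unit_exp_def cis_cnj)

lemma unit_exp_cong:
  assumes "q > 0" "[x = y] (mod int q)"
  shows "unit_exp (of_int (n * x) / of_nat q) = unit_exp (of_int (n * y) / of_nat q)"
proof -
  obtain k where k: "y = x + int q * k" using assms(2) by (metis cong_iff_lin)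
  have "of_int (n * y) / of_nat q = of_int (n * x) / real q + of_int (n * k)"
    using assms(1) by (simp add: k field_simps)
  then show ?thesis by (simp only: unit_exp_add unit_exp_of_int mult_1_right)
qed

lemma sum_unit_exp_residues:
  assumes "q > 0"
  shows "(\<Sum>n\<in>{0..<int q}. unit_exp (of_int (n * j) / of_nat q)) = (if int q dvd j then of_nat q else 0)"
proof (cases "int q dvd j")
  case True
  then obtain k where k: "j = int q * k" by auto
  have "unit_exp (of_int (n * j) / of_nat q) = 1" for n
  proof -
    have "of_int (n * j) / real q = of_int (n * k)" using assms by (simp add: k)
    then show ?thesis by (simp only: unit_exp_of_int)
  qed
  then show ?thesis using True by simp
next
  case False
  define f where "f n = unit_exp (of_int (n * j) / of_nat q)" for n
  have per: "f x = f y" if "[x = y] (mod int q)" for x y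
    using unit_exp_cong[OF assms that, of j] by (simp add: f_def mult.commute)
  \<comment> \<open>Shifting by 1 multiplies the sum by the root of unity \<open>f 1\<close>, which
    differs from 1, yet leaves the sum unchanged.\<close>
  have shift: "(\<Sum>n\<in>{0..<int q}. f (n + 1)) = (\<Sum>n\<in>{0..<int q}. f n)"
  proof (rule sum.reindex_bij_witness[where i = "\<lambda>x. (x - 1) mod int q" and j = "\<lambda>x. (x + 1) mod int q"])
    fix x assume x: "x \<in> {0..<int q}"
    show "((x + 1) mod int q - 1) mod int q = x" "((x - 1) mod int q + 1) mod int q = x"
      using x by (simp_all add: mod_diff_left_eq mod_add_left_eq)
    show "f ((x + 1) mod int q) = f (x + 1)" by (rule per) (simp add: cong_def)
  qed (use assms in auto)
  have "f (n + 1) = f n * f 1" for n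
    by (simp add: f_def unit_exp_add[symmetric] add_divide_distrib ring_distribs)
  then have "(\<Sum>n\<in>{0..<int q}. f n) * f 1 = (\<Sum>n\<in>{0..<int q}. f n)"
    using shift by (simp add: sum_distrib_right)
  moreover have "f 1 \<noteq> 1"
  proof
    assume "f 1 = 1"
    then have "cos (2 * pi * (of_int j / of_nat q)) = 1"
      by (metis (no_types, lifting) Re_complex_of_real cis.sel(1) f_def mult_1 of_real_1 unit_exp_def)
    then obtain k :: int where "2 * pi * (of_int j / of_nat q) = of_int k * 2 * pi"
      by (auto simp: cos_one_2pi_int)
    then have "real_of_int j = of_int (int q * k)" using assms by (simp add: field_simps)
    then have "j = int q * k" by (simp only: of_int_eq_iff)
    then show False using False by simp
  qed
  ultimately show ?thesis using False by (simp add: f_def)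
qed

lemma gauss_sum_residues:
  assumes "dirichlet_character q chi"
  shows "gauss_sum q chi = (\<Sum>x\<in>{0..<int q}. chi x * unit_exp (of_int x / of_nat q))"
proof -
  have q: "q > 0" using assms by (simp add: dirichlet_character_def)
  have "gauss_sum q chi = (\<Sum>k=1..q. chi (int k) * unit_exp (of_int (int k) / of_nat q))"
    unfolding gauss_sum_def unit_exp_def
    by (intro sum.cong refl) (simp add: cis_conv_exp mult_ac)
  also have "\<dots> = (\<Sum>x\<in>{0..<int q}. chi x * unit_exp (of_int x / of_nat q))"
    by (rule sum_period_residues[OF q])
      (use dirichlet_character_cong[OF assms] unit_exp_cong[OF q, of _ _ 1] in auto)
  finally show ?thesis .
qed

text \<open>For \<open>n\<close> prime to \<open>q\<close> this is a change of variable. For the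
  other \<open>n\<close> the right side is 0, and it is primitivity that makes the left side vanish
  as well. Every Fourier coefficient of the character sum is evaluated by it.\<close>

lemma gauss_sum_twisted:
  assumes "primitive_character q chi"
  shows "(\<Sum>x\<in>{0..<int q}. chi x * unit_exp (of_int (n * x) / of_nat q)) = cnj (chi n) * gauss_sum q chi"
proof -
  have dc: "dirichlet_character q chi" using assms by (simp add: primitive_character_def)
  have q: "q > 0" using dc by (simp add: dirichlet_character_def)
  define f where "f x = chi x * unit_exp (of_int (n * x) / of_nat q)" for x
  have per: "f x = f y" if "[x = y] (mod int q)" for x y
    using dirichlet_character_cong[OF dc that] unit_exp_cong[OF q that] by (simp add: f_def)
  show ?thesis
  proof (cases "coprime n (int q)")
    case True
    have "chi n * (\<Sum>x\<in>{0..<int q}. f x)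
        = (\<Sum>x\<in>{0..<int q}. chi (n * x) * unit_exp (of_int (n * x) / of_nat q))"
      by (simp add: f_def sum_distrib_left dirichlet_character_mult[OF dc] mult_ac)
    also have "\<dots> = gauss_sum q chi"
      unfolding gauss_sum_residues[OF dc]
      by (rule sum_residues_mult[OF q _ True, where f = "\<lambda>x. chi x * unit_exp (of_int x / of_nat q)"])
        (use dirichlet_character_cong[OF dc] unit_exp_cong[OF q, of _ _ 1] in auto)
    finally have "cnj (chi n) * (chi n * (\<Sum>x\<in>{0..<int q}. f x)) = cnj (chi n) * gauss_sum q chi"
      by simp
    moreover have "cnj (chi n) * chi n = 1"
      using dirichlet_character_mult_cnj[OF dc True] by (simp add: mult.commute)
    ultimately show ?thesis by (simp add: f_def mult.assoc[symmetric])
  next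
    case False
    \<comment> \<open>Here the exponential depends on \<open>x\<close> modulo
      \<open>e = q / g\<close> only. A unit \<open>u\<close> that is 1 modulo \<open>e\<close> with
      \<open>chi u \<noteq> 1\<close> leaves the sum unchanged and multiplies it by
      \<open>chi u\<close>.\<close>
    define g where "g = gcd n (int q)"
    have g: "g > 0" "g dvd n" "g dvd int q" using q by (auto simp: g_def)
    have "g \<noteq> 1" using False by (simp add: g_def coprime_iff_gcd_eq_1)
    obtain e where e: "int q = g * int e"
      using g q by (metis dvdE of_nat_0_less_iff pos_int_cases zero_less_mult_pos)
    obtain h where h: "n = g * h" using g by auto
    have "1 < g" using g \<open>g \<noteq> 1\<close> by simp
    moreover have "int e > 0" using e q by (cases "e = 0") auto
    ultimately have "1 * int e < g * int e" by (rule mult_strict_right_mono)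
    then have "int e < int q" using e by simp
    moreover have "e dvd q" using e by (metis dvd_triv_right of_nat_dvd_iff)
    ultimately obtain u where u: "[u = 1] (mod int e)" "coprime u (int q)" "chi u \<noteq> 1"
      using assms unfolding primitive_character_iff by auto
    have "[n * (u * x) = n * x] (mod int q)" for x
    proof -
      have "int e dvd u - 1" using u(1) by (simp add: cong_iff_dvd_diff)
      then obtain k where "u - 1 = int e * k" by auto
      then have "u = int e * k + 1" by simp
      then have "n * (u * x) - n * x = g * h * ((int e * k + 1) * x) - g * h * x"
        by (simp only: h)
      also have "\<dots> = int q * (h * k * x)"
        unfolding e by (simp add: algebra_simps)
      finally have "n * (u * x) - n * x = int q * (h * k * x)" .
      then show ?thesis by (simp add: cong_iff_dvd_diff)
    qed
    then have "unit_exp (of_int (n * (u * x)) / of_nat q) = unit_exp (of_int (n * x) / of_nat q)" for x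
      using unit_exp_cong[OF q, of "n * (u * x)" "n * x" 1] by (simp only: mult_1)
    then have "f (u * x) = chi u * f x" for x
      by (simp add: f_def dirichlet_character_mult[OF dc])
    then have "chi u * (\<Sum>x\<in>{0..<int q}. f x) = (\<Sum>x\<in>{0..<int q}. f x)"
      using sum_residues_mult[OF q _ u(2), of f] per by (simp add: sum_distrib_left)
    then have "(\<Sum>x\<in>{0..<int q}. f x) = 0" using u(3) by simp
    then show ?thesis using False dirichlet_character_eq_0_iff[OF dc, of n] by (simp add: f_def)
  qed
qed

text \<open>The square sum of \<open>G n\<close> over all residues is computed by orthogonality and
  again by \<open>gauss_sum_twisted\<close>; both results contain the number of units \<phi>, which
  cancels.\<close>

lemma norm_gauss_sum:
  assumes "primitive_character q chi"
  shows "cmod (gauss_sum q chi) = sqrt (real q)"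
proof -
  have dc: "dirichlet_character q chi" using assms by (simp add: primitive_character_def)
  have q: "q > 0" using dc by (simp add: dirichlet_character_def)
  let ?R = "{0..<int q}" and ?\<tau> = "gauss_sum q chi"
  define \<phi> where "\<phi> = (\<Sum>x\<in>?R. chi x * cnj (chi x))"
  define G where "G n = (\<Sum>x\<in>?R. chi x * unit_exp (of_int (n * x) / of_nat q))" for n
  have "\<phi> = (\<Sum>x\<in>?R. of_real ((cmod (chi x))\<^sup>2))"
    unfolding \<phi>_def by (simp only: complex_norm_square)
  then have phi: "\<phi> = of_real (\<Sum>x\<in>?R. (cmod (chi x))\<^sup>2)" by simp
  \<comment> \<open>Written as \<open>1 mod int q\<close> because for \<open>q = 1\<close> the only
    residue is 0.\<close>
  have "1 mod int q \<in> ?R" "cmod (chi (1 mod int q)) = 1"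
    using q dirichlet_character_cong[OF dc, of "1 mod int q" 1] dirichlet_character_one[OF dc]
    by (auto simp: cong_def)
  then have "(\<Sum>x\<in>?R. (cmod (chi x))\<^sup>2) > 0"
    by (intro sum_pos2[of _ "1 mod int q"]) auto
  then have phi0: "\<phi> \<noteq> 0" unfolding phi by (metis of_real_eq_0_iff order_less_irrefl)
  have "(\<Sum>n\<in>?R. G n * cnj (G n))
      = (\<Sum>n\<in>?R. \<Sum>x\<in>?R. \<Sum>y\<in>?R. chi x * cnj (chi y) * unit_exp (of_int (n * (x - y)) / of_nat q))"
    unfolding G_def cnj_sum sum_product
  proof (intro sum.cong refl)
    fix n x y
    have "of_int (n * (x - y)) / real q = of_int (n * x) / real q + - (of_int (n * y) / real q)"
      by (simp add: diff_divide_distrib ring_distribs)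
    then show "chi x * unit_exp (of_int (n * x) / of_nat q) * cnj (chi y * unit_exp (of_int (n * y) / of_nat q))
        = chi x * cnj (chi y) * unit_exp (of_int (n * (x - y)) / of_nat q)"
      by (simp only: unit_exp_add complex_cnj_mult cnj_unit_exp mult_ac)
  qed
  also have "\<dots> = (\<Sum>x\<in>?R. \<Sum>y\<in>?R. \<Sum>n\<in>?R. chi x * cnj (chi y) * unit_exp (of_int (n * (x - y)) / of_nat q))"
    by (rule trans[OF sum.swap], rule sum.cong[OF refl], rule sum.swap)
  also have "\<dots> = (\<Sum>x\<in>?R. \<Sum>y\<in>?R. chi x * cnj (chi y) * (if x = y then of_nat q else 0))"
  proof (intro sum.cong refl)
    fix x y assume xy: "x \<in> ?R" "y \<in> ?R"
    have "int q dvd x - y \<longleftrightarrow> x = y"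
      using xy by (metis atLeastLessThan_iff cong_iff_dvd_diff cong_less_imp_eq_int cong_refl)
    then show "(\<Sum>n\<in>?R. chi x * cnj (chi y) * unit_exp (of_int (n * (x - y)) / of_nat q))
        = chi x * cnj (chi y) * (if x = y then of_nat q else 0)"
      using sum_unit_exp_residues[OF q, of "x - y"] by (simp add: sum_distrib_left[symmetric])
  qed
  also have "\<dots> = of_nat q * \<phi>"
    by (simp add: \<phi>_def sum_distrib_left if_distrib[of "\<lambda>z. _ * z"] sum.delta' mult_ac cong: if_cong)
  finally have "(\<Sum>n\<in>?R. G n * cnj (G n)) = of_nat q * \<phi>" .
  moreover have "(\<Sum>n\<in>?R. G n * cnj (G n)) = ?\<tau> * cnj ?\<tau> * \<phi>"
    unfolding G_def gauss_sum_twisted[OF assms] \<phi>_def by (simp add: sum_distrib_left mult_ac)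
  ultimately have "?\<tau> * cnj ?\<tau> = of_nat q" using phi0 by simp
  then have "complex_of_real ((cmod ?\<tau>)\<^sup>2) = of_real (real q)" by (simp only: complex_norm_square) simp
  then have "(cmod ?\<tau>)\<^sup>2 = real q" by (simp only: of_real_eq_iff)
  then show ?thesis by (metis norm_ge_zero real_sqrt_unique)
qed

section \<open>Jacobi symbols\<close>

lemma Legendre_eq_0_iff: "Legendre a p = 0 \<longleftrightarrow> p dvd a"
  by (simp add: Legendre_def cong_0_iff)

lemma Legendre_cong:
  assumes "[a = b] (mod p)"
  shows "Legendre a p = Legendre b p"
proof -
  have "[a = 0] (mod p) \<longleftrightarrow> [b = 0] (mod p)" "QuadRes p a \<longleftrightarrow> QuadRes p b"
    using assms unfolding QuadRes_def by (meson cong_sym cong_trans)+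
  then show ?thesis by (simp add: Legendre_def)
qed

lemma Legendre_values: "Legendre a p \<in> {-1, 0, 1}"
  by (simp add: Legendre_def)

text \<open>Two numbers in {-1, 0, 1} differ by at most 2 < p, so Euler's criterion, a congruence
  modulo p, determines the symbol exactly.\<close>

lemma Legendre_eqI:
  fixes e :: int
  assumes "prime p" "2 < p" "e \<in> {-1, 0, 1}" "[e = a ^ ((p - 1) div 2)] (mod int p)"
  shows "Legendre a (int p) = e"
proof -
  have "[Legendre a (int p) = e] (mod int p)"
    using euler_criterion[OF assms(1,2), of a] assms(4) cong_sym cong_trans by blast
  then have "int p dvd Legendre a (int p) - e" by (simp add: cong_iff_dvd_diff)
  moreover have "\<bar>Legendre a (int p) - e\<bar> \<le> 2"
    using Legendre_values[of a "int p"] assms(3) by auto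
  ultimately show ?thesis
    using assms(2) dvd_imp_le_int[of "Legendre a (int p) - e" "int p"] by force
qed

lemma Legendre_mult:
  assumes "prime p" "2 < p"
  shows "Legendre (a * b) (int p) = Legendre a (int p) * Legendre b (int p)"
proof (rule Legendre_eqI[OF assms])
  show "Legendre a (int p) * Legendre b (int p) \<in> {-1, 0, 1}"
    using Legendre_values[of a "int p"] Legendre_values[of b "int p"] by auto
  show "[Legendre a (int p) * Legendre b (int p) = (a * b) ^ ((p - 1) div 2)] (mod int p)"
    unfolding power_mult_distrib by (intro cong_mult euler_criterion assms)
qed

lemma Legendre_one:
  assumes "prime p" "2 < p"
  shows "Legendre 1 (int p) = 1"
  by (rule Legendre_eqI[OF assms]) auto

lemma Legendre_minus_one:
  assumes "prime p" "2 < p"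
  shows "Legendre (-1) (int p) = (-1) ^ ((p - 1) div 2)"
  by (rule Legendre_eqI[OF assms]) (auto simp: minus_one_power_iff)

lemma Legendre_prod:
  assumes "prime p" "2 < p"
  shows "Legendre (\<Prod>x\<in>A. f x) (int p) = (\<Prod>x\<in>A. Legendre (f x) (int p))"
  by (induction A rule: infinite_finite_induct) (simp_all add: Legendre_one[OF assms] Legendre_mult[OF assms])

lemma Legendre_square:
  assumes "prime p" "2 < p" "\<not> int p dvd t"
  shows "Legendre (t\<^sup>2) (int p) = 1"
  using Legendre_mult[OF assms(1,2), of t t] Legendre_values[of t "int p"]
    Legendre_eq_0_iff[of t "int p"] assms(3)
  by (auto simp: power2_eq_square)

text \<open>Gauss's lemma: with h = (p - 1) / 2, the set \<open>E\<close> consists of the doubles 2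
  x, x \<le> h, that exceed h. It has h - h div 2 elements, and the parity of this number is decided
  by p modulo 8.\<close>

lemma Legendre_two:
  assumes "prime p" "2 < p"
  shows "Legendre 2 (int p) = (if p mod 8 = 1 \<or> p mod 8 = 7 then 1 else -1)"
proof -
  have odd: "odd p" using assms prime_odd_nat by blast
  interpret GAUSS p 2
  proof
    show "[2 \<noteq> 0] (mod int p)" using assms(2) by (simp add: cong_def)
  qed (use assms in auto)
  define h where "h = (p - 1) div 2"
  have p: "p = 2 * h + 1" using odd by (auto simp: h_def elim!: oddE)
  have h: "(int p - 1) div 2 = int h" by (simp add: p)
  have "C = (\<lambda>x. 2 * x) ` {0<..int h}"
    unfolding C_def B_def A_def h image_image by (intro image_cong refl) (auto simp: p)
  then have "E = (\<lambda>x. 2 * x) ` {int h div 2<..int h}"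
    unfolding E_def h by force
  then have "card E = card {int h div 2<..int h}" by (simp add: card_image inj_on_def)
  then have card: "card E = h - h div 2" by (simp add: nat_diff_distrib' zdiv_int[symmetric] flip: of_nat_diff)
  have "even (card E) \<longleftrightarrow> p mod 8 = 1 \<or> p mod 8 = 7"
  proof -
    have "even (h - h div 2) \<longleftrightarrow> h mod 4 = 0 \<or> h mod 4 = 3" by presburger
    also have "\<dots> \<longleftrightarrow> (2 * h + 1) mod 8 = 1 \<or> (2 * h + 1) mod 8 = 7" by presburger
    finally show ?thesis using card p by metis
  qed
  then show ?thesis unfolding gauss_lemma by (simp add: minus_one_power_iff)
qed

text \<open>Squaring takes the same value at 1 and p - 1, so on a finite set of residues it is not
  injective and hence not onto.\<close>

lemma Legendre_nonresidue_exists: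
  assumes "prime p" "2 < p"
  obtains u where "Legendre u (int p) = -1"
proof -
  define f :: "int \<Rightarrow> int" where "f x = x\<^sup>2 mod int p" for x
  let ?R = "{0..<int p}"
  have "f 1 = f (int p - 1)"
  proof -
    have "(int p - 1)\<^sup>2 = 1 + int p * (int p - 2)" by (simp add: power2_eq_square algebra_simps)
    then show ?thesis by (simp add: f_def)
  qed
  moreover have "1 \<in> ?R" "int p - 1 \<in> ?R" "(1::int) \<noteq> int p - 1" using assms(2) by auto
  ultimately have "\<not> inj_on f ?R" by (meson inj_onD)
  moreover have fR: "f ` ?R \<subseteq> ?R" using assms(2) by (auto simp: f_def)
  ultimately have "f ` ?R \<noteq> ?R" using finite_surj_inj[of ?R f] by auto
  then obtain u where u: "u \<in> ?R" "u \<notin> f ` ?R" using fR by blast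
  have "u \<noteq> 0"
  proof
    assume "u = 0"
    then have "u = f 0" by (simp add: f_def)
    then show False using u assms(2) by auto
  qed
  then have nd: "\<not> int p dvd u" using u(1) zdvd_imp_le[of "int p" u] by auto
  have "\<not> QuadRes (int p) u"
  proof
    assume "QuadRes (int p) u"
    then obtain y where "[y\<^sup>2 = u] (mod int p)" by (auto simp: QuadRes_def)
    then have "f (y mod int p) = u" using u(1) by (simp add: f_def cong_def power_mod)
    moreover have "y mod int p \<in> ?R" using assms(2) by simp
    ultimately show False using u(2) by blast
  qed
  then have "Legendre u (int p) = -1" using nd by (simp add: Legendre_def cong_0_iff)
  then show ?thesis using that by blast
qed

section \<open>The Jacobi symbol as a primitive character\<close>

text \<open>The product runs over distinct primes without multiplicity, so this is the Jacobi symbol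
  for squarefree \<open>s\<close>.\<close>

definition jacobi_char :: "nat \<Rightarrow> int \<Rightarrow> complex" where
  "jacobi_char s x = of_int (\<Prod>p\<in>prime_factors s. Legendre x (int p))"

lemma prod_prime_factors_squarefree:
  assumes "squarefree (s :: nat)"
  shows "\<Prod>(prime_factors s) = s"
proof -
  have s: "s \<noteq> 0" using assms by (metis not_squarefree_0)
  have "s = (\<Prod>p\<in>prime_factors s. p ^ multiplicity p s)"
    using prime_factorization_nat s by auto
  also have "\<dots> = \<Prod>(prime_factors s)"
  proof (intro prod.cong refl)
    fix p assume "p \<in> prime_factors s"
    then have "multiplicity p s > 0" "prime p"
      by (auto simp: prime_factors_multiplicity)
    moreover have "multiplicity p s \<le> 1" using assms s \<open>prime p\<close>
      by (auto simp: squarefree_factorial_semiring'')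
    ultimately have "multiplicity p s = 1" by simp
    then show "p ^ multiplicity p s = p" by simp
  qed
  finally show ?thesis ..
qed

lemma odd_prime_factor:
  assumes "odd s" "p \<in> prime_factors (s :: nat)"
  shows "prime p" "2 < p"
proof -
  show p: "prime p" using assms by (simp add: in_prime_factors_iff)
  have "p \<noteq> 2" using assms by (auto simp: in_prime_factors_iff)
  then show "2 < p" using p prime_ge_2_nat[OF p] by simp
qed

lemma dirichlet_character_jacobi:
  assumes "odd s"
  shows "dirichlet_character s (jacobi_char s)"
  unfolding dirichlet_character_def
proof (intro conjI allI)
  note pf = odd_prime_factor[OF assms]
  show s: "0 < s" using assms by (simp add: odd_pos)
  fix x y
  show "jacobi_char s (x * y) = jacobi_char s x * jacobi_char s y"
    unfolding jacobi_char_def of_int_mult[symmetric] prod.distrib[symmetric]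
    by (intro arg_cong[where f = of_int] prod.cong refl Legendre_mult pf)
  show "jacobi_char s (x + int s) = jacobi_char s x"
    unfolding jacobi_char_def
    by (intro arg_cong[where f = of_int] prod.cong refl Legendre_cong)
      (auto simp: cong_iff_dvd_diff in_prime_factors_iff)
  show "(jacobi_char s x \<noteq> 0) = coprime x (int s)"
  proof
    assume nz: "jacobi_char s x \<noteq> 0"
    show "coprime x (int s)"
    proof (rule ccontr)
      assume "\<not> coprime x (int s)"
      then have "gcd x (int s) \<noteq> 1" by (simp add: coprime_iff_gcd_eq_1)
      then have "nat (gcd x (int s)) \<noteq> 1" by simp
      then obtain p where p: "prime p" "p dvd nat (gcd x (int s))"
        using prime_factor_nat by blast
      then have "int p dvd int (nat (gcd x (int s)))" by (simp only: of_nat_dvd_iff)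
      then have "int p dvd gcd x (int s)" by simp
      then have "int p dvd x" "p dvd s" by auto
      then have "p \<in> prime_factors s" "Legendre x (int p) = 0"
        using p s by (auto simp: in_prime_factors_iff Legendre_eq_0_iff)
      then show False using nz by (auto simp: jacobi_char_def)
    qed
  next
    assume cop: "coprime x (int s)"
    have "Legendre x (int p) \<noteq> 0" if "p \<in> prime_factors s" for p
    proof
      assume "Legendre x (int p) = 0"
      then have "int p dvd x" by (simp add: Legendre_eq_0_iff)
      moreover have "int p dvd int s" using that by (simp add: in_prime_factors_iff)
      ultimately have "int p dvd 1" using cop by (meson coprime_common_divisor)
      then show False using pf[OF that] by simp
    qed
    then show "jacobi_char s x \<noteq> 0" by (simp add: jacobi_char_def)
  qed
qed

text \<open>Take a prime \<open>p\<close> dividing \<open>s / d\<close>. As \<open>s\<close> is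
  squarefree, \<open>p\<close> is prime to \<open>s / p\<close>, so some \<open>x\<close> is a
  nonresidue modulo \<open>p\<close> and 1 modulo \<open>s / p\<close>, a multiple of
  \<open>d\<close>. Only the symbol at \<open>p\<close> is then negative.\<close>

lemma primitive_character_jacobi:
  assumes "odd s" "squarefree s"
  shows "primitive_character s (jacobi_char s)"
  unfolding primitive_character_iff
proof safe
  show "dirichlet_character s (jacobi_char s)" using assms(1) by (rule dirichlet_character_jacobi)
  fix d assume d: "d dvd s" "d < s"
  then obtain e where e: "s = d * e" by auto
  then have "e \<noteq> 1" using d by auto
  then obtain p where p: "prime p" "p dvd e" using prime_factor_nat by blast
  then obtain e' where e': "e = p * e'" by auto
  define r where "r = d * e'"
  have s: "s = p * r" by (simp add: e e' r_def)
  have s0: "s > 0" using assms(1) by (simp add: odd_pos)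
  have pf: "p \<in> prime_factors s" using p s s0 by (auto simp: in_prime_factors_iff)
  have p2: "2 < p" using odd_prime_factor[OF assms(1) pf] by simp
  have "\<not> p dvd r"
  proof
    assume "p dvd r"
    then have "p\<^sup>2 dvd s" by (simp add: s power2_eq_square)
    then show False using assms(2) p(1) by (meson not_prime_unit squarefreeD)
  qed
  then have cop: "coprime (int p) (int r)" using p(1) by (simp add: prime_imp_coprime_nat)
  obtain u where u: "Legendre u (int p) = -1" using Legendre_nonresidue_exists[OF p(1) p2] by blast
  obtain x where x: "[x = u] (mod int p)" "[x = 1] (mod int r)"
    using binary_chinese_remainder_int[OF cop] by blast
  have "Legendre x (int p') = (if p' = p then -1 else 1)" if p': "p' \<in> prime_factors s" for p'
  proof (cases "p' = p")
    case True
    then show ?thesis using u Legendre_cong[OF x(1)] by simp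
  next
    case False
    have pr: "prime p'" "2 < p'" using odd_prime_factor[OF assms(1) p'] by auto
    have "p' dvd p * r" using p' s by (simp add: in_prime_factors_iff)
    then have "p' dvd r" using False pr(1) p(1)
      by (simp add: prime_dvd_mult_iff primes_dvd_imp_eq) (metis primes_dvd_imp_eq)
    then have "[x = 1] (mod int p')" using x(2) by (meson cong_dvd_modulus of_nat_dvd_iff)
    then show ?thesis using False Legendre_cong Legendre_one[OF pr] by metis
  qed
  then have "(\<Prod>p'\<in>prime_factors s. Legendre x (int p')) = (\<Prod>p'\<in>prime_factors s. if p' = p then -1 else 1)"
    by (intro prod.cong) auto
  then have v: "jacobi_char s x = -1" using pf by (simp add: jacobi_char_def)
  then have "coprime x (int s)"
    using dirichlet_character_eq_0_iff[OF dirichlet_character_jacobi[OF assms(1)], of x] by simp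
  moreover have "[x = 1] (mod int d)" using x(2) unfolding r_def
    by (metis cong_dvd_modulus dvd_triv_left of_nat_mult)
  ultimately show "\<exists>x. [x = 1] (mod int d) \<and> coprime x (int s) \<and> jacobi_char s x \<noteq> 1"
    using v by (intro exI[of _ x]) auto
qed

section \<open>Supplementary signs for a product of primes\<close>

text \<open>The sign is a character modulo 4 on odd numbers, so the product over the primes of
  \<open>s\<close> depends on \<open>s\<close> modulo 4 only.\<close>

lemma prod_sign_mod4:
  assumes "finite A" "\<And>p. p \<in> A \<Longrightarrow> odd (p::nat)"
  shows "(\<Prod>p\<in>A. (-1::int) ^ ((p - 1) div 2)) = (if (\<Prod>A) mod 4 = 1 then 1 else -1)"
proof -
  define f :: "nat \<Rightarrow> int" where "f p = (if p mod 4 = 1 then 1 else -1)" for p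
  have f_mult: "f (p * r) = f p * f r" if "odd p" "odd r" for p r
  proof -
    have "p mod 4 = 1 \<or> p mod 4 = 3" "r mod 4 = 1 \<or> r mod 4 = 3" using that by presburger+
    moreover have "(p * r) mod 4 = ((p mod 4) * (r mod 4)) mod 4" by (simp add: mod_mult_eq)
    ultimately show ?thesis unfolding f_def by (elim disjE) simp_all
  qed
  have *: "odd (\<Prod>A) \<and> (\<Prod>p\<in>A. f p) = f (\<Prod>A)"
    using assms
  proof (induction A rule: finite_induct)
    case (insert p A)
    then show ?case by (simp add: f_mult)
  qed (simp add: f_def)
  have "(-1::int) ^ ((p - 1) div 2) = f p" if "p \<in> A" for p
  proof -
    have "odd p" using assms(2)[OF that] .
    then have "even ((p - 1) div 2) \<longleftrightarrow> p mod 4 = 1" by presburger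
    then show ?thesis by (simp add: minus_one_power_iff f_def)
  qed
  then show "(\<Prod>p\<in>A. (-1::int) ^ ((p - 1) div 2)) = (if (\<Prod>A) mod 4 = 1 then 1 else -1)"
    using * by (simp add: f_def)
qed

text \<open>Multiplicativity modulo 8 carries \<open>Legendre_two\<close> from primes to their
  product.\<close>

lemma prod_sign_mod8:
  assumes "finite A" "\<And>p. p \<in> A \<Longrightarrow> odd (p::nat)"
  shows "(\<Prod>p\<in>A. (if p mod 8 = 1 \<or> p mod 8 = 7 then 1 else -1 :: int))
           = (if (\<Prod>A) mod 8 = 1 \<or> (\<Prod>A) mod 8 = 7 then 1 else -1)"
proof -
  define f :: "nat \<Rightarrow> int" where "f p = (if p mod 8 = 1 \<or> p mod 8 = 7 then 1 else -1)" for p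
  have f_mult: "f (p * r) = f p * f r" if "odd p" "odd r" for p r
  proof -
    have "p mod 8 \<in> {1,3,5,7}" "r mod 8 \<in> {1,3,5,7}" using that by simp_all presburger+
    moreover have "(p * r) mod 8 = ((p mod 8) * (r mod 8)) mod 8" by (simp add: mod_mult_eq)
    ultimately show ?thesis unfolding f_def by (elim insertE emptyE) simp_all
  qed
  have "odd (\<Prod>A) \<and> (\<Prod>p\<in>A. f p) = f (\<Prod>A)"
    using assms
  proof (induction A rule: finite_induct)
    case (insert p A)
    then show ?case by (simp add: f_mult)
  qed (simp add: f_def)
  then show ?thesis by (simp add: f_def)
qed

section \<open>Chebyshev's bound for the product of primes\<close>

lemma prod_primes_dvd:
  assumes "finite A" "\<And>p. p \<in> A \<Longrightarrow> prime (p::nat)" "\<And>p. p \<in> A \<Longrightarrow> p dvd n"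
  shows "\<Prod>A dvd n"
  using assms
proof (induction A rule: finite_induct)
  case (insert p A)
  have "coprime p (\<Prod>A)"
    using insert by (intro prod_coprime_right) (metis insertCI primes_coprime)
  then show ?case using insert by (simp add: divides_mult)
qed simp

definition primorial :: "nat \<Rightarrow> nat" where
  "primorial n = \<Prod>{p. prime p \<and> p \<le> n}"

lemma primorial_pos: "primorial n > 0"
  by (auto simp: primorial_def intro!: prod_pos prime_gt_0_nat)

lemma prime_dvd_primorial: "prime p \<Longrightarrow> p \<le> n \<Longrightarrow> p dvd primorial n"
  unfolding primorial_def by (rule dvd_prodI[where f = "\<lambda>p. p", simplified]) auto

text \<open>For n = 2 m + 1 the primes in (m + 1, n] all divide \<open>n choose m\<close>. This
  coefficient occurs twice in a row of sum 2^n, so it is at most 4^m; the smaller primes are covered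
  by induction. An even n > 2 adds no prime.\<close>

lemma primorial_le: "primorial n \<le> 4 ^ n"
proof (induction n rule: less_induct)
  case (less n)
  consider "n \<le> 1" | "n = 2" | "n > 2" "even n" | "n > 2" "odd n" by linarith
  then show ?case
  proof cases
    case 1
    then have "{p::nat. prime p \<and> p \<le> n} = {}" by (auto dest: prime_ge_2_nat)
    then show ?thesis unfolding primorial_def by (simp only:) simp
  next
    case 2
    have "{p::nat. prime p \<and> p \<le> 2} = {2}" using prime_ge_2_nat by (auto intro: order.antisym)
    then show ?thesis using 2 by (simp add: primorial_def)
  next
    case 3
    have "{p::nat. prime p \<and> p \<le> n} = {p. prime p \<and> p \<le> n - 1}"
    proof -
      have "\<not> prime n" using 3 prime_odd_nat by blast
      then have "prime p \<and> p \<le> n \<longleftrightarrow> prime p \<and> p \<le> n - 1" for p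
        by (cases "p = n") auto
      then show ?thesis by blast
    qed
    then have "primorial n = primorial (n - 1)" by (simp add: primorial_def)
    also have "\<dots> \<le> 4 ^ (n - 1)" using less 3 by simp
    also have "\<dots> \<le> 4 ^ n" by (intro power_increasing) auto
    finally show ?thesis .
  next
    case 4
    then obtain m where m: "n = 2 * m + 1" by (auto elim: oddE)
    then have m0: "m > 0" using 4 by simp
    let ?B = "{p. prime p \<and> m + 1 < p \<and> p \<le> n}"
    have fin: "finite ?B" by simp
    have "{p. prime p \<and> p \<le> n} = {p. prime p \<and> p \<le> m + 1} \<union> ?B" using m by auto
    then have split: "primorial n = primorial (m + 1) * \<Prod>?B"
      unfolding primorial_def by (simp only:) (rule prod.union_disjoint, auto)
    have "\<Prod>?B dvd n choose m"
    proof (rule prod_primes_dvd)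
      fix p assume "p \<in> ?B"
      then show p: "prime p" by simp
      have p: "prime p" "m + 1 < p" "p \<le> n" using \<open>p \<in> ?B\<close> by auto
      have "p dvd fact n" using p by (simp add: prime_dvd_fact_iff)
      moreover have "fact m * fact (n - m) * (n choose m) = fact n"
        by (rule binomial_fact_lemma) (simp add: m)
      ultimately have "p dvd fact m * fact (m + 1) * (n choose m)" by (simp add: m)
      moreover have "\<not> p dvd fact m" "\<not> p dvd fact (m + 1)" using p by (simp_all add: prime_dvd_fact_iff del: fact_Suc)
      ultimately show "p dvd n choose m" using p(1) by (simp only: prime_dvd_mult_iff) blast
    qed (fact fin)
    then have B: "\<Prod>?B \<le> n choose m" by (intro dvd_imp_le) (auto simp: m)
    have "n choose m \<le> 4 ^ m"
    proof -
      have "(n choose m) + (n choose (m + 1)) \<le> (\<Sum>k\<le>n. n choose k)"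
        using sum_mono2[of "{..n}" "{m, m+1}" "\<lambda>k. n choose k"] by (simp add: m)
      also have "\<dots> = 2 ^ n" by (rule choose_row_sum)
      finally have "2 * (n choose m) \<le> 2 * 4 ^ m"
        using binomial_symmetric[of m n] by (simp add: m power_mult power_add)
      then show ?thesis by simp
    qed
    then have "\<Prod>?B \<le> 4 ^ m" using B by (rule order.trans[rotated])
    moreover have "primorial (m + 1) \<le> 4 ^ (m + 1)" using less[of "m+1"] m m0 by simp
    ultimately have "primorial n \<le> 4 ^ (m + 1) * 4 ^ m" unfolding split by (intro mult_le_mono)
    also have "\<dots> = 4 ^ n" unfolding m mult_2 power_add by simp
    finally show ?thesis .
  qed
qed

section \<open>An odd quadratic character equal to 1 up to y\<close>

text \<open>For an odd prime p \<le> y, reciprocity over the primes of \<open>s\<close> produces the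
  sign (-1)^((p - 1) / 2), because \<open>s\<close> is 3 modulo 4. The inverted symbol of
  \<open>s\<close> at p equals that of \<open>N = s * t\<^sup>2\<close>, hence of -1, which is the
  same sign, and the two cancel. The prime 2 is settled by \<open>s\<close> being 7 modulo 8,
  composite arguments by multiplicativity.\<close>

lemma jacobi_char_near_trivial:
  assumes "y \<ge> 2"
  obtains s where "odd s" "squarefree s" "s > 1" "s \<le> 4 ^ Suc y"
    "\<And>p. prime p \<Longrightarrow> p \<le> y \<Longrightarrow> \<not> p dvd s"
    "jacobi_char s (-1) = -1" "\<And>n. 0 < n \<Longrightarrow> n \<le> y \<Longrightarrow> jacobi_char s (int n) = 1"
proof -
  define N where "N = 4 * primorial y - 1"
  define s t where "s = squarefree_part N" and "t = square_part N"
  have N1: "N + 1 = 4 * primorial y" using primorial_pos[of y] by (simp add: N_def)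
  have N0: "N > 0" using primorial_pos[of y] by (simp add: N_def)
  have Nst: "N = s * t\<^sup>2" unfolding s_def t_def by (rule squarefree_decompose)
  have sqf: "squarefree s" by (simp add: s_def)
  have "8 dvd N + 1"
    using N1 prime_dvd_primorial[of 2 y] assms by (auto elim!: dvdE)
  then have N8: "N mod 8 = 7" by presburger
  then have "odd N" by presburger
  then have odd: "odd s" "odd t" using Nst by auto
  \<comment> \<open>An odd square is 1 modulo 8, so \<open>s\<close> inherits the residue of
    \<open>N\<close>.\<close>
  have s8: "s mod 8 = 7"
  proof -
    have "t mod 8 \<in> {1,3,5,7}" using odd(2) by simp presburger
    then have "t\<^sup>2 mod 8 = 1"
      by (auto simp: power2_eq_square mod_mult_eq[of t 8 t, symmetric])
    then have "N mod 8 = s mod 8" unfolding Nst by (metis mod_mult_right_eq mult.right_neutral)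
    then show ?thesis using N8 by simp
  qed
  have s4: "s mod 4 \<noteq> 1" using s8 by presburger
  have pf: "prime p" "2 < p" "odd p" if "p \<in> prime_factors s" for p
    using odd_prime_factor[OF odd(1) that] prime_odd_nat by auto
  have prod_s: "\<Prod>(prime_factors s) = s" using sqf by (rule prod_prime_factors_squarefree)
  have sgn: "(\<Prod>p\<in>prime_factors s. (-1::int) ^ ((p - 1) div 2)) = -1"
    using prod_sign_mod4[of "prime_factors s"] pf(3) s4 by (simp add: prod_s)
  have ndvdN: "\<not> p dvd N" if "prime p" "p \<le> y" for p
  proof
    assume "p dvd N"
    moreover have "p dvd N + 1" unfolding N1 using prime_dvd_primorial[OF that] by simp
    ultimately have "p dvd 1" by (metis dvd_add_right_iff)
    then show False using that by simp
  qed
  have p1: "jacobi_char s (int p) = 1" if p: "prime p" "p \<le> y" for p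
  proof (cases "p = 2")
    case True
    have "(\<Prod>l\<in>prime_factors s. Legendre 2 (int l))
        = (\<Prod>l\<in>prime_factors s. (if l mod 8 = 1 \<or> l mod 8 = 7 then 1 else -1 :: int))"
      using pf Legendre_two by (intro prod.cong) auto
    also have "\<dots> = 1" using prod_sign_mod8[of "prime_factors s"] pf(3) s8 by (simp add: prod_s)
    finally show ?thesis using True by (simp add: jacobi_char_def)
  next
    case False
    then have p2: "2 < p" using prime_ge_2_nat[OF p(1)] by simp
    have ndvd: "\<not> p dvd s" "\<not> p dvd t" using ndvdN[OF p] Nst by (auto simp: power2_eq_square)
    have "(\<Prod>l\<in>prime_factors s. Legendre (int p) (int l))
        = (\<Prod>l\<in>prime_factors s. Legendre (int l) (int p) * ((-1) ^ ((l - 1) div 2)) ^ ((p - 1) div 2))"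
    proof (intro prod.cong refl)
      fix l assume l: "l \<in> prime_factors s"
      have neq: "p \<noteq> l" using l ndvd by (auto simp: in_prime_factors_iff)
      have "\<not> int p dvd int l" using neq p(1) pf(1)[OF l] by (simp add: primes_dvd_imp_eq) (metis primes_dvd_imp_eq)
      then have "Legendre (int l) (int p) \<noteq> 0" by (simp add: Legendre_eq_0_iff)
      then have sq: "Legendre (int l) (int p) * Legendre (int l) (int p) = 1"
        using Legendre_values[of "int l" "int p"] by auto
      have "Legendre (int p) (int l) * Legendre (int l) (int p) = (-1) ^ ((p - 1) div 2 * ((l - 1) div 2))"
        by (rule Quadratic_Reciprocity[OF p(1) p2 pf(1,2)[OF l] neq])
      then have "Legendre (int p) (int l) * (Legendre (int l) (int p) * Legendre (int l) (int p))
          = (-1) ^ ((p - 1) div 2 * ((l - 1) div 2)) * Legendre (int l) (int p)"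
        by (simp only: mult.assoc[symmetric])
      then show "Legendre (int p) (int l) = Legendre (int l) (int p) * ((-1) ^ ((l - 1) div 2)) ^ ((p - 1) div 2)"
        unfolding sq by (simp add: power_mult[symmetric] mult_ac)
    qed
    also have "\<dots> = Legendre (\<Prod>l\<in>prime_factors s. int l) (int p) * (-1) ^ ((p - 1) div 2)"
      by (simp only: prod.distrib Legendre_prod[OF p(1) p2] prod_power_distrib[symmetric] sgn)
    also have "(\<Prod>l\<in>prime_factors s. int l) = int s" by (simp only: of_nat_prod[symmetric] prod_s)
    also have "Legendre (int s) (int p) = (-1) ^ ((p - 1) div 2)"
    proof -
      have "Legendre (int s) (int p) = Legendre (int s) (int p) * Legendre ((int t)\<^sup>2) (int p)"
        using Legendre_square[OF p(1) p2, of "int t"] ndvd by simp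
      also have "\<dots> = Legendre (int N) (int p)"
        by (simp add: Legendre_mult[OF p(1) p2, symmetric] Nst)
      also have "\<dots> = Legendre (-1) (int p)"
      proof (rule Legendre_cong)
        have "p dvd N + 1" unfolding N1 using prime_dvd_primorial[OF p] by simp
        then have "int p dvd int (N + 1)" by (simp only: of_nat_dvd_iff)
        then show "[int N = -1] (mod int p)" by (simp add: cong_iff_dvd_diff add.commute)
      qed
      finally show ?thesis by (simp add: Legendre_minus_one[OF p(1) p2])
    qed
    finally show ?thesis by (simp add: jacobi_char_def power_mult_distrib[symmetric])
  qed
  note dc = dirichlet_character_jacobi[OF odd(1)]
  have J1: "jacobi_char s (int n) = 1" if "0 < n" "n \<le> y" for n
    using that
  proof (induction n rule: less_induct)
    case (less n)
    show ?case
    proof (cases "n = 1")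
      case True
      then show ?thesis using dirichlet_character_one[OF dc] by simp
    next
      case False
      then obtain p where p: "prime p" "p dvd n" using prime_factor_nat by blast
      then obtain m where m: "n = p * m" by auto
      have "m > 0" using m less by (cases m) auto
      moreover have "m < n" using m \<open>m > 0\<close> prime_ge_2_nat[OF p(1)] by simp
      ultimately have "jacobi_char s (int m) = 1" using less by simp
      moreover have "p \<le> y" using p less dvd_imp_le[of p n] by simp
      ultimately show ?thesis using p1[OF p(1)] by (simp add: m dirichlet_character_mult[OF dc])
    qed
  qed
  have Jm: "jacobi_char s (-1) = -1"
  proof -
    have "(\<Prod>l\<in>prime_factors s. Legendre (-1) (int l)) = (\<Prod>l\<in>prime_factors s. (-1::int) ^ ((l - 1) div 2))"
      using pf Legendre_minus_one by (intro prod.cong) auto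
    then show ?thesis unfolding jacobi_char_def sgn by simp
  qed
  have "s \<le> N" using Nst N0 by (metis dvd_imp_le dvd_triv_left)
  also have "N \<le> 4 ^ Suc y" using primorial_le[of y] by (simp add: N_def)
  finally have sle: "s \<le> 4 ^ Suc y" .
  have "s > 1" using s8 by (cases "s = 0"; cases "s = 1") auto
  moreover have "\<not> p dvd s" if "prime p" "p \<le> y" for p
    using ndvdN[OF that] Nst by auto
  ultimately show ?thesis using that odd(1) sqf sle Jm J1 by blast
qed

lemma character_order_jacobi:
  assumes "odd s" "jacobi_char s (-1) = -1"
  shows "character_order s (jacobi_char s) = 2"
proof -
  note dc = dirichlet_character_jacobi[OF assms(1)]
  let ?g = "character_order s (jacobi_char s)"
  have "\<forall>x. coprime x (int s) \<longrightarrow> jacobi_char s x ^ 2 = 1"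
  proof safe
    fix x assume "coprime x (int s)"
    define z where "z = (\<Prod>p\<in>prime_factors s. Legendre x (int p))"
    have "(\<Prod>p\<in>A. Legendre x (int p)) \<in> {-1, 0, 1}" for A
    proof (induction A rule: infinite_finite_induct)
      case (insert p A)
      then show ?case using Legendre_values[of x "int p"] by auto
    qed auto
    then have "z \<in> {-1, 0, 1}" unfolding z_def by blast
    moreover have "z \<noteq> 0" using \<open>coprime x (int s)\<close> dirichlet_character_eq_0_iff[OF dc, of x]
      by (simp add: jacobi_char_def z_def)
    ultimately show "jacobi_char s x ^ 2 = 1" by (auto simp: jacobi_char_def z_def[symmetric])
  qed
  then have "?g dvd 2" using character_order_properties(2)[OF dc] by blast
  moreover have "?g \<noteq> 1"
  proof
    assume "?g = 1"
    then have "\<forall>x. coprime x (int s) \<longrightarrow> jacobi_char s x ^ 1 = 1"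
      using character_order_properties(2)[OF dc, of 1] by simp
    moreover have "coprime (-1) (int s)" by simp
    ultimately show False using assms(2) by fastforce
  qed
  ultimately show ?thesis by (metis dvd_antisym One_nat_def two_is_prime_nat prime_nat_iff)
qed

section \<open>Dirichlet series with bounded partial sums\<close>

lemma summation_by_parts:
  fixes a w :: "nat \<Rightarrow> complex"
  assumes "m \<le> n"
  shows "(\<Sum>k=m..<n. a k * w k) = (\<Sum>k<n. a k) * w n - (\<Sum>k<m. a k) * w m
           + (\<Sum>k=m..<n. (\<Sum>j<Suc k. a j) * (w k - w (Suc k)))"
  using assms
proof (induction n rule: dec_induct)
  case (step n)
  then show ?case by (simp add: algebra_simps)
qed simp

text \<open>Boundary terms and telescoping sum add up to B (w n + w m) + B (w m - w n) = 2 B w m.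
  The bound does not involve the upper limit, so it controls tails without absolute
  convergence.\<close>

lemma Abel_inequality:
  fixes a :: "nat \<Rightarrow> complex" and w :: "nat \<Rightarrow> real"
  assumes B: "\<And>n. cmod (\<Sum>k<n. a k) \<le> B"
    and anti: "\<And>n. w (Suc n) \<le> w n" and nonneg: "\<And>n. w n \<ge> 0"
  shows "cmod (\<Sum>k=m..<n. a k * of_real (w k)) \<le> 2 * B * w m"
proof (cases "m \<le> n")
  case True
  have "cmod (\<Sum>k=m..<n. a k * of_real (w k))
      = cmod ((\<Sum>k<n. a k) * of_real (w n) - (\<Sum>k<m. a k) * of_real (w m)
           + (\<Sum>k=m..<n. (\<Sum>j<Suc k. a j) * (of_real (w k) - of_real (w (Suc k)))))"
    by (rule arg_cong[OF summation_by_parts[OF True]])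
  also have "\<dots> \<le> cmod ((\<Sum>k<n. a k) * of_real (w n)) + cmod ((\<Sum>k<m. a k) * of_real (w m))
           + cmod (\<Sum>k=m..<n. (\<Sum>j<Suc k. a j) * (of_real (w k) - of_real (w (Suc k))))"
    by (rule order.trans[OF norm_triangle_ineq add_right_mono[OF norm_triangle_ineq4]])
  also have "\<dots> \<le> B * w n + B * w m + (\<Sum>k=m..<n. B * (w k - w (Suc k)))"
  proof (intro add_mono sum_norm_le)
    have *: "cmod ((\<Sum>k<n. a k) * of_real (w n)) \<le> B * w n" for n
      using mult_right_mono[OF B nonneg] nonneg[of n] by (simp add: norm_mult)
    show "cmod ((\<Sum>k<n. a k) * of_real (w n)) \<le> B * w n"
      "cmod ((\<Sum>k<m. a k) * of_real (w m)) \<le> B * w m" by (rule *)+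
    fix k
    have "cmod (of_real (w k) - of_real (w (Suc k))) = w k - w (Suc k)"
      using anti[of k] by (metis abs_of_nonneg diff_ge_0_iff_ge norm_of_real of_real_diff)
    then show "cmod ((\<Sum>j<Suc k. a j) * (of_real (w k) - of_real (w (Suc k)))) \<le> B * (w k - w (Suc k))"
      unfolding norm_mult using mult_right_mono[OF B[of "Suc k"], of "w k - w (Suc k)"] anti[of k] by simp
  qed
  also have "(\<Sum>k=m..<n. B * (w k - w (Suc k))) = B * (w m - w n)"
    using sum_Suc_diff'[OF True, of "\<lambda>k. - w k"] by (simp add: sum_distrib_left[symmetric])
  finally show ?thesis by (simp add: algebra_simps)
next
  case False
  have "0 \<le> B" using B[of 0] by simp
  then show ?thesis using False nonneg[of m] by simp
qed

text \<open>Whole periods drop out, which leaves fewer than \<open>m\<close> terms.\<close>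

lemma partial_sums_periodic_bound:
  fixes c :: "nat \<Rightarrow> complex"
  assumes per: "\<And>k. c (k + m) = c k" and zero: "(\<Sum>k<m. c k) = 0" and "m > 0"
    and K: "\<And>k. cmod (c k) \<le> K"
  shows "cmod (\<Sum>k<n. c k) \<le> K * real m"
proof (induction n rule: less_induct)
  case (less n)
  have K0: "0 \<le> K" using K[of 0] norm_ge_zero order_trans by blast
  show ?case
  proof (cases "n < m")
    case True
    have "cmod (\<Sum>k<n. c k) \<le> (\<Sum>k<n. K)" by (intro sum_norm_le K)
    also have "\<dots> \<le> K * real m" using True K0 by (simp add: mult.commute mult_left_mono)
    finally show ?thesis .
  next
    case False
    have split: "(\<Sum>k<m + d. c k) = (\<Sum>k<m. c k) + (\<Sum>k<d. c (k + m))" for d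
      by (induction d) (simp_all add: add_ac)
    have "(\<Sum>k<n. c k) = (\<Sum>k<m + (n - m). c k)" using False by simp
    also have "\<dots> = (\<Sum>k<m. c k) + (\<Sum>k<n - m. c (k + m))"
      using split .
    also have "\<dots> = (\<Sum>k<n - m. c k)" by (simp add: zero per)
    finally show ?thesis using less[of "n - m"] False \<open>m > 0\<close> by simp
  qed
qed

text \<open>The integral test in telescoping form: by the mean value theorem each term is at most a
  difference of values of \<open>- z powr (- a) / a\<close>, whose derivative is
  \<open>z powr (- a - 1)\<close>.\<close>

lemma sum_powr_le:
  fixes a :: real
  assumes "a > 0"
  shows "(\<Sum>n<N. real (Suc n) powr (- a - 1)) \<le> 1 + 1 / a"
proof -
  have step: "real (Suc (Suc n)) powr (- a - 1) \<le> (real (Suc n) powr (-a) - real (Suc (Suc n)) powr (-a)) / a" for n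
  proof -
    have "\<exists>z. real (Suc n) < z \<and> z < real (Suc (Suc n)) \<and>
        (- (real (Suc (Suc n)) powr (-a)) / a) - (- (real (Suc n) powr (-a)) / a)
          = (real (Suc (Suc n)) - real (Suc n)) * (z powr (- a - 1))"
      by (intro MVT2) (use assms in \<open>auto intro!: derivative_eq_intros simp: field_simps\<close>)
    then obtain z where z: "real (Suc n) < z" "z < real (Suc (Suc n))"
        "(real (Suc n) powr (-a) - real (Suc (Suc n)) powr (-a)) / a = z powr (- a - 1)"
      by (auto simp: diff_divide_distrib)
    have "real (Suc (Suc n)) powr (- a - 1) \<le> z powr (- a - 1)"
      using z assms by (intro powr_mono2') auto
    then show ?thesis using z by simp
  qed
  have "(\<Sum>n<Suc N. real (Suc n) powr (- a - 1)) \<le> 1 + (1 - real (Suc N) powr (-a)) / a" for N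
  proof (induction N)
    case (Suc N)
    have "(\<Sum>n<Suc (Suc N). real (Suc n) powr (- a - 1))
        \<le> 1 + (1 - real (Suc N) powr (-a)) / a + real (Suc (Suc N)) powr (- a - 1)"
      using Suc by simp
    also have "\<dots> \<le> 1 + (1 - real (Suc N) powr (-a)) / a
        + (real (Suc N) powr (-a) - real (Suc (Suc N)) powr (-a)) / a" using step[of N] by simp
    also have "\<dots> = 1 + (1 - real (Suc (Suc N)) powr (-a)) / a" by (simp add: diff_divide_distrib)
    finally show ?case .
  qed simp
  note * = this
  have "(\<Sum>n<N. real (Suc n) powr (- a - 1)) \<le> (\<Sum>n<Suc N. real (Suc n) powr (- a - 1))" by simp
  also have "\<dots> \<le> 1 + (1 - real (Suc N) powr (-a)) / a" by (rule *)
  also have "\<dots> \<le> 1 + 1 / a" using assms by (intro add_left_mono divide_right_mono) auto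
  finally show ?thesis .
qed

lemma summable_powr:
  fixes a :: real
  assumes "a > 0"
  shows "summable (\<lambda>n. real (Suc n) powr (- a - 1))" "(\<Sum>n. real (Suc n) powr (- a - 1)) \<le> 1 + 1 / a"
proof -
  show s: "summable (\<lambda>n. real (Suc n) powr (- a - 1))"
    by (intro summableI_nonneg_bounded[where x = "1 + 1/a"] sum_powr_le[OF assms]) auto
  show "(\<Sum>n. real (Suc n) powr (- a - 1)) \<le> 1 + 1 / a"
    by (rule suminf_le_const[OF s]) (rule sum_powr_le[OF assms])
qed

text \<open>Differencing gains a full power of n. After summation by parts the series therefore
  converges absolutely for Re s > 0.\<close>

lemma norm_powr_diff_le:
  fixes s :: complex
  assumes "Re s > 0"
  shows "cmod (1 / of_nat (Suc n) powr s - 1 / of_nat (Suc (Suc n)) powr s)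
           \<le> cmod s * real (Suc n) powr (- Re s - 1)"
proof -
  let ?S = "closed_segment (complex_of_real (real (Suc n))) (of_real (real (Suc (Suc n))))"
  have S: "\<exists>t\<ge>real (Suc n). z = complex_of_real t" if z: "z \<in> ?S" for z
  proof -
    have "z \<in> complex_of_real ` closed_segment (real (Suc n)) (real (Suc (Suc n)))"
      using z by (simp only: closed_segment_of_real)
    then show ?thesis by (auto simp: closed_segment_eq_real_ivl)
  qed
  have "cmod (of_real (real (Suc n)) powr (-s) - of_real (real (Suc (Suc n))) powr (-s))
      \<le> (cmod s * real (Suc n) powr (- Re s - 1)) * cmod (of_real (real (Suc n)) - of_real (real (Suc (Suc n))) :: complex)"
  proof (rule field_differentiable_bound[where f' = "\<lambda>z. - s * z powr (- s - 1)"])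
    fix z assume z: "z \<in> ?S"
    then obtain t where t: "t \<ge> real (Suc n)" "z = of_real t" using S by blast
    have "z \<notin> \<real>\<^sub>\<le>\<^sub>0" using t by auto
    then show "((\<lambda>z. z powr - s) has_field_derivative - s * z powr (- s - 1)) (at z within ?S)"
      by (intro has_field_derivative_powr DERIV_subset[OF _ subset_UNIV])
    have "t powr (- Re s - 1) \<le> real (Suc n) powr (- Re s - 1)"
      using t assms by (intro powr_mono2') auto
    then show "cmod (- s * z powr (- s - 1)) \<le> cmod s * real (Suc n) powr (- Re s - 1)"
      using t norm_powr_real_powr[of z "- s - 1"] by (simp add: norm_mult mult_left_mono)
  qed (auto simp: convex_closed_segment)
  moreover have "cmod (of_real (real (Suc n)) - of_real (real (Suc (Suc n))) :: complex) = 1"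
    by (simp flip: of_real_diff)
  ultimately show ?thesis by (simp add: powr_minus field_simps)
qed

section \<open>Dirichlet series in the half-plane Re s > 0\<close>

text \<open>\<open>c n\<close> is the coefficient of the integer n + 1; this shift recurs in all
  later series.\<close>

definition dirichlet_series :: "(nat \<Rightarrow> complex) \<Rightarrow> complex \<Rightarrow> complex" where
  "dirichlet_series c s = (\<Sum>n. c n / of_nat (Suc n) powr s)"

lemma norm_nat_powr: "cmod (of_nat (Suc n) powr s) = real (Suc n) powr Re s"
  using norm_powr_real_powr[of "of_nat (Suc n)" s] by simp

locale bounded_partial_sums =
  fixes c :: "nat \<Rightarrow> complex" and B :: real
  assumes partial: "\<And>n. cmod (\<Sum>k<n. c k) \<le> B"
begin

lemma B_nonneg: "0 \<le> B"
  using partial[of 0] by simp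

text \<open>The terms after summation by parts. They have a summable majorant, locally uniformly for
  Re s > 0, so bounds and holomorphy are read off from them and not from the conditionally
  convergent series.\<close>

definition T :: "nat \<Rightarrow> complex \<Rightarrow> complex" where
  "T n s = (\<Sum>k<Suc n. c k) * (1 / of_nat (Suc n) powr s - 1 / of_nat (Suc (Suc n)) powr s)"

lemma norm_T:
  assumes "Re s > 0"
  shows "cmod (T n s) \<le> B * (cmod s * real (Suc n) powr (- Re s - 1))"
  unfolding T_def norm_mult
  by (intro mult_mono partial norm_powr_diff_le assms B_nonneg) simp

lemma summable_T:
  assumes "Re s > 0"
  shows "summable (\<lambda>n. T n s)"
proof (rule summable_comparison_test')
  show "summable (\<lambda>n. B * (cmod s * real (Suc n) powr (- Re s - 1)))"
    using assms by (intro summable_mult summable_powr)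
qed (use norm_T[OF assms] in auto)

lemma dirichlet_series_sums_aux:
  assumes "Re s > 0"
  shows "(\<lambda>n. c n / of_nat (Suc n) powr s) sums (\<Sum>n. T n s)"
proof -
  have eq: "(\<Sum>n<N. c n / of_nat (Suc n) powr s)
      = (\<Sum>k<N. c k) * (1 / of_nat (Suc N) powr s) + (\<Sum>n<N. T n s)" for N
    using summation_by_parts[of 0 N c "\<lambda>n. 1 / of_nat (Suc n) powr s"]
    by (simp add: T_def lessThan_atLeast0 del: of_nat_Suc)
  have "(\<lambda>N. (\<Sum>k<N. c k) * (1 / of_nat (Suc N) powr s)) \<longlonglongrightarrow> 0"
  proof (rule Lim_null_comparison)
    show "\<forall>\<^sub>F N in sequentially. cmod ((\<Sum>k<N. c k) * (1 / of_nat (Suc N) powr s)) \<le> B * real (Suc N) powr (- Re s)"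
    proof (intro always_eventually allI)
      fix N
      have "cmod ((\<Sum>k<N. c k) * (1 / of_nat (Suc N) powr s)) = cmod (\<Sum>k<N. c k) * real (Suc N) powr (- Re s)"
        unfolding norm_mult norm_divide norm_nat_powr by (simp add: powr_minus field_simps)
      also have "\<dots> \<le> B * real (Suc N) powr (- Re s)" by (intro mult_right_mono partial) auto
      finally show "cmod ((\<Sum>k<N. c k) * (1 / of_nat (Suc N) powr s)) \<le> B * real (Suc N) powr (- Re s)" .
    qed
    have "(\<lambda>N. real (Suc N) powr (- Re s)) \<longlonglongrightarrow> 0"
      by (rule tendsto_neg_powr[OF _ filterlim_compose[OF filterlim_real_sequentially filterlim_Suc]])
        (use assms in auto)
    then show "(\<lambda>N. B * real (Suc N) powr (- Re s)) \<longlonglongrightarrow> 0"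
      by (rule tendsto_mult_right_zero)
  qed
  moreover have "(\<lambda>N. \<Sum>n<N. T n s) \<longlonglongrightarrow> (\<Sum>n. T n s)"
    using summable_T[OF assms] by (rule summable_LIMSEQ)
  ultimately show ?thesis unfolding sums_def eq using tendsto_add[of _ 0 sequentially] by simp
qed

lemma dirichlet_series_eq: "Re s > 0 \<Longrightarrow> dirichlet_series c s = (\<Sum>n. T n s)"
  unfolding dirichlet_series_def by (rule sums_unique[symmetric, OF dirichlet_series_sums_aux])

lemma dirichlet_series_sums:
  "Re s > 0 \<Longrightarrow> (\<lambda>n. c n / of_nat (Suc n) powr s) sums dirichlet_series c s"
  using dirichlet_series_sums_aux dirichlet_series_eq by simp

text \<open>Applied with \<open>B = q\<close>: a bound linear in the modulus has a logarithm of size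
  ln q + O(1), which is O(y).\<close>

lemma norm_dirichlet_series_le:
  assumes "Re s > 0"
  shows "cmod (dirichlet_series c s) \<le> B * cmod s * (1 + 1 / Re s)"
proof -
  have sm: "summable (\<lambda>n. B * (cmod s * real (Suc n) powr (- Re s - 1)))"
    using assms by (intro summable_mult summable_powr)
  have "cmod (\<Sum>n. T n s) \<le> (\<Sum>n. B * (cmod s * real (Suc n) powr (- Re s - 1)))"
    by (rule norm_suminf_le[OF norm_T[OF assms] sm])
  also have "\<dots> = B * (cmod s * (\<Sum>n. real (Suc n) powr (- Re s - 1)))"
    using summable_powr(1)[OF assms] by (simp add: suminf_mult summable_mult)
  also have "\<dots> \<le> B * (cmod s * (1 + 1 / Re s))"
    by (intro mult_left_mono summable_powr assms B_nonneg) auto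
  finally show ?thesis unfolding dirichlet_series_eq[OF assms] by (simp add: mult_ac)
qed

lemma dirichlet_series_holomorphic: "dirichlet_series c holomorphic_on {s. Re s > 0}"
proof -
  have "(\<lambda>s. \<Sum>n. T n s) holomorphic_on {s. Re s > 0}"
  proof (rule holomorphic_uniform_sequence[where f = "\<lambda>N s. \<Sum>n<N. T n s"])
    show "open {s. Re s > 0}" by (rule open_halfspace_Re_gt)
    show "(\<lambda>s. \<Sum>n<N. T n s) holomorphic_on {s. Re s > 0}" for N
      unfolding T_def by (intro holomorphic_intros) auto
    fix x assume "x \<in> {s. Re s > 0}"
    then have x: "Re x > 0" by simp
    define d where "d = Re x / 2"
    have ball: "Re z \<ge> d \<and> cmod z \<le> cmod x + d" if "z \<in> cball x d" for z
    proof -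
      have "cmod (x - z) \<le> d" using that by (simp add: dist_norm)
      moreover have "Re x - Re z \<le> cmod (x - z)" using abs_Re_le_cmod[of "x - z"] by simp
      moreover have "cmod z \<le> cmod x + cmod (x - z)" by (metis norm_minus_commute norm_triangle_sub)
      ultimately show ?thesis by (simp add: d_def)
    qed
    have "uniform_limit (cball x d) (\<lambda>N s. \<Sum>n<N. T n s) (\<lambda>s. \<Sum>n. T n s) sequentially"
    proof (rule Weierstrass_m_test)
      fix n z assume z: "z \<in> cball x d"
      have d: "d > 0" using x by (simp add: d_def)
      have "cmod (T n z) \<le> B * (cmod z * real (Suc n) powr (- Re z - 1))"
        using ball[OF z] d by (intro norm_T) auto
      also have "\<dots> \<le> B * ((cmod x + d) * real (Suc n) powr (- d - 1))"
        using ball[OF z] d by (intro mult_left_mono mult_mono powr_mono B_nonneg) auto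
      finally show "cmod (T n z) \<le> B * ((cmod x + d) * real (Suc n) powr (- d - 1))" .
    next
      show "summable (\<lambda>n. B * ((cmod x + d) * real (Suc n) powr (- d - 1)))"
        using x by (intro summable_mult summable_powr) (simp add: d_def)
    qed
    moreover have "cball x d \<subseteq> {s. Re s > 0}" using ball x by (force simp: d_def)
    ultimately show "\<exists>d>0. cball x d \<subseteq> {s. Re s > 0} \<and>
        uniform_limit (cball x d) (\<lambda>N s. \<Sum>n<N. T n s) (\<lambda>s. \<Sum>n. T n s) sequentially"
      using x by (intro exI[of _ d]) (auto simp: d_def)
  qed
  then show ?thesis
    by (rule holomorphic_transform) (simp add: dirichlet_series_eq)
qed

text \<open>Abel's theorem. The weights decrease in n for every r in [0, 1], so
  \<open>Abel_inequality\<close> bounds the tails uniformly up to and including r = 1.\<close>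

lemma power_series_continuous:
  "continuous_on {0..1} (\<lambda>r. \<Sum>n. c n * of_real (r ^ Suc n / real (Suc n)))"
proof -
  define f where "f N r = (\<Sum>n<N. c n * of_real (r ^ Suc n / real (Suc n)))" for N and r :: real
  have tail: "cmod (f n r - f m r) \<le> 2 * B / real (Suc m)" if "r \<in> {0..1}" "m \<le> n" for m n r
  proof -
    have "f n r - f m r = (\<Sum>k=m..<n. c k * of_real (r ^ Suc k / real (Suc k)))"
      unfolding f_def using sum_diff_nat_ivl[of 0 m n "\<lambda>k. c k * of_real (r ^ Suc k / real (Suc k))"] that
      by (simp add: lessThan_atLeast0)
    also have "cmod \<dots> \<le> 2 * B * (r ^ Suc m / real (Suc m))"
    proof (rule Abel_inequality[OF partial])
      fix n
      have "r ^ Suc (Suc n) \<le> r ^ Suc n" using that by (intro power_decreasing) auto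
      then show "r ^ Suc (Suc n) / real (Suc (Suc n)) \<le> r ^ Suc n / real (Suc n)"
        using that by (intro frac_le) auto
    qed (use that in auto)
    also have "\<dots> \<le> 2 * B * (1 / real (Suc m))"
      using that B_nonneg by (intro mult_left_mono divide_right_mono power_le_one) auto
    finally show ?thesis by simp
  qed
  have "uniformly_Cauchy_on {0..1} f"
    unfolding uniformly_Cauchy_on_def
  proof (intro allI impI)
    fix e :: real assume e: "e > 0"
    obtain M :: nat where M: "2 * B / e < real M" using reals_Archimedean2 by blast
    have small: "2 * B / real (Suc m) < e" if "m \<ge> M" for m
    proof -
      have "2 * B < real M * e" using M e by (simp add: field_simps)
      also have "\<dots> \<le> real (Suc m) * e" using that e by (intro mult_right_mono) auto
      finally show ?thesis by (simp add: field_simps)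
    qed
    show "\<exists>M. \<forall>x\<in>{0..1}. \<forall>m\<ge>M. \<forall>n\<ge>M. dist (f m x) (f n x) < e"
    proof (intro exI[of _ M] ballI allI impI)
      fix r :: real and m n assume r: "r \<in> {0..1}" and mn: "M \<le> m" "M \<le> n"
      show "dist (f m r) (f n r) < e"
      proof (cases "m \<le> n")
        case True
        then show ?thesis using tail[OF r True] small[OF mn(1)] by (simp add: dist_norm norm_minus_commute)
      next
        case False
        then show ?thesis using tail[OF r, of n m] small[OF mn(2)] by (simp add: dist_norm)
      qed
    qed
  qed
  then have "uniformly_convergent_on {0..1} f" by (rule Cauchy_uniformly_convergent)
  then have ul: "uniform_limit {0..1} f (\<lambda>r. lim (\<lambda>N. f N r)) sequentially"
    by (simp add: uniformly_convergent_uniform_limit_iff)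
  have "continuous_on {0..1} (\<lambda>r. lim (\<lambda>N. f N r))"
  proof (rule uniform_limit_theorem[OF _ ul])
    show "\<forall>\<^sub>F n in sequentially. continuous_on {0..1} (f n)"
      unfolding f_def by (intro always_eventually allI continuous_intros) auto
  qed simp
  moreover have "lim (\<lambda>N. f N r) = (\<Sum>n. c n * of_real (r ^ Suc n / real (Suc n)))" for r
    unfolding f_def suminf_eq_lim ..
  ultimately show ?thesis by simp
qed

lemma Abel_limit:
  assumes "\<And>j. 0 \<le> r j" "\<And>j. r j \<le> 1" "r \<longlonglongrightarrow> 1"
  shows "(\<lambda>j. \<Sum>n. c n * of_real (r j ^ Suc n / real (Suc n))) \<longlonglongrightarrow> dirichlet_series c 1"
proof -
  have "(\<lambda>j. \<Sum>n. c n * of_real (r j ^ Suc n / real (Suc n))) \<longlonglongrightarrow> (\<Sum>n. c n * of_real (1 ^ Suc n / real (Suc n)))"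
    using continuous_on_tendsto_compose[OF power_series_continuous assms(3)] assms(1,2) by simp
  then show ?thesis by (simp add: dirichlet_series_def divide_inverse del: of_nat_Suc)
qed

end

section \<open>Identification with \<open>dirichlet_L\<close>\<close>

text \<open>The series itself is an admissible continuation. Any other one agrees with it far to the
  right, hence on all of \<open>?U\<close> by the identity theorem, as a half-plane stays connected
  when the at most one point of \<open>P\<close> is removed.\<close>

lemma dirichlet_L_eq_series:
  assumes B: "\<And>n. cmod (\<Sum>k<n. chi (int (Suc k))) \<le> B" and s: "Re s > 0"
  shows "dirichlet_L chi s = dirichlet_series (\<lambda>n. chi (int (Suc n))) s"
proof -
  let ?c = "\<lambda>n. chi (int (Suc n))"
  interpret bounded_partial_sums ?c B by unfold_locales (rule B)
  let ?D = "dirichlet_series ?c"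
  show ?thesis unfolding dirichlet_L_def
  proof (rule the_equality)
    show "\<exists>F c P. P \<subseteq> {1} \<and> s \<in> {w. Re w > c} - P \<and> F holomorphic_on ({w. Re w > c} - P) \<and>
        (\<forall>w. Re w > 1 \<longrightarrow> (\<lambda>n. chi (int (Suc n)) / of_nat (Suc n) powr w) sums F w) \<and> ?D s = F s"
      using dirichlet_series_holomorphic dirichlet_series_sums s
      by (intro exI[of _ ?D] exI[of _ 0] exI[of _ "{}"]) auto
  next
    fix z assume "\<exists>F c P. P \<subseteq> {1} \<and> s \<in> {w. Re w > c} - P \<and> F holomorphic_on ({w. Re w > c} - P) \<and>
        (\<forall>w. Re w > 1 \<longrightarrow> (\<lambda>n. chi (int (Suc n)) / of_nat (Suc n) powr w) sums F w) \<and> z = F s"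
    then obtain F c P where F: "P \<subseteq> {1::complex}" "s \<in> {w. Re w > c} - P"
      "F holomorphic_on ({w. Re w > c} - P)"
      "\<And>w. Re w > 1 \<Longrightarrow> (\<lambda>n. chi (int (Suc n)) / of_nat (Suc n) powr w) sums F w" "z = F s"
      by blast
    let ?U = "{w. Re w > max c 0} - P" and ?V = "{w. Re w > max c 1} - P"
    have fin: "finite P" using F(1) finite_subset by auto
    have opn: "open ({w. Re w > r} - P)" for r
      by (intro open_Diff open_halfspace_Re_gt finite_imp_closed fin)
    have "F s = ?D s"
    proof (rule analytic_continuation_open[of ?V ?U F ?D])
      show "open ?V" "open ?U" by (rule opn)+
      have "complex_of_real (max c 1 + 1) \<in> ?V" using F(1) by (auto simp: complex_eq_iff)
      then show "?V \<noteq> {}" by blast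
      show "connected ?U"
        by (intro connected_open_diff_countable countable_finite fin convex_connected
            convex_halfspace_Re_gt open_halfspace_Re_gt) simp
      show "?V \<subseteq> ?U" by auto
      show "F holomorphic_on ?U" by (rule holomorphic_on_subset[OF F(3)]) auto
      show "?D holomorphic_on ?U"
        by (rule holomorphic_on_subset[OF dirichlet_series_holomorphic]) auto
      show "s \<in> ?U" using F(2) s by auto
      show "F w = ?D w" if "w \<in> ?V" for w
        using F(4)[of w] dirichlet_series_sums[of w] that sums_unique2 by fastforce
    qed
    then show "z = ?D s" using F(5) by simp
  qed
qed

lemma dirichlet_character_sum_zero:
  assumes "dirichlet_character q chi" "coprime u (int q)" "chi u \<noteq> 1"
  shows "(\<Sum>x\<in>{0..<int q}. chi x) = 0"
proof -
  have q: "q > 0" using assms(1) by (simp add: dirichlet_character_def)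
  have "(\<Sum>x\<in>{0..<int q}. chi (u * x)) = (\<Sum>x\<in>{0..<int q}. chi x)"
    by (rule sum_residues_mult[OF q _ assms(2)]) (rule dirichlet_character_cong[OF assms(1)])
  then have "chi u * (\<Sum>x\<in>{0..<int q}. chi x) = (\<Sum>x\<in>{0..<int q}. chi x)"
    by (simp add: dirichlet_character_mult[OF assms(1)] sum_distrib_left)
  then show ?thesis using assms(3) by simp
qed

lemma nonprincipal_partial_sums:
  assumes "dirichlet_character q chi" "coprime u (int q)" "chi u \<noteq> 1"
  shows "cmod (\<Sum>k<n. chi (int (Suc k))) \<le> real q"
proof -
  have q: "q > 0" using assms(1) by (simp add: dirichlet_character_def)
  have "cmod (\<Sum>k<n. chi (int (Suc k))) \<le> 1 * real q"
  proof (rule partial_sums_periodic_bound[OF _ _ q])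
    show "chi (int (Suc (k + q))) = chi (int (Suc k))" for k
      by (rule dirichlet_character_cong[OF assms(1)]) (simp add: cong_iff_dvd_diff)
    have "(\<Sum>k<q. chi (int (Suc k))) = (\<Sum>k=1..q. chi (int k))"
      by (rule sum.reindex_bij_witness[of _ "\<lambda>k. k - 1" Suc]) auto
    also have "\<dots> = (\<Sum>x\<in>{0..<int q}. chi x)"
      by (rule sum_period_residues[OF q]) (rule dirichlet_character_cong[OF assms(1)])
    finally show "(\<Sum>k<q. chi (int (Suc k))) = 0" using dirichlet_character_sum_zero[OF assms] by simp
  qed (use dirichlet_character_norm_le[OF assms(1)] in auto)
  then show ?thesis by simp
qed

text \<open>The primitivity criterion for the divisor 1; it rules out the principal character, so
  partial sums are bounded.\<close>

lemma primitive_character_nontrivial: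
  assumes "primitive_character q chi" "q > 1"
  obtains u where "coprime u (int q)" "chi u \<noteq> 1"
  using assms unfolding primitive_character_iff by (metis one_dvd)

section \<open>Fourier expansion of character sums\<close>

text \<open>At integers the value is the midpoint of the jump, to which the Fourier series converges
  there.\<close>

definition sawtooth :: "real \<Rightarrow> real" where
  "sawtooth x = (if x \<in> \<int> then 0 else frac x - 1 / 2)"

text \<open>The closed form of -1/pi times the sum of r^n sin(2 pi n x) / n. From the logarithm one
  reads off a bound uniform in r as well as the pointwise limit.\<close>

definition abel_sawtooth :: "real \<Rightarrow> real \<Rightarrow> real" where
  "abel_sawtooth r x = Im (Ln (1 - of_real r * unit_exp x)) / pi"

lemma Re_unit_exp_less_1:
  assumes "x \<notin> \<int>"
  shows "Re (unit_exp x) < 1"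
proof -
  have "cos (2 * pi * x) \<noteq> 1"
  proof
    assume "cos (2 * pi * x) = 1"
    then obtain n :: int where "2 * pi * x = of_int n * 2 * pi" by (auto simp: cos_one_2pi_int)
    then have "x = of_int n" by simp
    then show False using assms by simp
  qed
  then show ?thesis using cos_le_one[of "2 * pi * x"] by (simp add: unit_exp_def less_le)
qed

lemma Re_one_minus_unit_exp_pos:
  assumes "0 \<le> r" "r < 1"
  shows "Re (1 - of_real r * unit_exp x) > 0"
proof -
  have "r * cos (2 * pi * x) \<le> r * 1" using assms by (intro mult_left_mono) auto
  then show ?thesis using assms by (simp add: unit_exp_def)
qed

text \<open>The argument of the logarithm lies in the right half-plane, so its angle is below pi/2.
  Uniformity in r is what dominated convergence will need.\<close>

lemma abs_abel_sawtooth_le: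
  assumes "0 \<le> r" "r < 1"
  shows "\<bar>abel_sawtooth r x\<bar> \<le> 1 / 2"
proof -
  let ?z = "1 - of_real r * unit_exp x"
  have "Re ?z > 0" using Re_one_minus_unit_exp_pos[OF assms] .
  moreover from this have "?z \<noteq> 0" by (metis less_irrefl zero_complex.simps(1))
  ultimately have "\<bar>Im (Ln ?z)\<bar> < pi / 2" using Re_Ln_pos_lt by blast
  then show ?thesis by (simp add: abel_sawtooth_def field_simps)
qed

lemma unit_exp_frac: "unit_exp (frac x) = unit_exp x"
proof -
  have "unit_exp x = unit_exp (frac x + of_int \<lfloor>x\<rfloor>)" by (simp add: frac_def)
  then show ?thesis by (simp only: unit_exp_add unit_exp_of_int mult_1_right)
qed

text \<open>The polar form is 1 - e(x) = 2 sin(pi t) exp(i pi (t - 1/2)) for t =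
  \<open>frac x\<close>, with e(x) = \<open>unit_exp x\<close>.\<close>

lemma Im_Ln_one_minus_unit_exp:
  assumes "x \<notin> \<int>"
  shows "Im (Ln (1 - unit_exp x)) = pi * (frac x - 1 / 2)"
proof -
  define t where "t = frac x"
  have t: "0 < t" "t < 1" using assms frac_lt_1[of x] frac_gt_0_iff[of x] by (auto simp: t_def)
  have "sin (pi * t) > 0" using t mult_strict_left_mono[of t 1 pi] by (intro sin_gt_zero) auto
  moreover have "of_real (2 * sin (pi * t)) * exp (\<i> * of_real (pi * (t - 1/2))) = 1 - unit_exp x"
  proof -
    have "exp (\<i> * of_real (pi * (t - 1/2))) = cis (pi * t - pi / 2)"
      by (simp add: cis_conv_exp algebra_simps)
    moreover have "cos (2 * pi * t) = 1 - 2 * (sin (pi * t))\<^sup>2"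
      using cos_double_sin[of "pi * t"] by (simp add: mult.assoc)
    moreover have "sin (2 * pi * t) = 2 * sin (pi * t) * cos (pi * t)"
      using sin_double[of "pi * t"] by (simp add: mult.assoc)
    moreover have "unit_exp x = cis (2 * pi * t)"
      using unit_exp_frac[of x] by (simp add: t_def unit_exp_def)
    ultimately show ?thesis
      by (simp add: complex_eq_iff cos_diff sin_diff power2_eq_square)
  qed
  moreover have "- pi < pi * (t - 1/2)" using t mult_strict_left_mono[of "-1" "t - 1/2" pi] by simp
  moreover have "pi * (t - 1/2) \<le> pi" using t mult_left_mono[of "t - 1/2" 1 pi] by simp
  ultimately have "Arg (1 - unit_exp x) = pi * (t - 1 / 2)" by (intro Arg_unique[where r = "2 * sin (pi * t)"]) auto
  moreover have "1 - unit_exp x \<noteq> 0" using Re_unit_exp_less_1[OF assms] by auto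
  ultimately show ?thesis by (simp add: Arg_eq_Im_Ln t_def)
qed

lemma abel_sawtooth_tendsto:
  assumes "\<And>j. 0 \<le> r j" "\<And>j. r j < 1" "r \<longlonglongrightarrow> 1"
  shows "(\<lambda>j. abel_sawtooth (r j) x) \<longlonglongrightarrow> sawtooth x"
proof (cases "x \<in> \<int>")
  case True
  then have "unit_exp x = 1" by (auto elim!: Ints_cases)
  then have "abel_sawtooth (r j) x = 0" for j
  proof -
    have 1: "1 - of_real (r j) * unit_exp x = complex_of_real (1 - r j)"
      by (simp add: \<open>unit_exp x = 1\<close>)
    have 2: "Ln (complex_of_real (1 - r j)) = of_real (ln (1 - r j))"
      using assms(2)[of j] by (intro Ln_of_real) simp
    show ?thesis unfolding abel_sawtooth_def 1 2 by simp
  qed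
  then show ?thesis using True by (simp add: sawtooth_def)
next
  case False
  have "1 - unit_exp x \<notin> \<real>\<^sub>\<le>\<^sub>0"
    using Re_unit_exp_less_1[OF False] by (auto simp: complex_nonpos_Reals_iff)
  moreover have "(\<lambda>j. 1 - of_real (r j) * unit_exp x) \<longlonglongrightarrow> 1 - of_real 1 * unit_exp x"
    by (intro tendsto_intros assms(3))
  ultimately have "(\<lambda>j. Ln (1 - of_real (r j) * unit_exp x)) \<longlonglongrightarrow> Ln (1 - unit_exp x)"
    by (intro tendsto_Ln) auto
  then have "(\<lambda>j. abel_sawtooth (r j) x) \<longlonglongrightarrow> Im (Ln (1 - unit_exp x)) / pi"
    unfolding abel_sawtooth_def using tendsto_divide[OF tendsto_Im tendsto_const[of pi]] by simp
  then show ?thesis using False by (simp add: Im_Ln_one_minus_unit_exp sawtooth_def)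
qed

lemma unit_exp_power: "unit_exp x ^ n = unit_exp (real n * x)"
  by (simp add: unit_exp_def Complex.DeMoivre mult_ac)

lemma abel_sawtooth_sums:
  assumes "0 \<le> r" "r < 1"
  shows "(\<lambda>n. r ^ Suc n / real (Suc n) * sin (2 * pi * (real (Suc n) * x))) sums (- pi * abel_sawtooth r x)"
proof -
  let ?z = "of_real r * unit_exp x"
  have "cmod (- ?z) < 1" using assms by (simp add: norm_mult)
  from Ln_series'[OF this] have "(\<lambda>n. - (?z ^ n) / of_nat n) sums ln (1 - ?z)" by simp
  then have "(\<lambda>n. - (?z ^ Suc n) / of_nat (Suc n)) sums ln (1 - ?z)"
    using sums_Suc_iff[of "\<lambda>n. - (?z ^ n) / of_nat n" "ln (1 - ?z)"] by simp
  then have "(\<lambda>n. - (- (?z ^ Suc n) / of_nat (Suc n))) sums (- ln (1 - ?z))" by (rule sums_minus)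
  then have "(\<lambda>n. Im (- (- (?z ^ Suc n) / of_nat (Suc n)))) sums Im (- ln (1 - ?z))" by (rule sums_Im)
  moreover have "Im (- (- (?z ^ Suc n) / of_nat (Suc n)))
      = r ^ Suc n / real (Suc n) * sin (2 * pi * (real (Suc n) * x))" for n
  proof -
    have "- (- (?z ^ Suc n) / of_nat (Suc n)) = of_real (r ^ Suc n / real (Suc n)) * unit_exp (real (Suc n) * x)"
      unfolding power_mult_distrib unit_exp_power by simp
    then show ?thesis by (simp only: unit_exp_def Im_complex_of_real Re_complex_of_real times_complex.sel cis.sel)
  qed
  moreover have "Im (- ln (1 - ?z)) = - pi * abel_sawtooth r x"
    by (simp add: abel_sawtooth_def)
  ultimately show ?thesis by simp
qed

lemma sin_eq_unit_exp:
  "complex_of_real (sin (2 * pi * t)) = (unit_exp t - unit_exp (- t)) / (2 * \<i>)"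
  by (simp add: unit_exp_def complex_eq_iff)

text \<open>
  The Fourier series of the sawtooth, summed against \<open>chi\<close>, becomes the Fourier series of the
  character sum; the parameter \<open>r\<close> is Abel's regularisation.
\<close>

definition abel_char_sum :: "nat \<Rightarrow> (int \<Rightarrow> complex) \<Rightarrow> real \<Rightarrow> real \<Rightarrow> complex" where
  "abel_char_sum q chi r x = - (\<Sum>m\<in>{0..<int q}. chi m * of_real (abel_sawtooth r (x - of_int m / real q)))"

text \<open>Frequencies n and -n taken together, without the common factor \<tau>(chi) / (2 pi i
  n).\<close>

definition char_fourier :: "(int \<Rightarrow> complex) \<Rightarrow> nat \<Rightarrow> real \<Rightarrow> complex" where
  "char_fourier chi n x = cnj (chi (int n)) *
     (cnj (chi (-1)) * unit_exp (real n * x) - unit_exp (- (real n * x)))"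

text \<open>With the sine split into exponentials, the sum over residues \<open>m\<close> becomes a
  pair of twisted Gauss sums at \<open>- k\<close> and \<open>k\<close>, and
  \<open>gauss_sum_twisted\<close> extracts the character values.\<close>

lemma abel_char_sum_sums:
  assumes prim: "primitive_character q chi" and r: "0 \<le> r" "r < 1"
  shows "(\<lambda>n. gauss_sum q chi / (2 * of_real pi * \<i>) *
            (of_real (r ^ Suc n / real (Suc n)) * char_fourier chi (Suc n) x)) sums abel_char_sum q chi r x"
proof -
  have dc: "dirichlet_character q chi" using prim by (simp add: primitive_character_def)
  have q: "q > 0" using dc by (simp add: dirichlet_character_def)
  let ?\<tau> = "gauss_sum q chi"
  have "(\<lambda>n. chi m / of_real pi * of_real (r ^ Suc n / real (Suc n) * sin (2 * pi * (real (Suc n) * (x - of_int m / real q)))))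
          sums (chi m / of_real pi * of_real (- pi * abel_sawtooth r (x - of_int m / real q)))" for m
    by (intro sums_mult sums_of_real abel_sawtooth_sums r)
  then have "(\<lambda>n. \<Sum>m\<in>{0..<int q}. chi m / of_real pi * of_real (r ^ Suc n / real (Suc n) * sin (2 * pi * (real (Suc n) * (x - of_int m / real q)))))
          sums (\<Sum>m\<in>{0..<int q}. chi m / of_real pi * of_real (- pi * abel_sawtooth r (x - of_int m / real q)))"
    by (intro sums_sum)
  also have "(\<Sum>m\<in>{0..<int q}. chi m / of_real pi * of_real (- pi * abel_sawtooth r (x - of_int m / real q)))
      = abel_char_sum q chi r x"
    unfolding abel_char_sum_def sum_negf[symmetric] by (intro sum.cong refl) simp
  also have "(\<lambda>n. \<Sum>m\<in>{0..<int q}. chi m / of_real pi * of_real (r ^ Suc n / real (Suc n) * sin (2 * pi * (real (Suc n) * (x - of_int m / real q)))))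
      = (\<lambda>n. ?\<tau> / (2 * of_real pi * \<i>) * (of_real (r ^ Suc n / real (Suc n)) * char_fourier chi (Suc n) x))"
  proof
    fix n
    define k where "k = int (Suc n)"
    define R where "R = complex_of_real (r ^ Suc n / real (Suc n))"
    have "(\<Sum>m\<in>{0..<int q}. chi m / of_real pi * of_real (r ^ Suc n / real (Suc n) * sin (2 * pi * (real (Suc n) * (x - of_int m / real q)))))
        = (\<Sum>m\<in>{0..<int q}. R / (2 * of_real pi * \<i>) *
             (unit_exp (of_int k * x) * (chi m * unit_exp (of_int ((- k) * m) / real q))
              - unit_exp (- (of_int k * x)) * (chi m * unit_exp (of_int (k * m) / real q))))"
    proof (intro sum.cong refl)
      fix m
      have 1: "unit_exp (real (Suc n) * (x - of_int m / real q)) = unit_exp (of_int k * x) * unit_exp (of_int ((- k) * m) / real q)"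
        unfolding unit_exp_add[symmetric] by (rule arg_cong[of _ _ unit_exp]) (use q in \<open>simp add: k_def field_simps\<close>)
      have 2: "unit_exp (- (real (Suc n) * (x - of_int m / real q))) = unit_exp (- (of_int k * x)) * unit_exp (of_int (k * m) / real q)"
        unfolding unit_exp_add[symmetric] by (rule arg_cong[of _ _ unit_exp]) (use q in \<open>simp add: k_def field_simps\<close>)
      show "chi m / of_real pi * of_real (r ^ Suc n / real (Suc n) * sin (2 * pi * (real (Suc n) * (x - of_int m / real q))))
        = R / (2 * of_real pi * \<i>) *
             (unit_exp (of_int k * x) * (chi m * unit_exp (of_int ((- k) * m) / real q))
              - unit_exp (- (of_int k * x)) * (chi m * unit_exp (of_int (k * m) / real q)))"
        unfolding of_real_mult sin_eq_unit_exp 1 2 R_def[symmetric] by (simp add: field_simps)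
    qed
    also have "\<dots> = R / (2 * of_real pi * \<i>) *
             (unit_exp (of_int k * x) * (cnj (chi (- k)) * ?\<tau>) - unit_exp (- (of_int k * x)) * (cnj (chi k) * ?\<tau>))"
      unfolding gauss_sum_twisted[OF prim, symmetric] sum_distrib_left[symmetric] sum_subtractf ..
    also have "chi (- k) = chi (-1) * chi k" using dirichlet_character_mult[OF dc, of "-1" k] by simp
    finally show "(\<Sum>m\<in>{0..<int q}. chi m / of_real pi * of_real (r ^ Suc n / real (Suc n) * sin (2 * pi * (real (Suc n) * (x - of_int m / real q)))))
      = ?\<tau> / (2 * of_real pi * \<i>) * (of_real (r ^ Suc n / real (Suc n)) * char_fourier chi (Suc n) x)"
      unfolding char_fourier_def R_def[symmetric] by (simp add: k_def algebra_simps)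
  qed
  finally show ?thesis .
qed

section \<open>The character sum in terms of the sawtooth\<close>

lemma char_sum_of_int_step:
  "char_sum chi (of_int (X + 1)) = char_sum chi (of_int X) + chi (X + 1)"
proof (cases "X \<ge> 0")
  case True
  have "{0<..X + 1} = insert (X + 1) {0<..X}" "{X + 1<..0} = {}" "{X<..0} = {}" using True by auto
  then show ?thesis by (simp add: char_sum_def del: of_int_add)
next
  case False
  have "{X<..0} = insert (X + 1) {X + 1<..0}" "{0<..X + 1} = {}" "{0<..X} = {}" using False by auto
  then show ?thesis by (simp add: char_sum_def del: of_int_add)
qed

text \<open>When X grows by 1, the quotient (X - m) div q jumps for exactly one residue, m = X + 1
  modulo q, so both sides increase by chi(X + 1). The induction runs in both directions, in
  accordance with the oriented sum for negative X.\<close>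

lemma char_sum_eq_floor_sum:
  assumes dc: "dirichlet_character q chi" and zero: "(\<Sum>m\<in>{0..<int q}. chi m) = 0"
  shows "char_sum chi (of_int X) = (\<Sum>m\<in>{0..<int q}. chi m * of_int ((X - m) div int q))"
proof -
  have q: "q > 0" using dc by (simp add: dirichlet_character_def)
  define D where "D X = (\<Sum>m\<in>{0..<int q}. chi m * of_int ((X - m) div int q))" for X
  have step: "D (X + 1) = D X + chi (X + 1)" for X
  proof -
    define k where "k = (X + 1) mod int q"
    have k: "k \<in> {0..<int q}" using q by (simp add: k_def)
    have "D (X + 1) - D X = (\<Sum>m\<in>{0..<int q}. chi m * of_int ((X + 1 - m) div int q - (X - m) div int q))"
      by (simp add: D_def sum_subtractf algebra_simps)
    also have "\<dots> = (\<Sum>m\<in>{0..<int q}. if m = k then chi m else 0)"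
    proof (intro sum.cong refl)
      fix m assume m: "m \<in> {0..<int q}"
      have *: "(Y + 1) div int q - Y div int q = (if int q dvd Y + 1 then 1 else 0)" for Y
      proof (cases "int q dvd Y + 1")
        case True
        then obtain l where l: "Y + 1 = int q * l" by auto
        then have "Y = int q * (l - 1) + (int q - 1)" by (simp add: algebra_simps)
        then have "Y div int q = l - 1" using q by (simp add: div_add1_eq)
        then show ?thesis using True l q by simp
      next
        case False
        have "0 \<le> Y mod int q" "Y mod int q < int q" using q by simp_all
        moreover have "Y mod int q \<noteq> int q - 1"
        proof
          assume "Y mod int q = int q - 1"
          moreover have "int q * (Y div int q + 1) = int q * (Y div int q) + int q"
            by (simp add: distrib_left)
          ultimately have "Y + 1 = int q * (Y div int q + 1)"
            using mult_div_mod_eq[of "int q" Y] by linarith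
          then show False using False by simp
        qed
        ultimately have r: "0 \<le> Y mod int q + 1" "Y mod int q + 1 < int q" by auto
        have "Y + 1 = int q * (Y div int q) + (Y mod int q + 1)" by simp
        then have "(Y + 1) div int q = Y div int q + (Y mod int q + 1) div int q"
          using q by (metis add.commute div_mult_self2 of_nat_0_less_iff order_less_irrefl)
        then show ?thesis using r False by (simp add: div_pos_pos_trivial)
      qed
      have "int q dvd X - m + 1 \<longleftrightarrow> m = k"
      proof -
        have "int q dvd X - m + 1 \<longleftrightarrow> (X + 1) mod int q = m mod int q"
          by (simp add: mod_eq_dvd_iff algebra_simps)
        also have "m mod int q = m" using m by simp
        finally show ?thesis by (auto simp: k_def)
      qed
      then show "chi m * of_int ((X + 1 - m) div int q - (X - m) div int q) = (if m = k then chi m else 0)"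
        using *[of "X - m"] by (simp add: algebra_simps)
    qed
    also have "\<dots> = chi k" using k by simp
    also have "\<dots> = chi (X + 1)"
      by (rule dirichlet_character_cong[OF dc]) (simp add: k_def cong_def)
    finally show ?thesis by (simp add: algebra_simps)
  qed
  have "char_sum chi (of_int X) = D X"
  proof (induction X rule: int_induct[where k = 0])
    case base
    have "D 0 = (\<Sum>m\<in>{0..<int q}. (if m = 0 then chi 0 else 0) - chi m)"
      unfolding D_def
    proof (intro sum.cong refl)
      fix m assume m: "m \<in> {0..<int q}"
      show "chi m * of_int ((0 - m) div int q) = (if m = 0 then chi 0 else 0) - chi m"
      proof (cases "m = 0")
        case False
        then have "(- m) div int q = -1" using m by (simp add: div_eq_minus1 zdiv_zminus1_eq_if)
        then show ?thesis using False by simp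
      qed simp
    qed
    also have "\<dots> = chi 0" using q zero by (simp add: sum_subtractf)
    \<comment> \<open>A nonzero value at 0 would mean \<open>q = 1\<close>, where the sum over
      residues does not vanish.\<close>
    also have "chi 0 = 0"
    proof (rule ccontr)
      assume "chi 0 \<noteq> 0"
      then have "q = 1" using dirichlet_character_eq_0_iff[OF dc, of 0] by simp
      moreover have "{0..<1::int} = {0}" by auto
      ultimately show False using zero \<open>chi 0 \<noteq> 0\<close> by simp
    qed
    finally show ?case by (simp add: char_sum_def)
  next
    case (step1 i)
    then show ?case using step[of i] char_sum_of_int_step[of chi i] by simp
  next
    case (step2 i)
    then show ?case using step[of "i - 1"] char_sum_of_int_step[of chi "i - 1"] by simp
  qed
  then show ?thesis by (simp add: D_def)
qed

text \<open>In frac(t) - 1/2 the part independent of \<open>m\<close> is killed by the vanishing sum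
  of \<open>chi\<close>, the floors give the character sum, and the part linear in \<open>m\<close>
  leaves a constant. The condition on \<open>x\<close> avoids the jumps, where the sawtooth takes
  its midpoint value.\<close>

lemma sawtooth_char_sum:
  assumes dc: "dirichlet_character q chi" and zero: "(\<Sum>m\<in>{0..<int q}. chi m) = 0"
    and x: "x * real q \<notin> \<int>"
  shows "- (\<Sum>m\<in>{0..<int q}. chi m * of_real (sawtooth (x - of_int m / real q)))
     = char_sum chi (x * real q) + (\<Sum>m\<in>{0..<int q}. chi m * of_int m) / of_nat q"
proof -
  have q: "q > 0" using dc by (simp add: dirichlet_character_def)
  have "sawtooth (x - of_int m / real q)
      = (x - 1/2) - of_int m / real q - of_int ((\<lfloor>x * real q\<rfloor> - m) div int q)" for m
  proof -
    have "x - of_int m / real q \<notin> \<int>"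
    proof
      assume "x - of_int m / real q \<in> \<int>"
      then obtain n where "x - of_int m / real q = of_int n" by (auto elim: Ints_cases)
      then have "x * real q = of_int (m + n * int q)" using q by (simp add: field_simps)
      then show False using x by (metis Ints_of_int)
    qed
    moreover have "\<lfloor>x - of_int m / real q\<rfloor> = (\<lfloor>x * real q\<rfloor> - m) div int q"
    proof -
      have "x - of_int m / real q = (x * real q - of_int m) / real_of_int (int q)"
        using q by (simp add: field_simps)
      then have "\<lfloor>x - of_int m / real q\<rfloor> = \<lfloor>x * real q - of_int m\<rfloor> div int q"
        by (simp only: floor_divide_real_eq_div)
      then show ?thesis by simp
    qed
    ultimately show ?thesis by (simp add: sawtooth_def frac_def)
  qed
  then have saw: "complex_of_real (sawtooth (x - of_int m / real q))
      = of_real (x - 1/2) - of_int m / of_nat q - of_int ((\<lfloor>x * real q\<rfloor> - m) div int q)" for m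
    by simp
  have "- (\<Sum>m\<in>{0..<int q}. chi m * of_real (sawtooth (x - of_int m / real q)))
     = - (\<Sum>m\<in>{0..<int q}. chi m * of_real (x - 1/2) - chi m * of_int m / of_nat q
            - chi m * of_int ((\<lfloor>x * real q\<rfloor> - m) div int q))"
    by (simp only: saw right_diff_distrib times_divide_eq_right)
  also have "\<dots> = - ((\<Sum>m\<in>{0..<int q}. chi m) * of_real (x - 1/2)) + (\<Sum>m\<in>{0..<int q}. chi m * of_int m) / of_nat q
            + (\<Sum>m\<in>{0..<int q}. chi m * of_int ((\<lfloor>x * real q\<rfloor> - m) div int q))"
    by (simp add: sum_subtractf sum_distrib_right sum_divide_distrib)
  also have "(\<Sum>m\<in>{0..<int q}. chi m * of_int ((\<lfloor>x * real q\<rfloor> - m) div int q)) = char_sum chi (of_int \<lfloor>x * real q\<rfloor>)"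
    using char_sum_eq_floor_sum[OF dc zero] by simp
  also have "\<dots> = char_sum chi (x * real q)" by (simp add: char_sum_def)
  finally show ?thesis by (simp add: zero)
qed

lemma dirichlet_character_minus_one:
  assumes "dirichlet_character q chi"
  shows "chi (-1) = 1 \<or> chi (-1) = -1"
proof -
  have "chi (-1) * chi (-1) = 1"
    using dirichlet_character_mult[OF assms, of "-1" "-1"] dirichlet_character_one[OF assms] by simp
  then show ?thesis by (simp add: square_eq_1_iff)
qed

text \<open>The constant is identified with -A(chi) by taking x = 0 in two ways: through the
  sawtooth values, and through the Fourier series, where Abel's theorem produces L(1) of the
  conjugate character.\<close>

lemma abel_char_sum_tendsto:
  assumes prim: "primitive_character q chi" and q1: "q > 1"
    and r: "\<And>j. 0 \<le> r j" "\<And>j. r j < 1" "r \<longlonglongrightarrow> 1" and x: "x * real q \<notin> \<int>"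
  shows "(\<lambda>j. abel_char_sum q chi (r j) x) \<longlonglongrightarrow> char_sum chi (x * real q) - char_A q chi"
proof -
  have dc: "dirichlet_character q chi" using prim by (simp add: primitive_character_def)
  obtain u where u: "coprime u (int q)" "chi u \<noteq> 1" using primitive_character_nontrivial[OF prim q1] by blast
  have zero: "(\<Sum>m\<in>{0..<int q}. chi m) = 0" by (rule dirichlet_character_sum_zero[OF dc u])
  let ?M = "(\<Sum>m\<in>{0..<int q}. chi m * of_int m) / of_nat q"
  have lim: "(\<lambda>j. abel_char_sum q chi (r j) x) \<longlonglongrightarrow> - (\<Sum>m\<in>{0..<int q}. chi m * of_real (sawtooth (x - of_int m / real q)))" for x
    unfolding abel_char_sum_def by (intro tendsto_intros abel_sawtooth_tendsto r)
  have "?M = - char_A q chi"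
  proof (rule LIMSEQ_unique)
    have "- (\<Sum>m\<in>{0..<int q}. chi m * of_real (sawtooth (0 - of_int m / real q)))
        = - (\<Sum>m\<in>{0..<int q}. chi m / 2 - chi m * of_int m / of_nat q)"
    proof (intro arg_cong[where f = uminus] sum.cong refl)
      fix m assume m: "m \<in> {0..<int q}"
      show "chi m * of_real (sawtooth (0 - of_int m / real q)) = chi m / 2 - chi m * of_int m / of_nat q"
      proof (cases "m = 0")
        case True
        then show ?thesis using q1 dirichlet_character_eq_0_iff[OF dc, of 0] by simp
      next
        case False
        have fl: "\<lfloor>- (of_int m / real q)\<rfloor> = -1"
          using m False by (intro floor_unique) (auto simp: field_simps)
        have "- (of_int m / real q) \<notin> \<int>"
        proof
          assume "- (of_int m / real q) \<in> \<int>"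
          then have "- (of_int m / real q) = of_int \<lfloor>- (of_int m / real q)\<rfloor>" by (metis floor_of_int Ints_cases)
          then have "of_int m / real q = 1" using fl by simp
          then show False using m by (simp add: field_simps)
        qed
        then have "sawtooth (0 - of_int m / real q) = 1 / 2 - of_int m / real q"
          using fl by (simp add: sawtooth_def frac_def)
        then have "complex_of_real (sawtooth (0 - of_int m / real q)) = 1 / 2 - of_int m / of_nat q" by simp
        then show ?thesis by (simp only: right_diff_distrib times_divide_eq_right mult_1_right)
      qed
    qed
    also have "\<dots> = ?M" using zero by (simp add: sum_subtractf sum_divide_distrib[symmetric])
    finally show "(\<lambda>j. abel_char_sum q chi (r j) 0) \<longlonglongrightarrow> ?M" using lim[of 0] by simp
    let ?c = "\<lambda>n. cnj (chi (int (Suc n)))"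
    have cnj_sum: "cmod (\<Sum>k<n. ?c k) \<le> real q" for n
      using nonprincipal_partial_sums[OF dc u, of n] by (metis cnj_sum complex_mod_cnj)
    interpret bounded_partial_sums ?c "real q" by unfold_locales (rule cnj_sum)
    let ?K = "gauss_sum q chi / (2 * of_real pi * \<i>) * (cnj (chi (-1)) - 1)"
    have "abel_char_sum q chi (r j) 0 = ?K * (\<Sum>n. ?c n * of_real (r j ^ Suc n / real (Suc n)))" for j
    proof -
      have smm: "summable (\<lambda>n. ?c n * of_real (r j ^ Suc n / real (Suc n)))"
      proof (rule summable_comparison_test')
        show "summable (\<lambda>n. r j ^ Suc n)" using r(1,2)[of j] by (intro summable_geometric summable_Suc_iff[THEN iffD2]) auto
        fix n
        have "r j ^ Suc n / real (Suc n) \<le> r j ^ Suc n" using r(1)[of j] divide_left_mono[of 1 "real (Suc n)" "r j ^ Suc n"] by simp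
        moreover have "cmod (?c n) \<le> 1" using dirichlet_character_norm_le[OF dc] by simp
        ultimately have "cmod (?c n) * (r j ^ Suc n / real (Suc n)) \<le> 1 * r j ^ Suc n"
          using r(1)[of j] by (intro mult_mono) auto
        then show "norm (?c n * of_real (r j ^ Suc n / real (Suc n))) \<le> r j ^ Suc n"
          using r(1)[of j] unfolding norm_mult norm_of_real by simp
      qed
      have "(\<lambda>n. ?K * (?c n * of_real (r j ^ Suc n / real (Suc n)))) sums abel_char_sum q chi (r j) 0"
      proof -
        have "char_fourier chi (Suc n) 0 = ?c n * (cnj (chi (-1)) - 1)" for n
          by (simp add: char_fourier_def unit_exp_def)
        then show ?thesis
          using abel_char_sum_sums[OF prim r(1,2)[of j], of 0] by (simp only: mult_ac)
      qed
      then show ?thesis by (rule sums_unique2[OF _ sums_mult[OF summable_sums[OF smm]]])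
    qed
    then have "(\<lambda>j. abel_char_sum q chi (r j) 0) \<longlonglongrightarrow> ?K * dirichlet_series ?c 1"
      by (simp only:) (rule tendsto_mult[OF tendsto_const Abel_limit[OF r(1) less_imp_le[OF r(2)] r(3)]])
    moreover have "dirichlet_series ?c 1 = dirichlet_L (\<lambda>n. cnj (chi n)) 1"
      by (rule dirichlet_L_eq_series[symmetric, where B = "real q"]) (use cnj_sum in auto)
    moreover have "cnj (chi (-1)) = chi (-1)"
      using dirichlet_character_minus_one[OF dc] by auto
    ultimately show "(\<lambda>j. abel_char_sum q chi (r j) 0) \<longlonglongrightarrow> - char_A q chi"
      by (simp add: char_A_def algebra_simps diff_divide_distrib)
  qed
  then show ?thesis using lim[of x] sawtooth_char_sum[OF dc zero x] by simp
qed


section \<open>Averaging over a short interval\<close>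

text \<open>Integration multiplies frequency k by a factor close to 2 \<delta> for small k and at
  most 1 / (pi |k|) always: low frequencies survive, high ones are damped.\<close>

lemma has_integral_unit_exp:
  fixes k u \<delta> :: real
  assumes "k \<noteq> 0" "\<delta> \<ge> 0"
  shows "((\<lambda>x. unit_exp (k * x)) has_integral unit_exp (k * u) * of_real (sin (2 * pi * k * \<delta>) / (pi * k))) {u - \<delta>..u + \<delta>}"
proof -
  define c where "c = 2 * of_real pi * \<i> * of_real k"
  have c: "c \<noteq> 0" using assms(1) by (simp add: c_def)
  have ue: "unit_exp (k * x) = exp (of_real x * c)" for x
    by (simp add: unit_exp_def cis_conv_exp c_def mult_ac)
  have "((\<lambda>x. exp (of_real x * c)) has_integral (exp (of_real (u + \<delta>) * c) / c - exp (of_real (u - \<delta>) * c) / c)) {u - \<delta>..u + \<delta>}"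
  proof (rule fundamental_theorem_of_calculus)
    fix x
    have "((\<lambda>z. exp (z * c) / c) has_field_derivative exp (of_real x * c)) (at (of_real x))"
      using c by (auto intro!: derivative_eq_intros)
    then show "((\<lambda>x. exp (of_real x * c) / c) has_vector_derivative exp (of_real x * c)) (at x within {u - \<delta>..u + \<delta>})"
      by (rule has_vector_derivative_real_field)
  qed (use assms(2) in simp)
  also have "exp (of_real (u + \<delta>) * c) / c - exp (of_real (u - \<delta>) * c) / c
      = unit_exp (k * u) * of_real (sin (2 * pi * k * \<delta>) / (pi * k))"
  proof -
    have 1: "exp (of_real (u + \<delta>) * c) = unit_exp (k * u) * unit_exp (k * \<delta>)"
      and 2: "exp (of_real (u - \<delta>) * c) = unit_exp (k * u) * unit_exp (- (k * \<delta>))"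
      unfolding ue[symmetric] unit_exp_add[symmetric] by (simp_all add: algebra_simps)
    have 3: "complex_of_real (sin (2 * pi * k * \<delta>)) = (unit_exp (k * \<delta>) - unit_exp (- (k * \<delta>))) / (2 * \<i>)"
      using sin_eq_unit_exp[of "k * \<delta>"] by (simp add: mult.assoc)
    show ?thesis unfolding 1 2 of_real_divide 3 of_real_mult
      by (simp add: c_def diff_divide_distrib right_diff_distrib mult_ac)
  qed
  finally show ?thesis by (simp add: ue)
qed

lemma has_integral_char_fourier:
  assumes "n > 0" "\<delta> \<ge> 0"
  shows "(char_fourier chi n has_integral
            char_fourier chi n u * of_real (sin (2 * pi * real n * \<delta>) / (pi * real n))) {u - \<delta>..u + \<delta>}"
proof -
  let ?w = "complex_of_real (sin (2 * pi * real n * \<delta>) / (pi * real n))"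
  have 1: "((\<lambda>x. unit_exp (real n * x)) has_integral unit_exp (real n * u) * ?w) {u - \<delta>..u + \<delta>}"
    using assms by (intro has_integral_unit_exp) auto
  have 2: "((\<lambda>x. unit_exp (- (real n * x))) has_integral unit_exp (- (real n * u)) * ?w) {u - \<delta>..u + \<delta>}"
    using has_integral_unit_exp[of "- real n" \<delta> u] assms by simp
  have "((\<lambda>x. cnj (chi (int n)) * (cnj (chi (-1)) * unit_exp (real n * x) - unit_exp (- (real n * x))))
      has_integral cnj (chi (int n)) * (cnj (chi (-1)) * (unit_exp (real n * u) * ?w) - unit_exp (- (real n * u)) * ?w)) {u - \<delta>..u + \<delta>}"
    by (intro has_integral_mult_right has_integral_diff 1 2)
  then show ?thesis unfolding char_fourier_def by (simp add: algebra_simps)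
qed

lemma norm_char_fourier_le:
  assumes "dirichlet_character q chi"
  shows "cmod (char_fourier chi n x) \<le> 2"
proof -
  have "cmod (cnj (chi (-1)) * unit_exp (real n * x) - unit_exp (- (real n * x))) \<le> 1 + 1"
    using dirichlet_character_norm_le[OF assms, of "-1"]
    by (intro order.trans[OF norm_triangle_ineq4] add_mono) (auto simp: norm_mult)
  then have "cmod (chi (int n)) * cmod (cnj (chi (-1)) * unit_exp (real n * x) - unit_exp (- (real n * x))) \<le> 1 * 2"
    using dirichlet_character_norm_le[OF assms, of "int n"] by (intro mult_mono) auto
  then show ?thesis by (simp add: char_fourier_def norm_mult)
qed

lemma continuous_on_char_fourier: "continuous_on S (char_fourier chi n)"
  unfolding char_fourier_def unit_exp_def by (intro continuous_intros continuous_on_cis)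

text \<open>For r < 1 a geometric majorant permits termwise integration. At r = 1 the series does
  not converge uniformly, so r tends to 1 only after integrating.\<close>

lemma abel_char_sum_integral:
  assumes prim: "primitive_character q chi" and r: "0 \<le> r" "r < 1" and \<delta>: "\<delta> \<ge> 0"
  obtains J where "(abel_char_sum q chi r has_integral J) {u - \<delta>..u + \<delta>}"
    "(\<lambda>n. gauss_sum q chi / (2 * of_real pi * \<i>) * (of_real (r ^ Suc n / real (Suc n)) *
        (char_fourier chi (Suc n) u * of_real (sin (2 * pi * real (Suc n) * \<delta>) / (pi * real (Suc n)))))) sums J"
proof -
  have dc: "dirichlet_character q chi" using prim by (simp add: primitive_character_def)
  let ?K = "gauss_sum q chi / (2 * of_real pi * \<i>)"
  define t where "t n x = ?K * (of_real (r ^ Suc n / real (Suc n)) * char_fourier chi (Suc n) x)" for n x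
  define I where "I n = ?K * (of_real (r ^ Suc n / real (Suc n)) *
        (char_fourier chi (Suc n) u * of_real (sin (2 * pi * real (Suc n) * \<delta>) / (pi * real (Suc n)))))" for n
  have eq: "abel_char_sum q chi r x = (\<Sum>n. t n x)" for x
    using abel_char_sum_sums[OF prim r, of x] by (simp add: t_def sums_iff)
  have ul: "uniform_limit {u - \<delta>..u + \<delta>} (\<lambda>N x. \<Sum>n<N. t n x) (\<lambda>x. \<Sum>n. t n x) sequentially"
  proof (rule Weierstrass_m_test)
    show "summable (\<lambda>n. cmod ?K * (r ^ Suc n * 2))"
      using r by (intro summable_mult summable_mult2 summable_geometric summable_Suc_iff[THEN iffD2]) auto
    fix n x
    have "r ^ Suc n / real (Suc n) \<le> r ^ Suc n"
      using r(1) divide_left_mono[of 1 "real (Suc n)" "r ^ Suc n"] by simp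
    then have "(r ^ Suc n / real (Suc n)) * cmod (char_fourier chi (Suc n) x) \<le> r ^ Suc n * 2"
      using r(1) norm_char_fourier_le[OF dc] by (intro mult_mono) auto
    moreover have "cmod (of_real (r ^ Suc n / real (Suc n))) = r ^ Suc n / real (Suc n)"
      using r(1) by (simp only: norm_of_real) simp
    ultimately show "cmod (t n x) \<le> cmod ?K * (r ^ Suc n * 2)"
      unfolding t_def norm_mult[of ?K] norm_mult[of "of_real _"] by (intro mult_left_mono) auto
  qed
  have cont: "continuous_on {u - \<delta>..u + \<delta>} (\<lambda>x. \<Sum>n<N. t n x)" for N
    unfolding t_def by (intro continuous_intros continuous_on_char_fourier)
  obtain IN J where IJ: "\<And>N. ((\<lambda>x. \<Sum>n<N. t n x) has_integral IN N) {u - \<delta>..u + \<delta>}"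
      "((\<lambda>x. \<Sum>n. t n x) has_integral J) {u - \<delta>..u + \<delta>}" "IN \<longlonglongrightarrow> J"
    by (rule uniform_limit_integral[OF ul cont trivial_limit_sequentially]) blast
  have "((\<lambda>x. \<Sum>n<N. t n x) has_integral (\<Sum>n<N. I n)) {u - \<delta>..u + \<delta>}" for N
    unfolding t_def I_def
    by (intro has_integral_sum has_integral_mult_right has_integral_char_fourier \<delta>) auto
  then have "IN = (\<lambda>N. \<Sum>n<N. I n)" using IJ(1) has_integral_unique by blast
  then have "I sums J" using IJ(3) by (simp add: sums_def)
  then show ?thesis using that IJ(2) unfolding eq[symmetric] I_def by blast
qed

lemma primitive_character_cnj:
  "primitive_character q chi \<Longrightarrow> primitive_character q (\<lambda>x. cnj (chi x))"
  unfolding primitive_character_iff using dirichlet_character_cnj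
  by (metis complex_cnj_cancel_iff complex_cnj_one)

lemma abs_sin_diff_le: "\<bar>sin t - t\<bar> \<le> t\<^sup>2 / 2" for t :: real
  using Maclaurin_sin_bound[of t 2] by (simp add: numeral_2_eq_2 sin_coeff_def)

lemma harm_ge_ln: "y \<ge> 1 \<Longrightarrow> (\<Sum>n<y. 1 / real (Suc n)) \<ge> ln (real y)"
proof -
  assume y: "y \<ge> 1"
  have "ln (real y) \<le> ln (real y + 1)" using y by simp
  also have "\<dots> \<le> harm y" by (rule ln_le_harm)
  also have "harm y = (\<Sum>n<y. 1 / real (Suc n))"
    unfolding harm_def by (rule sum.reindex_bij_witness[of _ Suc "\<lambda>k. k - 1"]) (auto simp: field_simps)
  finally show ?thesis .
qed

section \<open>The main term at a / b\<close>

text \<open>Opposite parity makes the two exponentials add up, so the periodic function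
  \<open>f\<close> has mean \<mu> = 2 psi(-a) \<tau> / b, with \<tau> the Gauss sum of the conjugate
  of psi; for equal parity the mean would be 0. The mean is weighted by the harmonic sum, while the
  rest has bounded partial sums and contributes O(1).\<close>

lemma main_term_lower_bound:
  assumes prim: "primitive_character b psi"
    and agree: "\<And>n. 0 < n \<Longrightarrow> n \<le> y \<Longrightarrow> chi (int n) = psi (int n)"
    and parity: "chi (-1) = - psi (-1)" and a: "coprime a (int b)" and y: "y \<ge> 1"
  shows "cmod (\<Sum>n<y. char_fourier chi (Suc n) (of_int a / real b) / of_nat (Suc n))
           \<ge> 2 / sqrt (real b) * ln (real y) - 8 * real b"
proof -
  have dc: "dirichlet_character b psi" using prim by (simp add: primitive_character_def)
  have b: "b > 0" using dc by (simp add: dirichlet_character_def)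
  let ?psi = "\<lambda>x. cnj (psi x)"
  have prim': "primitive_character b ?psi" by (rule primitive_character_cnj[OF prim])
  have dc': "dirichlet_character b ?psi" by (rule dirichlet_character_cnj[OF dc])
  have pm: "cnj (psi (-1)) = psi (-1)" using dirichlet_character_minus_one[OF dc] by auto
  define f where "f x = ?psi x * (psi (-1) * unit_exp (of_int (a * x) / real b) + unit_exp (of_int ((- a) * x) / real b))" for x
  have per: "f x = f z" if "[x = z] (mod int b)" for x z
    unfolding f_def dirichlet_character_cong[OF dc that] unit_exp_cong[OF b that, of a]
      unit_exp_cong[OF b that, of "- a"] ..
  have norm_f: "cmod (f x) \<le> 2" for x
  proof -
    have "cmod (psi (-1) * unit_exp (of_int (a * x) / real b) + unit_exp (of_int ((- a) * x) / real b)) \<le> 1 + 1"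
      using dirichlet_character_norm_le[OF dc, of "-1"]
      by (intro order.trans[OF norm_triangle_ineq] add_mono) (auto simp: norm_mult)
    then have "cmod (psi x) * cmod (psi (-1) * unit_exp (of_int (a * x) / real b) + unit_exp (of_int ((- a) * x) / real b)) \<le> 1 * 2"
      using dirichlet_character_norm_le[OF dc, of x] by (intro mult_mono) auto
    then show ?thesis by (simp add: f_def norm_mult)
  qed
  define \<mu> where "\<mu> = 2 * psi (- a) * gauss_sum b ?psi / of_nat b"
  have "cmod (psi (- a)) = 1" using a dirichlet_character_norm[OF dc, of "- a"] by simp
  then have "cmod \<mu> = 2 * sqrt (real b) / real b"
    unfolding \<mu>_def using norm_gauss_sum[OF prim'] by (simp add: norm_mult norm_divide)
  also have "\<dots> = 2 / sqrt (real b)" using b by (simp add: field_simps)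
  finally have norm_mu: "cmod \<mu> = 2 / sqrt (real b)" .
  have "sqrt (real b) \<ge> 1" using b by simp
  then have mu2: "cmod \<mu> \<le> 2" unfolding norm_mu by (simp add: divide_le_eq)
  have "(\<Sum>x\<in>{0..<int b}. f x)
      = psi (-1) * (\<Sum>x\<in>{0..<int b}. ?psi x * unit_exp (of_int (a * x) / real b))
        + (\<Sum>x\<in>{0..<int b}. ?psi x * unit_exp (of_int ((- a) * x) / real b))"
    by (simp add: f_def sum_distrib_left sum.distrib algebra_simps)
  also have "\<dots> = psi (-1) * (cnj (?psi a) * gauss_sum b ?psi) + cnj (?psi (- a)) * gauss_sum b ?psi"
    unfolding gauss_sum_twisted[OF prim'] ..
  also have "\<dots> = of_nat b * \<mu>"
    using dirichlet_character_mult[OF dc, of "-1" a] b by (simp add: \<mu>_def)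
  finally have sum_f: "(\<Sum>x\<in>{0..<int b}. f x) = of_nat b * \<mu>" .
  define c where "c k = f (int (Suc k)) - \<mu>" for k
  \<comment> \<open>Each term is at most 2 + 2 in modulus, whence 4 b here and 8 b after
    \<open>Abel_inequality\<close>.\<close>
  have part: "cmod (\<Sum>k<n. c k) \<le> 4 * real b" for n
  proof (rule partial_sums_periodic_bound[OF _ _ b])
    show "c (k + b) = c k" for k
      unfolding c_def by (intro arg_cong2[where f = minus] refl per) (simp add: cong_iff_dvd_diff)
    have "(\<Sum>k<b. f (int (Suc k))) = (\<Sum>k=1..b. f (int k))"
      by (rule sum.reindex_bij_witness[of _ "\<lambda>k. k - 1" Suc]) auto
    also have "\<dots> = (\<Sum>x\<in>{0..<int b}. f x)" by (rule sum_period_residues[OF b per])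
    finally show "(\<Sum>k<b. c k) = 0" by (simp add: c_def sum_subtractf sum_f)
    show "cmod (c k) \<le> 4" for k
      unfolding c_def using norm_triangle_ineq4[of "f (int (Suc k))" \<mu>] norm_f[of "int (Suc k)"] mu2 by linarith
  qed
  have "cmod (\<Sum>k=0..<y. c k * of_real (1 / real (Suc k))) \<le> 2 * (4 * real b) * (1 / real (Suc 0))"
    by (rule Abel_inequality[OF part]) (auto simp: field_simps)
  then have osc: "cmod (\<Sum>k<y. c k / of_nat (Suc k)) \<le> 8 * real b"
    by (simp add: lessThan_atLeast0 del: of_nat_Suc)
  have cf: "char_fourier chi (Suc n) (of_int a / real b) = - f (int (Suc n))" if "n < y" for n
  proof -
    have 1: "real (Suc n) * (of_int a / real b) = of_int (a * int (Suc n)) / real b" by simp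
    have 2: "- (of_int (a * int (Suc n)) / real b) = of_int ((- a) * int (Suc n)) / real b" by simp
    have 3: "chi (int (Suc n)) = psi (int (Suc n))" using agree[of "Suc n"] that by simp
    show ?thesis unfolding char_fourier_def 1 2 3 parity f_def complex_cnj_minus pm
      by (simp add: algebra_simps)
  qed
  have "(\<Sum>n<y. char_fourier chi (Suc n) (of_int a / real b) / of_nat (Suc n))
      = (\<Sum>n<y. - (c n / of_nat (Suc n)) - \<mu> * of_real (1 / real (Suc n)))"
  proof (intro sum.cong refl)
    fix n assume "n \<in> {..<y}"
    then show "char_fourier chi (Suc n) (of_int a / real b) / of_nat (Suc n)
        = - (c n / of_nat (Suc n)) - \<mu> * of_real (1 / real (Suc n))"
      using cf[of n] by (simp add: c_def diff_divide_distrib del: of_nat_Suc)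
  qed
  also have "\<dots> = - (\<Sum>n<y. c n / of_nat (Suc n)) - \<mu> * of_real (\<Sum>n<y. 1 / real (Suc n))"
    by (simp add: sum_subtractf sum_negf sum_distrib_left del: of_nat_Suc)
  finally have eq: "(\<Sum>n<y. char_fourier chi (Suc n) (of_int a / real b) / of_nat (Suc n))
      = - (\<Sum>n<y. c n / of_nat (Suc n)) - \<mu> * of_real (\<Sum>n<y. 1 / real (Suc n))" .
  have "cmod (\<mu> * of_real (\<Sum>n<y. 1 / real (Suc n))) = 2 / sqrt (real b) * (\<Sum>n<y. 1 / real (Suc n))"
    unfolding norm_mult norm_mu norm_of_real by (simp add: sum_nonneg)
  also have "\<dots> \<ge> 2 / sqrt (real b) * ln (real y)"
    by (intro mult_left_mono harm_ge_ln y) auto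
  finally have "cmod (\<mu> * of_real (\<Sum>n<y. 1 / real (Suc n))) \<ge> 2 / sqrt (real b) * ln (real y)" .
  moreover have "cmod (\<mu> * of_real (\<Sum>n<y. 1 / real (Suc n))) - cmod (\<Sum>n<y. c n / of_nat (Suc n))
      \<le> cmod (- (\<Sum>n<y. c n / of_nat (Suc n)) - \<mu> * of_real (\<Sum>n<y. 1 / real (Suc n)))"
    using norm_triangle_ineq2[of "- (\<mu> * of_real (\<Sum>n<y. 1 / real (Suc n)))" "\<Sum>n<y. c n / of_nat (Suc n)"]
    by (simp only: norm_minus_cancel diff_conv_add_uminus add.commute)
  ultimately show ?thesis unfolding eq using osc by linarith
qed


section \<open>Existence of a good \<alpha>\<close>

text \<open>Telescoping majorant: 1 / m^2 is at most 1 / (m - 1) - 1 / m.\<close>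

lemma tail_inverse_squares:
  assumes "y \<ge> 1" "0 \<le> M" "\<And>n. cmod (f n) \<le> M / (real (Suc (n + y)))\<^sup>2"
  shows "cmod (\<Sum>n. f n) \<le> M / real y"
proof -
  have "(\<lambda>n. M / real (n + y)) \<longlonglongrightarrow> 0"
    by (intro tendsto_divide_0[OF tendsto_const] filterlim_at_top_imp_at_infinity
        filterlim_compose[OF filterlim_real_sequentially] filterlim_add_const_nat_at_top)
  from telescope_sums'[OF this]
  have sums: "(\<lambda>n. M / real (n + y) - M / real (Suc n + y)) sums (M / real y)" by simp
  have le: "cmod (f n) \<le> M / real (n + y) - M / real (Suc n + y)" for n
  proof -
    have "1 / (real (Suc (n + y)))\<^sup>2 \<le> 1 / (real (n + y) * real (Suc (n + y)))"
      using assms(1) by (intro divide_left_mono) (auto simp: power2_eq_square intro!: mult_right_mono)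
    also have "\<dots> = 1 / real (n + y) - 1 / real (Suc n + y)"
      using assms(1) by (simp add: field_simps)
    finally have "M * (1 / (real (Suc (n + y)))\<^sup>2) \<le> M * (1 / real (n + y) - 1 / real (Suc n + y))"
      using assms(2) by (rule mult_left_mono)
    then show ?thesis using assms(3)[of n] by (simp add: right_diff_distrib)
  qed
  have "cmod (\<Sum>n. f n) \<le> (\<Sum>n. M / real (n + y) - M / real (Suc n + y))"
    by (rule norm_suminf_le[OF le sums_summable[OF sums]])
  then show ?thesis using sums_unique[OF sums] by simp
qed

text \<open>These are the jumps of the character sum, where the limit of the Abel means is a
  midpoint; being finite in number they do not affect the integral.\<close>

lemma finite_lattice_points:
  assumes "q > 0"
  shows "finite {x \<in> {c..d}. x * real q \<in> \<int>}"
proof (rule finite_subset)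
  show "{x \<in> {c..d}. x * real q \<in> \<int>} \<subseteq> (\<lambda>n. of_int n / real q) ` {\<lfloor>c * real q\<rfloor>..\<lceil>d * real q\<rceil>}"
  proof
    fix x assume "x \<in> {x \<in> {c..d}. x * real q \<in> \<int>}"
    then obtain n where x: "c \<le> x" "x \<le> d" "x * real q = of_int n" by (auto elim: Ints_cases)
    have "c * real q \<le> of_int n" "of_int n \<le> d * real q"
      unfolding x(3)[symmetric] using x(1,2) by (auto intro!: mult_right_mono simp del: x(3))
    then have "n \<in> {\<lfloor>c * real q\<rfloor>..\<lceil>d * real q\<rceil>}" by (auto simp: floor_le_iff le_ceiling_iff)
    moreover have "x = of_int n / real q" using x(3) assms by (simp add: field_simps)
    ultimately show "x \<in> (\<lambda>n. of_int n / real q) ` {\<lfloor>c * real q\<rfloor>..\<lceil>d * real q\<rceil>}" by blast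
  qed
qed simp

text \<open>The integral over the interval is at least its length times \<open>cmod K * M\<close>,
  where \<open>M\<close> is the main term up to O(1). So the integrand cannot stay below
  \<open>cmod K * (M - 1)\<close> throughout.\<close>

lemma large_char_sum:
  assumes prim_psi: "primitive_character b psi" and prim: "primitive_character q chi" and q1: "q > 1"
    and agree: "\<And>n. 0 < n \<Longrightarrow> n \<le> y \<Longrightarrow> chi (int n) = psi (int n)"
    and parity: "chi (-1) = - psi (-1)" and a: "coprime a (int b)" and y: "y \<ge> 1" and C: "C > 0"
  obtains \<alpha> where "\<bar>\<alpha> - of_int a / real b\<bar> \<le> 1 / (C * real y)"
    "cmod (char_sum chi (\<alpha> * real q) - char_A q chi)
       \<ge> sqrt (real q) / (pi * sqrt (real b)) *
           (ln (real y) - sqrt (real b) * (8 * real b + 2 * pi / C + C / pi + 1) / 2)"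
proof -
  have dc: "dirichlet_character q chi" using prim by (simp add: primitive_character_def)
  have b: "b > 0" using prim_psi by (simp add: primitive_character_def dirichlet_character_def)
  define u where "u = of_int a / real b"
  \<comment> \<open>The order 1 / y balances the errors: relative to 2 \<delta>, the tail n > y
    costs C / pi and the linearisation of the sine for n \<le> y costs 2 pi / C.\<close>
  define \<delta> where "\<delta> = 1 / (C * real y)"
  have \<delta>: "\<delta> > 0" using C y by (simp add: \<delta>_def)
  let ?S = "{u - \<delta>..u + \<delta>}"
  define K where "K = gauss_sum q chi / (2 * of_real pi * \<i>)"
  have K: "cmod K = sqrt (real q) / (2 * pi)"
    using norm_gauss_sum[OF prim] by (simp add: K_def norm_divide norm_mult)
  then have K0: "cmod K > 0" using q1 by simp
  define cf where "cf n = char_fourier chi (Suc n) u" for n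
  have cf2: "cmod (cf n) \<le> 2" for n unfolding cf_def by (rule norm_char_fourier_le[OF dc])
  define w where "w n = sin (2 * pi * real (Suc n) * \<delta>) / (pi * real (Suc n))" for n
  define r where "r j = 1 - 1 / real (Suc j)" for j
  have r: "0 \<le> r j" "r j < 1" for j by (auto simp: r_def field_simps)
  have r_lim: "r \<longlonglongrightarrow> 1"
    using tendsto_diff[OF tendsto_const[of 1] LIMSEQ_inverse_real_of_nat] by (simp add: r_def[abs_def] inverse_eq_divide)
  define f where "f j x = abel_char_sum q chi (r j) x" for j x
  define g where "g x = - (\<Sum>m\<in>{0..<int q}. chi m * of_real (sawtooth (x - of_int m / real q)))" for x
  have f_g: "(\<lambda>j. f j x) \<longlonglongrightarrow> g x" for x
    unfolding f_def g_def abel_char_sum_def by (intro tendsto_intros abel_sawtooth_tendsto r r_lim)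
  have f_bound: "cmod (f j x) \<le> real q" for j x
  proof -
    have "cmod (f j x) \<le> (\<Sum>m\<in>{0..<int q}. 1)"
      unfolding f_def abel_char_sum_def norm_minus_cancel
    proof (rule sum_norm_le)
      fix m
      have "cmod (chi m) * \<bar>abel_sawtooth (r j) (x - of_int m / real q)\<bar> \<le> 1 * 1"
        using dirichlet_character_norm_le[OF dc, of m] abs_abel_sawtooth_le[OF r, of j "x - of_int m / real q"]
        by (intro mult_mono) auto
      then show "cmod (chi m * of_real (abel_sawtooth (r j) (x - of_int m / real q))) \<le> 1"
        by (simp add: norm_mult)
    qed
    then show ?thesis by simp
  qed
  have "\<exists>J. (f j has_integral J) ?S \<and>
      (\<lambda>n. K * (of_real (r j ^ Suc n / real (Suc n)) * (cf n * of_real (w n)))) sums J" for j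
    using abel_char_sum_integral[OF prim r less_imp_le[OF \<delta>], of j u]
    unfolding f_def K_def cf_def w_def by blast
  then obtain I where I: "\<And>j. (f j has_integral I j) ?S"
      "\<And>j. (\<lambda>n. K * (of_real (r j ^ Suc n / real (Suc n)) * (cf n * of_real (w n)))) sums I j"
    by metis
  \<comment> \<open>The bound \<open>real q\<close> does not depend on r, so the limit r to 1 may be
    taken under the integral although \<open>g\<close> has jumps.\<close>
  have dom: "g integrable_on ?S" "(\<lambda>j. integral ?S (f j)) \<longlonglongrightarrow> integral ?S g"
    using dominated_convergence[of f ?S "\<lambda>_. real q" g] I(1) f_bound f_g
    by (auto simp: integrable_on_def intro: integrable_const_ivl[unfolded integrable_on_def])
  have "integral ?S (f j) = I j" for j by (rule integral_unique[OF I(1)])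
  then have I_lim: "I \<longlonglongrightarrow> integral ?S g" using dom(2) by simp
  define P where "P j = (\<Sum>n<y. of_real (r j ^ Suc n / real (Suc n)) * (cf n * of_real (w n)))" for j
  have tail: "cmod (I j - K * P j) \<le> cmod K * (2 / pi) / real y" for j
  proof -
    define t where "t n = K * (of_real (r j ^ Suc n / real (Suc n)) * (cf n * of_real (w n)))" for n
    have t: "t sums I j" unfolding t_def by (rule I(2))
    have "K * P j = (\<Sum>n<y. t n)" by (simp only: P_def t_def sum_distrib_left)
    then have "I j - K * P j = (\<Sum>n. t (n + y))"
      using suminf_minus_initial_segment[OF sums_summable[OF t], of y] sums_unique[OF t] by simp
    also have "cmod \<dots> \<le> cmod K * (2 / pi) / real y"
    proof (rule tail_inverse_squares[OF y])
      fix n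
      let ?m = "real (Suc (n + y))"
      have "\<bar>r j ^ Suc (n + y) / ?m\<bar> \<le> 1 / ?m"
        using r[of j] power_le_one[of "r j" "Suc (n + y)"] by (simp add: divide_right_mono)
      moreover have "\<bar>w (n + y)\<bar> \<le> 1 / (pi * ?m)"
        unfolding w_def abs_divide using abs_sin_le_one by (intro frac_le) auto
      then have "cmod (cf (n + y)) * \<bar>w (n + y)\<bar> \<le> 2 * (1 / (pi * ?m))"
        using cf2 by (intro mult_mono) auto
      ultimately have "\<bar>r j ^ Suc (n + y) / ?m\<bar> * (cmod (cf (n + y)) * \<bar>w (n + y)\<bar>) \<le> 1 / ?m * (2 * (1 / (pi * ?m)))"
        by (rule mult_mono) auto
      then have "cmod (t (n + y)) \<le> cmod K * (1 / ?m * (2 * (1 / (pi * ?m))))"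
        unfolding t_def norm_mult norm_of_real by (intro mult_left_mono) auto
      then show "cmod (t (n + y)) \<le> cmod K * (2 / pi) / ?m\<^sup>2"
        by (simp add: power2_eq_square mult_ac)
    qed auto
    finally show ?thesis .
  qed
  define Q where "Q = (\<Sum>n<y. cf n / of_nat (Suc n) * of_real (w n))"
  have "P \<longlonglongrightarrow> (\<Sum>n<y. of_real (1 ^ Suc n / real (Suc n)) * (cf n * of_real (w n)))"
    unfolding P_def by (intro tendsto_intros r_lim) auto
  then have P_lim: "P \<longlonglongrightarrow> Q" by (simp add: Q_def del: of_nat_Suc)
  have "cmod (integral ?S g - K * Q) \<le> cmod K * (2 / pi) / real y"
  proof (rule Lim_norm_ubound[OF trivial_limit_sequentially])
    show "(\<lambda>j. I j - K * P j) \<longlonglongrightarrow> integral ?S g - K * Q" by (intro tendsto_intros I_lim P_lim)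
  qed (use tail in simp)
  then have int_ge: "cmod (integral ?S g) \<ge> cmod K * cmod Q - cmod K * (2 / pi) / real y"
    using norm_triangle_ineq2[of "K * Q" "integral ?S g"] by (simp add: norm_mult norm_minus_commute)
  \<comment> \<open>Low frequencies: \<open>w n\<close> is 2 \<delta> up to O(n \<delta>^2), and the
    1/n of the Fourier coefficient leaves the same error for every n.\<close>
  have "cmod (Q - of_real (2 * \<delta>) * (\<Sum>n<y. cf n / of_nat (Suc n))) \<le> (\<Sum>n<y. 4 * pi * \<delta>\<^sup>2)"
  proof -
    have "Q - of_real (2 * \<delta>) * (\<Sum>n<y. cf n / of_nat (Suc n)) = (\<Sum>n<y. cf n / of_nat (Suc n) * of_real (w n - 2 * \<delta>))"
      unfolding Q_def sum_distrib_left sum_subtractf[symmetric]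
      by (intro sum.cong refl) (simp add: algebra_simps del: of_nat_Suc)
    also have "cmod \<dots> \<le> (\<Sum>n<y. 4 * pi * \<delta>\<^sup>2)"
    proof (rule sum_norm_le)
      fix n
      let ?m = "real (Suc n)"
      have "w n - 2 * \<delta> = (sin (2 * pi * ?m * \<delta>) - 2 * pi * ?m * \<delta>) / (pi * ?m)"
        unfolding w_def by (simp add: diff_divide_distrib)
      then have "\<bar>w n - 2 * \<delta>\<bar> = \<bar>sin (2 * pi * ?m * \<delta>) - 2 * pi * ?m * \<delta>\<bar> / (pi * ?m)"
        by simp
      also have "\<dots> \<le> ((2 * pi * ?m * \<delta>)\<^sup>2 / 2) / (pi * ?m)"
        by (intro divide_right_mono abs_sin_diff_le) simp
      also have "\<dots> = 2 * pi * ?m * \<delta>\<^sup>2"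
      proof -
        have "((2 * pi * m * \<delta>)\<^sup>2 / 2) / (pi * m) = 2 * pi * m * \<delta>\<^sup>2" if "m > 0" for m
          using that by (simp add: field_simps power2_eq_square)
        then show ?thesis by simp
      qed
      finally have "\<bar>w n - 2 * \<delta>\<bar> \<le> 2 * pi * ?m * \<delta>\<^sup>2" .
      moreover have "cmod (cf n / of_nat (Suc n)) \<le> 2 / ?m"
        using cf2[of n] unfolding norm_divide norm_of_nat by (intro divide_right_mono) auto
      ultimately have "cmod (cf n / of_nat (Suc n)) * \<bar>w n - 2 * \<delta>\<bar> \<le> 2 / ?m * (2 * pi * ?m * \<delta>\<^sup>2)"
        by (intro mult_mono) auto
      then show "cmod (cf n / of_nat (Suc n) * of_real (w n - 2 * \<delta>)) \<le> 4 * pi * \<delta>\<^sup>2"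
        unfolding norm_mult norm_of_real by simp
    qed
    finally show ?thesis .
  qed
  then have "cmod (Q - of_real (2 * \<delta>) * (\<Sum>n<y. cf n / of_nat (Suc n))) \<le> real y * (4 * pi * \<delta>\<^sup>2)"
    by simp
  moreover have "cmod (of_real (2 * \<delta>) * (\<Sum>n<y. cf n / of_nat (Suc n))) \<ge> 2 * \<delta> * (2 / sqrt (real b) * ln (real y) - 8 * real b)"
    unfolding norm_mult norm_of_real cf_def u_def
    using main_term_lower_bound[where y = y and chi = chi and psi = psi and b = b and a = a] prim_psi agree parity a y \<delta> by simp
  ultimately have Q_ge: "cmod Q \<ge> 2 * \<delta> * (2 / sqrt (real b) * ln (real y) - 8 * real b) - real y * (4 * pi * \<delta>\<^sup>2)"
    using norm_triangle_ineq2[of "of_real (2 * \<delta>) * (\<Sum>n<y. cf n / of_nat (Suc n))" Q]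
    by (simp add: norm_minus_commute)
  define M where "M = 2 / sqrt (real b) * ln (real y) - 8 * real b - 2 * pi / C - C / pi"
  have "real y * (4 * pi * \<delta>\<^sup>2) = 2 * \<delta> * (2 * pi / C)"
    using y C by (simp add: \<delta>_def power2_eq_square)
  moreover have "(2 / pi) / real y = 2 * \<delta> * (C / pi)"
    using y C by (simp add: \<delta>_def)
  ultimately have "2 * \<delta> * M \<le> cmod Q - (2 / pi) / real y"
    using Q_ge unfolding M_def by (simp only: right_diff_distrib)
  then have "cmod K * (2 * \<delta> * M) \<le> cmod K * (cmod Q - (2 / pi) / real y)"
    using K0 by (intro mult_left_mono) auto
  then have int_ge': "cmod K * (2 * \<delta> * M) \<le> cmod (integral ?S g)"
    using int_ge by (simp add: right_diff_distrib)
  define L where "L = sqrt (real q) / (pi * sqrt (real b)) *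
           (ln (real y) - sqrt (real b) * (8 * real b + 2 * pi / C + C / pi + 1) / 2)"
  \<comment> \<open>The summand 1 in the stated constant is the slack that makes the final
    inequality strict.\<close>
  have L: "L = cmod K * (M - 1)"
    unfolding L_def K M_def using b by (simp add: field_simps)
  have "\<exists>\<alpha>. \<bar>\<alpha> - u\<bar> \<le> \<delta> \<and> L \<le> cmod (char_sum chi (\<alpha> * real q) - char_A q chi)"
  proof (rule ccontr)
    assume "\<not> ?thesis"
    then have less: "cmod (char_sum chi (\<alpha> * real q) - char_A q chi) < L" if "\<bar>\<alpha> - u\<bar> \<le> \<delta>" for \<alpha>
      using that by force
    \<comment> \<open>A nonpositive \<open>L\<close> would be attained at \<open>u\<close>
      itself.\<close>
    have "L > 0" using less[of u] \<delta> norm_ge_zero[of "char_sum chi (u * real q) - char_A q chi"] by (simp del: norm_ge_zero)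
    have "cmod (integral ?S g) \<le> L * measure lborel (cbox (u - \<delta>) (u + \<delta>))"
    proof (rule has_integral_bound_spike_finite)
      show "finite {x \<in> ?S. x * real q \<in> \<int>}" using q1 by (intro finite_lattice_points) simp
      show "(g has_integral integral ?S g) (cbox (u - \<delta>) (u + \<delta>))"
        using dom(1) by (simp add: integrable_integral)
      fix x assume x: "x \<in> cbox (u - \<delta>) (u + \<delta>) - {x \<in> ?S. x * real q \<in> \<int>}"
      then have "g x = char_sum chi (x * real q) - char_A q chi"
        using abel_char_sum_tendsto[OF prim q1 r r_lim, of x] f_g[of x] LIMSEQ_unique unfolding f_def by auto
      moreover have "\<bar>x - u\<bar> \<le> \<delta>" using x by (auto simp: abs_le_iff)
      ultimately show "norm (g x) \<le> L" using less[of x] by simp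
    qed (use \<open>L > 0\<close> in simp)
    also have "\<dots> = L * (2 * \<delta>)" using \<delta> by simp
    also have "\<dots> < cmod K * (2 * \<delta> * M)"
      unfolding L using K0 \<delta> by (simp add: algebra_simps)
    finally show False using int_ge' by simp
  qed
  then show ?thesis using that unfolding L_def u_def \<delta>_def by blast
qed

section \<open>Euler products and nonvanishing\<close>

text \<open>The multiples of a new prime p within the sifted set \<open>?A\<close> are exactly p
  times \<open>?A\<close>, so removing them multiplies the sum by 1 - a(p).\<close>

lemma euler_sieve:
  fixes a :: "nat \<Rightarrow> complex"
  assumes mult: "\<And>m n. a (m * n) = a m * a n"
    and abs: "(\<lambda>n. norm (a n)) summable_on {0<..}" and "finite S" "\<And>p. p \<in> S \<Longrightarrow> prime p"
  shows "infsum a {n. n > 0 \<and> (\<forall>p\<in>S. \<not> p dvd n)} = (\<Prod>p\<in>S. 1 - a p) * infsum a {0<..}"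
  using assms(3,4)
proof (induction S rule: finite_induct)
  case empty
  have "{n::nat. n > 0 \<and> (\<forall>p\<in>{}. \<not> p dvd n)} = {0<..}" by auto
  then show ?case by simp
next
  case (insert p S)
  let ?A = "{n. n > 0 \<and> (\<forall>p\<in>S. \<not> p dvd n)}"
  have p: "prime p" using insert by auto
  have p0: "p > 0" using prime_gt_0_nat[OF p] .
  have smm: "a summable_on B" if "B \<subseteq> {0<..}" for B
    using summable_on_subset_banach[OF Infinite_Sum.abs_summable_summable[OF abs] that] .
  have eq: "{n. n > 0 \<and> (\<forall>r\<in>insert p S. \<not> r dvd n)} = ?A - (\<lambda>n. p * n) ` ?A"
  proof (intro Set.set_eqI iffI)
    fix n assume "n \<in> {n. n > 0 \<and> (\<forall>r\<in>insert p S. \<not> r dvd n)}"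
    then show "n \<in> ?A - (\<lambda>n. p * n) ` ?A" by auto
  next
    fix n assume n: "n \<in> ?A - (\<lambda>n. p * n) ` ?A"
    have "\<not> p dvd n"
    proof
      assume "p dvd n"
      then obtain m where m: "n = p * m" by auto
      then have "m \<in> ?A" using n by auto
      then show False using n m by auto
    qed
    then show "n \<in> {n. n > 0 \<and> (\<forall>r\<in>insert p S. \<not> r dvd n)}" using n by auto
  qed
  have sub: "(\<lambda>n. p * n) ` ?A \<subseteq> ?A"
  proof
    fix n assume "n \<in> (\<lambda>n. p * n) ` ?A"
    then obtain m where m: "n = p * m" "m > 0" "\<forall>r\<in>S. \<not> r dvd m" by auto
    have "\<not> r dvd n" if r: "r \<in> S" for r
    proof
      assume "r dvd n"
      moreover have "prime r" using insert r by auto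
      ultimately have "r dvd p" using m r by (auto simp: prime_dvd_mult_iff)
      then have "r = p" using \<open>prime r\<close> p by (simp add: primes_dvd_imp_eq)
      then show False using r insert by auto
    qed
    then show "n \<in> ?A" using m p0 by auto
  qed
  have "infsum a (?A - (\<lambda>n. p * n) ` ?A) = infsum a ?A - infsum a ((\<lambda>n. p * n) ` ?A)"
    by (intro infsum_Diff smm sub) (use p0 in auto)
  also have "infsum a ((\<lambda>n. p * n) ` ?A) = infsum (a \<circ> (\<lambda>n. p * n)) ?A"
    by (rule infsum_reindex) (use p0 in \<open>auto simp: inj_on_def\<close>)
  also have "\<dots> = a p * infsum a ?A"
    unfolding comp_def mult by (rule infsum_cmult_right) (intro smm, auto)
  finally have diff: "infsum a (?A - (\<lambda>n. p * n) ` ?A) = infsum a ?A - a p * infsum a ?A" .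
  have IH: "infsum a ?A = (\<Prod>p\<in>S. 1 - a p) * infsum a {0<..}" using insert by blast
  show ?case unfolding eq diff IH using insert.hyps by (simp add: left_diff_distrib mult.assoc)
qed

text \<open>After sifting by the primes up to P only 1 and integers beyond P remain. Stated with the
  product on the side of the series, the limit yields nonvanishing of the series as a
  consequence.\<close>

lemma euler_product_tendsto:
  fixes a :: "nat \<Rightarrow> complex"
  assumes mult: "\<And>m n. a (m * n) = a m * a n" and one: "a 1 = 1"
    and abs: "(\<lambda>n. norm (a n)) summable_on {0<..}"
  shows "(\<lambda>P. (\<Prod>p\<in>{p. prime p \<and> p \<le> P}. 1 - a p) * infsum a {0<..}) \<longlonglongrightarrow> 1"
proof -
  let ?A = "\<lambda>P. {n. n > 0 \<and> (\<forall>p\<in>{p. prime p \<and> p \<le> P}. \<not> p dvd n)}"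
  let ?n = "\<lambda>n. norm (a n)"
  have smm: "a summable_on B" if "B \<subseteq> {0<..}" for B
    using summable_on_subset_banach[OF Infinite_Sum.abs_summable_summable[OF abs] that] .
  have nsmm: "?n summable_on B" if "B \<subseteq> {0<..}" for B
    using summable_on_subset_banach[OF abs that] .
  have bound: "norm (infsum a (?A P) - 1) \<le> infsum ?n {0<..} - (\<Sum>n\<in>{0<..P}. ?n n)" if "P \<ge> 1" for P
  proof -
    have 1: "1 \<in> ?A P" using prime_nat_iff by auto
    have "infsum a (?A P - {1}) = infsum a (?A P) - infsum a {1}"
      by (intro infsum_Diff smm) (use 1 in auto)
    then have "norm (infsum a (?A P) - 1) = norm (infsum a (?A P - {1}))" by (simp add: one[simplified])
    also have "\<dots> \<le> infsum ?n (?A P - {1})" by (rule norm_infsum_bound, rule nsmm) auto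
    also have "\<dots> \<le> infsum ?n ({0<..} - {0<..P})"
    proof (rule infsum_mono2)
      show "?A P - {1} \<subseteq> {0<..} - {0<..P}"
      proof
        fix n assume n: "n \<in> ?A P - {1}"
        then obtain p where p: "prime p" "p dvd n" using prime_factor_nat by blast
        then have "p > P" using n by auto
        moreover have "p \<le> n" using p n by (auto intro: dvd_imp_le)
        ultimately show "n \<in> {0<..} - {0<..P}" using n by auto
      qed
    qed (auto intro: nsmm)
    also have "\<dots> = infsum ?n {0<..} - infsum ?n {0<..P}"
      by (intro infsum_Diff nsmm) auto
    finally show ?thesis by simp
  qed
  have "(\<lambda>P. infsum ?n {0<..} - (\<Sum>n\<in>{0<..P}. ?n n)) \<longlonglongrightarrow> infsum ?n {0<..} - infsum ?n {0<..}"
  proof (intro tendsto_diff tendsto_const)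
    have "(?n has_sum infsum ?n {0<..}) {0<..}" using abs by (rule has_sum_infsum)
    then show "(\<lambda>P. \<Sum>n\<in>{0<..P}. ?n n) \<longlonglongrightarrow> infsum ?n {0<..}"
      unfolding has_sum_def
    proof (rule filterlim_compose)
      show "filterlim (\<lambda>P. {0<..P}) (finite_subsets_at_top {0<..}) sequentially"
        unfolding filterlim_finite_subsets_at_top
      proof safe
        fix X :: "nat set" assume "finite X" "X \<subseteq> {0<..}"
        then show "\<forall>\<^sub>F P in sequentially. finite {0<..P} \<and> X \<subseteq> {0<..P} \<and> {0<..P} \<subseteq> {0<..}"
          using finite_nat_set_iff_bounded_le[of X]
          by (auto simp: eventually_sequentially subset_iff) (meson le_trans)
      qed
    qed
  qed
  then have "(\<lambda>P. infsum ?n {0<..} - (\<Sum>n\<in>{0<..P}. ?n n)) \<longlonglongrightarrow> 0" by simp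
  then have "(\<lambda>P. infsum a (?A P) - 1) \<longlonglongrightarrow> 0"
    by (rule Lim_null_comparison[rotated]) (use bound in \<open>auto simp: eventually_sequentially intro!: exI[of _ 1]\<close>)
  then have "(\<lambda>P. infsum a (?A P)) \<longlonglongrightarrow> 1" by (simp add: LIM_zero_iff)
  moreover have "infsum a (?A P) = (\<Prod>p\<in>{p. prime p \<and> p \<le> P}. 1 - a p) * infsum a {0<..}" for P
    by (rule euler_sieve[OF mult abs]) auto
  ultimately show ?thesis by simp
qed

abbreviation L_series :: "(int \<Rightarrow> complex) \<Rightarrow> complex \<Rightarrow> complex" where
  "L_series chi \<equiv> dirichlet_series (\<lambda>n. chi (int (Suc n)))"

lemma L_series_abs_summable:
  assumes "dirichlet_character q chi" "Re s > 1"
  shows "summable (\<lambda>n. norm (chi (int (Suc n)) / of_nat (Suc n) powr s))"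
proof (rule summable_comparison_test')
  show "summable (\<lambda>n. real (Suc n) powr (- (Re s - 1) - 1))"
    using assms(2) by (intro summable_powr) simp
  fix n
  have "norm (chi (int (Suc n)) / of_nat (Suc n) powr s) = cmod (chi (int (Suc n))) / real (Suc n) powr Re s"
    by (simp only: norm_divide norm_nat_powr)
  also have "\<dots> \<le> 1 / real (Suc n) powr Re s"
    by (intro divide_right_mono dirichlet_character_norm_le[OF assms(1)]) auto
  also have "\<dots> = real (Suc n) powr (- (Re s - 1) - 1)" by (simp add: powr_minus_divide)
  finally show "norm (norm (chi (int (Suc n)) / of_nat (Suc n) powr s)) \<le> real (Suc n) powr (- (Re s - 1) - 1)"
    by simp
qed

lemma L_series_euler:
  assumes dc: "dirichlet_character q chi" and s: "Re s > 1"
  shows "(\<lambda>P. (\<Prod>p\<in>{p. prime p \<and> p \<le> P}. 1 - chi (int p) / of_nat p powr s) * L_series chi s) \<longlonglongrightarrow> 1"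
proof -
  define a where "a n = chi (int n) / of_nat n powr s" for n
  have mult: "a (m * n) = a m * a n" for m n
  proof (cases "m = 0 \<or> n = 0")
    case False
    then have "of_nat (m * n) powr s = of_nat m powr s * (of_nat n powr s :: complex)"
      by (simp add: powr_times_real)
    then show ?thesis by (simp add: a_def dirichlet_character_mult[OF dc])
  qed (auto simp: a_def)
  have img: "Suc ` UNIV = {0<..}" by (auto simp: image_iff gr0_conv_Suc)
  have sm: "summable (\<lambda>n. norm (a (Suc n)))"
    using L_series_abs_summable[OF dc s] by (simp only: a_def)
  have "((a \<circ> Suc) has_sum L_series chi s) UNIV"
    unfolding comp_def dirichlet_series_def a_def[symmetric]
    using norm_summable_imp_has_sum[OF sm] summable_norm_cancel[OF sm] by (simp add: summable_sums)
  then have "(a has_sum L_series chi s) {0<..}"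
    using has_sum_reindex[of Suc UNIV a "L_series chi s"] by (simp add: img)
  then have L: "infsum a {0<..} = L_series chi s" by (rule infsumI)
  have "(\<lambda>n. norm (a (Suc n))) summable_on UNIV"
    using sm by (rule norm_summable_imp_summable_on[of "\<lambda>n. norm (a (Suc n))", simplified])
  then have "(\<lambda>n. norm (a n)) summable_on {0<..}"
    using summable_on_reindex[of Suc UNIV "\<lambda>n. norm (a n)"] by (simp add: img comp_def)
  from euler_product_tendsto[OF mult _ this] show ?thesis
    using dirichlet_character_one[OF dc] unfolding L by (simp add: a_def)
qed

lemma L_series_nonzero:
  assumes "dirichlet_character q chi" "Re s > 1"
  shows "L_series chi s \<noteq> 0"
proof
  assume "L_series chi s = 0"
  then have "(\<lambda>P::nat. 0::complex) \<longlonglongrightarrow> 1" using L_series_euler[OF assms] by simp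
  then show False using LIMSEQ_unique[OF _ tendsto_const] by fastforce
qed

section \<open>Nonvanishing on the line Re s = 1\<close>

text \<open>The logarithm is minus the sum of r^n / n times 3 + 4 cos x + cos 2x = 2 (1 + cos x)^2,
  where x is the argument of z^n. The case \<open>z = 0\<close> belongs to the primes dividing the
  modulus.\<close>

lemma mertens_341:
  fixes r :: real and z :: complex
  assumes "0 \<le> r" "r < 1" "cmod z = 1 \<or> z = 0"
  shows "\<bar>1 - r\<bar> ^ 3 * cmod (1 - of_real r * z) ^ 4 * cmod (1 - of_real r * z\<^sup>2) \<le> 1"
proof (cases "z = 0")
  case True
  then show ?thesis using assms power_le_one[of "1 - r" 3] by simp
next
  case False
  then have z: "cmod z = 1" using assms by simp
  \<comment> \<open>The index n = 0 contributes 0, because division by 0 yields 0.\<close>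
  have ln: "(\<lambda>n. - Re (w ^ n) * (r ^ n / real n)) sums ln (cmod (1 - of_real r * w)) \<and> 1 - of_real r * w \<noteq> 0"
    if w: "cmod w = 1" for w
  proof -
    have nw: "cmod (- (of_real r * w)) < 1" using w assms by (simp add: norm_mult)
    have nz: "1 - of_real r * w \<noteq> 0"
    proof
      assume "1 - of_real r * w = 0"
      then have "cmod (of_real r * w) = 1" by simp
      then show False using nw by simp
    qed
    have "(\<lambda>n. - ((- (- (of_real r * w))) ^ n) / of_nat n) sums ln (1 + - (of_real r * w))"
      by (rule Ln_series'[OF nw])
    then have "(\<lambda>n. Re (- ((of_real r * w) ^ n) / of_nat n)) sums Re (ln (1 - of_real r * w))"
      using sums_Re by fastforce
    moreover have "Re (- ((of_real r * w) ^ n) / of_nat n) = - Re (w ^ n) * (r ^ n / real n)" for n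
    proof -
      have "- ((of_real r * w) ^ n) / of_nat n = - (w ^ n) * complex_of_real (r ^ n / real n)"
        by (simp add: power_mult_distrib)
      then show ?thesis by (simp only: times_complex.sel uminus_complex.sel Re_complex_of_real Im_complex_of_real)
    qed
    moreover have "Re (ln (1 - of_real r * w)) = ln (cmod (1 - of_real r * w))" using nz by (rule Re_Ln)
    ultimately show ?thesis using nz by (simp only: not_False_eq_True simp_thms)
  qed
  have 1: "(\<lambda>n. - Re (1 ^ n) * (r ^ n / real n)) sums ln (cmod (1 - of_real r * 1))" using ln[of 1] by simp
  have 2: "(\<lambda>n. - Re (z ^ n) * (r ^ n / real n)) sums ln (cmod (1 - of_real r * z))" "1 - of_real r * z \<noteq> 0"
    using ln[OF z] by auto
  have z2: "cmod (z\<^sup>2) = 1" using z by (simp add: norm_power)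
  have 3: "(\<lambda>n. - Re ((z\<^sup>2) ^ n) * (r ^ n / real n)) sums ln (cmod (1 - of_real r * z\<^sup>2))" "1 - of_real r * z\<^sup>2 \<noteq> 0"
    using ln[OF z2] by auto
  have A: "(\<lambda>n. 3 * (- Re (1 ^ n) * (r ^ n / real n)) + 4 * (- Re (z ^ n) * (r ^ n / real n)) + (- Re ((z\<^sup>2) ^ n) * (r ^ n / real n)))
      sums (3 * ln (cmod (1 - of_real r * 1)) + 4 * ln (cmod (1 - of_real r * z)) + ln (cmod (1 - of_real r * z\<^sup>2)))"
    by (intro sums_add sums_mult 1 2 3)
  have B: "3 * (- Re (1 ^ n) * (r ^ n / real n)) + 4 * (- Re (z ^ n) * (r ^ n / real n)) + (- Re ((z\<^sup>2) ^ n) * (r ^ n / real n)) \<le> 0" for n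
  proof -
    define v where "v = z ^ n"
    have v: "(Re v)\<^sup>2 + (Im v)\<^sup>2 = 1" using z unfolding v_def by (simp add: cmod_power2[symmetric] norm_power)
    have "(z\<^sup>2) ^ n = v\<^sup>2" by (simp add: v_def power_mult[symmetric] mult.commute)
    then have "Re ((z\<^sup>2) ^ n) = 2 * (Re v)\<^sup>2 - 1" using v by (simp add: power2_eq_square)
    then have "3 + 4 * Re (z ^ n) + Re ((z\<^sup>2) ^ n) = 2 * (1 + Re v)\<^sup>2" by (simp add: v_def power2_eq_square algebra_simps)
    then have "3 + 4 * Re (z ^ n) + Re ((z\<^sup>2) ^ n) \<ge> 0" by simp
    then have "(3 + 4 * Re (z ^ n) + Re ((z\<^sup>2) ^ n)) * (r ^ n / real n) \<ge> 0" using assms by (intro mult_nonneg_nonneg) auto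
    then show ?thesis by (simp add: algebra_simps)
  qed
  have "3 * ln (cmod (1 - of_real r * 1)) + 4 * ln (cmod (1 - of_real r * z)) + ln (cmod (1 - of_real r * z\<^sup>2)) \<le> 0"
    by (rule sums_le[OF B A sums_zero])
  moreover have "cmod (1 - of_real r * 1) = 1 - r"
    using assms by (metis abs_of_pos diff_gt_0_iff_gt mult.right_neutral norm_of_real of_real_1 of_real_diff)
  ultimately have "ln ((1 - r) ^ 3 * cmod (1 - of_real r * z) ^ 4 * cmod (1 - of_real r * z\<^sup>2)) \<le> 0"
    using 2(2) 3(2) assms by (simp add: ln_mult ln_realpow)
  moreover have "(1 - r) ^ 3 * cmod (1 - of_real r * z) ^ 4 * cmod (1 - of_real r * z\<^sup>2) > 0"
    using 2(2) 3(2) assms by simp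
  ultimately show ?thesis using assms by (simp add: ln_le_zero_iff)
qed

lemma dirichlet_character_trivial: "dirichlet_character 1 (\<lambda>_. 1)"
  by (simp add: dirichlet_character_def)

lemma dirichlet_character_square:
  "dirichlet_character q chi \<Longrightarrow> dirichlet_character q (\<lambda>x. (chi x)\<^sup>2)"
  by (simp add: dirichlet_character_def power_mult_distrib)

text \<open>Multiplying the local inequalities over p \<le> P bounds the product of the finite Euler
  products by 1; since each of them times its series tends to 1, the series satisfy the reverse
  inequality.\<close>

lemma L_series_341:
  assumes dc: "dirichlet_character q chi" and \<sigma>: "\<sigma> > 1"
  shows "cmod (L_series (\<lambda>_. 1) (of_real \<sigma>)) ^ 3 * cmod (L_series chi (Complex \<sigma> t)) ^ 4
           * cmod (L_series (\<lambda>x. (chi x)\<^sup>2) (Complex \<sigma> (2 * t))) \<ge> 1"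
proof -
  define E1 where "E1 P = (\<Prod>p\<in>{p. prime p \<and> p \<le> P}. 1 - 1 / of_nat p powr complex_of_real \<sigma>)" for P :: nat
  define E2 where "E2 P = (\<Prod>p\<in>{p. prime p \<and> p \<le> P}. 1 - chi (int p) / of_nat p powr Complex \<sigma> t)" for P
  define E3 where "E3 P = (\<Prod>p\<in>{p. prime p \<and> p \<le> P}. 1 - (chi (int p))\<^sup>2 / of_nat p powr Complex \<sigma> (2 * t))" for P
  let ?L1 = "L_series (\<lambda>_. 1) (complex_of_real \<sigma>)" and ?L2 = "L_series chi (Complex \<sigma> t)"
    and ?L3 = "L_series (\<lambda>x. (chi x)\<^sup>2) (Complex \<sigma> (2 * t))"
  have lim: "(\<lambda>P. E1 P * ?L1) \<longlonglongrightarrow> 1" "(\<lambda>P. E2 P * ?L2) \<longlonglongrightarrow> 1" "(\<lambda>P. E3 P * ?L3) \<longlonglongrightarrow> 1"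
    unfolding E1_def E2_def E3_def
    using L_series_euler[OF dirichlet_character_trivial, of "of_real \<sigma>"] L_series_euler[OF dc, of "Complex \<sigma> t"]
      L_series_euler[OF dirichlet_character_square[OF dc], of "Complex \<sigma> (2 * t)"] \<sigma> by auto
  have "(\<lambda>P. cmod (E1 P * ?L1) ^ 3 * cmod (E2 P * ?L2) ^ 4 * cmod (E3 P * ?L3)) \<longlonglongrightarrow> cmod 1 ^ 3 * cmod 1 ^ 4 * cmod 1"
    by (intro tendsto_intros lim)
  then have "(\<lambda>P. cmod (E1 P * ?L1) ^ 3 * cmod (E2 P * ?L2) ^ 4 * cmod (E3 P * ?L3)) \<longlonglongrightarrow> 1" by simp
  moreover have "cmod (E1 P * ?L1) ^ 3 * cmod (E2 P * ?L2) ^ 4 * cmod (E3 P * ?L3)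
      \<le> cmod ?L1 ^ 3 * cmod ?L2 ^ 4 * cmod ?L3" for P
  proof -
    have "cmod (E1 P) ^ 3 * cmod (E2 P) ^ 4 * cmod (E3 P) \<le> 1"
    proof -
      have "cmod (E1 P) ^ 3 * cmod (E2 P) ^ 4 * cmod (E3 P) = (\<Prod>p\<in>{p. prime p \<and> p \<le> P}.
          cmod (1 - 1 / of_nat p powr complex_of_real \<sigma>) ^ 3 * cmod (1 - chi (int p) / of_nat p powr Complex \<sigma> t) ^ 4
          * cmod (1 - (chi (int p))\<^sup>2 / of_nat p powr Complex \<sigma> (2 * t)))"
        unfolding E1_def E2_def E3_def by (simp add: prod_norm[symmetric] prod_power_distrib prod.distrib)
      also have "\<dots> \<le> 1"
      proof (intro prod_le_1 conjI)
        fix p assume "p \<in> {p. prime p \<and> p \<le> P}"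
        then have p: "p \<ge> 2" using prime_ge_2_nat by auto
        define r where "r = real p powr (- \<sigma>)"
        have r: "0 \<le> r" "r < 1" using p \<sigma> by (auto simp: r_def intro: powr_less_one)
        define z where "z = chi (int p) * of_nat p powr Complex 0 (- t)"
        have "cmod (of_nat p powr Complex 0 (- t)) = 1" using p by (simp add: norm_powr_real_powr)
        then have z: "cmod z = 1 \<or> z = 0"
          using dirichlet_character_norm[OF dc, of "int p"] by (auto simp: z_def norm_mult)
        have rc: "complex_of_real r = of_nat p powr complex_of_real (- \<sigma>)"
          using p by (simp add: r_def powr_of_real[symmetric])
        have e1: "1 / of_nat p powr complex_of_real \<sigma> = of_real r"
          using p by (simp add: rc powr_minus_divide)
        have e2: "chi (int p) / of_nat p powr Complex \<sigma> t = of_real r * z"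
        proof -
          have "of_real r * z = chi (int p) * (of_nat p powr complex_of_real (- \<sigma>) * of_nat p powr Complex 0 (- t))"
            by (simp add: rc z_def)
          also have "of_nat p powr complex_of_real (- \<sigma>) * of_nat p powr Complex 0 (- t) = of_nat p powr (- Complex \<sigma> t)"
            unfolding powr_add[symmetric] by (rule arg_cong[where f = "\<lambda>x. _ powr x"]) (simp add: complex_eq_iff)
          finally show ?thesis by (simp add: powr_minus_divide)
        qed
        have e3: "(chi (int p))\<^sup>2 / of_nat p powr Complex \<sigma> (2 * t) = of_real r * z\<^sup>2"
        proof -
          have "of_real r * z\<^sup>2 = (chi (int p))\<^sup>2 * (of_nat p powr complex_of_real (- \<sigma>) * (of_nat p powr Complex 0 (- t) * of_nat p powr Complex 0 (- t)))"
            by (simp add: rc z_def power2_eq_square mult_ac)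
          also have "of_nat p powr complex_of_real (- \<sigma>) * (of_nat p powr Complex 0 (- t) * of_nat p powr Complex 0 (- t)) = of_nat p powr (- Complex \<sigma> (2 * t))"
            unfolding powr_add[symmetric] by (rule arg_cong[where f = "\<lambda>x. _ powr x"]) (simp add: complex_eq_iff)
          finally show ?thesis by (simp add: powr_minus_divide)
        qed
        have "cmod (1 - complex_of_real r) = \<bar>1 - r\<bar>" by (metis norm_of_real of_real_1 of_real_diff)
        then show "cmod (1 - 1 / of_nat p powr complex_of_real \<sigma>) ^ 3 * cmod (1 - chi (int p) / of_nat p powr Complex \<sigma> t) ^ 4
          * cmod (1 - (chi (int p))\<^sup>2 / of_nat p powr Complex \<sigma> (2 * t)) \<le> 1"
          unfolding e1 e2 e3 using mertens_341[OF r z] by simp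
      qed auto
      finally show ?thesis .
    qed
    then have "(cmod (E1 P) ^ 3 * cmod (E2 P) ^ 4 * cmod (E3 P)) * (cmod ?L1 ^ 3 * cmod ?L2 ^ 4 * cmod ?L3)
        \<le> 1 * (cmod ?L1 ^ 3 * cmod ?L2 ^ 4 * cmod ?L3)" by (rule mult_right_mono) auto
    then show ?thesis by (simp add: norm_mult power_mult_distrib mult_ac)
  qed
  ultimately show ?thesis by (intro LIMSEQ_le_const2) auto
qed

lemma norm_zeta_le:
  assumes "\<sigma> > 1"
  shows "cmod (L_series (\<lambda>_. 1) (of_real \<sigma>)) \<le> \<sigma> / (\<sigma> - 1)"
proof -
  have a: "\<sigma> - 1 > 0" using assms by simp
  have n: "cmod (1 / of_nat (Suc n) powr of_real \<sigma>) = real (Suc n) powr (- (\<sigma> - 1) - 1)" for n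
    by (simp only: norm_divide norm_nat_powr) (simp add: powr_minus_divide)
  have "cmod (L_series (\<lambda>_. 1) (of_real \<sigma>)) \<le> (\<Sum>n. real (Suc n) powr (- (\<sigma> - 1) - 1))"
    unfolding dirichlet_series_def by (rule norm_suminf_le[OF _ summable_powr(1)[OF a]]) (simp only: n order_refl)
  also have "\<dots> \<le> 1 + 1 / (\<sigma> - 1)" by (rule summable_powr(2)[OF a])
  also have "\<dots> = \<sigma> / (\<sigma> - 1)" using a by (simp add: field_simps)
  finally show ?thesis .
qed

lemma tendsto_Complex_at_right: "((\<lambda>\<sigma>. Complex \<sigma> t) \<longlongrightarrow> Complex 1 t) (at_right 1)"
  by (intro tendsto_Complex tendsto_const tendsto_ident_at)

lemma eventually_at_right_gt: "\<forall>\<^sub>F \<sigma> in at_right (1::real). \<sigma> > 1"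
  by (simp add: eventually_at_right_less)

text \<open>
  Multiplying by \<open>1 - 2 powr (1 - s)\<close> removes the pole at \<open>1\<close> of a principal character.
\<close>

lemma L_series_twisted:
  assumes dc: "dirichlet_character q \<omega>"
  defines "c \<equiv> \<lambda>n. \<omega> (int (Suc n)) - 2 * (if even (Suc n) then \<omega> (int (Suc n div 2)) else 0)"
  shows "cmod (\<Sum>k<n. c k) \<le> 6 * real q"
    and "Re s > 1 \<Longrightarrow> dirichlet_series c s = (1 - 2 / 2 powr s) * L_series \<omega> s"
proof -
  have q: "q > 0" using dc by (simp add: dirichlet_character_def)
  have norm_w: "cmod (\<omega> x) \<le> 1" for x by (rule dirichlet_character_norm_le[OF dc])
  have per: "\<omega> (int (x + q)) = \<omega> (int x)" for x
    by (rule dirichlet_character_cong[OF dc]) (simp add: cong_iff_dvd_diff)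
  have per2: "\<omega> (int (x + 2 * q)) = \<omega> (int x)" for x
    by (rule dirichlet_character_cong[OF dc]) (simp add: cong_iff_dvd_diff)
  have split: "(\<Sum>k<m + d. f k) = (\<Sum>k<m. f k) + (\<Sum>k<d. f (k + m))" for m d and f :: "nat \<Rightarrow> complex"
    by (induction d) (simp_all add: add_ac)
  have "cmod (\<Sum>k<n. c k) \<le> 3 * real (2 * q)"
  proof (rule partial_sums_periodic_bound)
    show "c (k + 2 * q) = c k" for k
    proof -
      have "even (Suc (k + 2 * q)) \<longleftrightarrow> even (Suc k)" by simp
      moreover have "Suc (k + 2 * q) div 2 = Suc k div 2 + q" by simp
      moreover have "\<omega> (int (Suc (k + 2 * q))) = \<omega> (int (Suc k))" using per2[of "Suc k"] by simp
      ultimately show ?thesis using per[of "Suc k div 2"] unfolding c_def by (simp only:)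
    qed
    have half: "(\<Sum>k<2 * m. if even (Suc k) then \<omega> (int (Suc k div 2)) else 0) = (\<Sum>k<m. \<omega> (int (Suc k)))" for m
      by (induction m) simp_all
    have "(\<Sum>k<2 * q. \<omega> (int (Suc k))) = (\<Sum>k<q. \<omega> (int (Suc k))) + (\<Sum>k<q. \<omega> (int (Suc (k + q))))"
      using split[of "\<lambda>k. \<omega> (int (Suc k))" q q] by (simp add: mult_2)
    also have "(\<Sum>k<q. \<omega> (int (Suc (k + q)))) = (\<Sum>k<q. \<omega> (int (Suc k)))"
      using per[of "Suc _"] by (intro sum.cong refl) (metis add_Suc)
    finally show "(\<Sum>k<2 * q. c k) = 0"
      unfolding c_def sum_subtractf sum_distrib_left[symmetric] half by simp
    show "cmod (c k) \<le> 3" for k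
    proof -
      have "cmod (c k) \<le> cmod (\<omega> (int (Suc k))) + cmod (2 * (if even (Suc k) then \<omega> (int (Suc k div 2)) else 0))"
        unfolding c_def by (rule norm_triangle_ineq4)
      also have "cmod (2 * (if even (Suc k) then \<omega> (int (Suc k div 2)) else 0)) \<le> 2"
        using norm_w by (simp add: norm_mult)
      finally show ?thesis using norm_w[of "int (Suc k)"] by linarith
    qed
  qed (use q in simp)
  then show bound: "cmod (\<Sum>k<n. c k) \<le> 6 * real q" by simp
  assume s: "Re s > 1"
  let ?L = "L_series \<omega> s"
  have L: "(\<lambda>n. \<omega> (int (Suc n)) / of_nat (Suc n) powr s) sums ?L"
    unfolding dirichlet_series_def
    by (rule summable_sums[OF summable_norm_cancel[OF L_series_abs_summable[OF dc s]]])
  \<comment> \<open>The even integers N = n + 1 with coefficient taken at N / 2, so that the factor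
    2^s comes out whatever the value of \<omega> at 2.\<close>
  define h where "h n = (if even (Suc n) then \<omega> (int (Suc n div 2)) else 0) / of_nat (Suc n) powr s" for n
  have "(\<lambda>m. h (2 * m + 1)) sums (?L / 2 powr s)"
  proof -
    have "h (2 * m + 1) = (\<omega> (int (Suc m)) / of_nat (Suc m) powr s) / 2 powr s" for m
    proof -
      have "(of_nat (Suc (2 * m + 1)) :: complex) = of_real 2 * of_real (real (Suc m))" by simp
      moreover have "(of_real 2 * of_real (real (Suc m)) :: complex) powr s = of_real 2 powr s * of_real (real (Suc m)) powr s"
        by (rule powr_times_real) auto
      ultimately have "(of_nat (Suc (2 * m + 1)) :: complex) powr s = 2 powr s * of_nat (Suc m) powr s"
        by simp
      then show ?thesis unfolding h_def by simp
    qed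
    then show ?thesis using sums_divide[OF L, of "2 powr s"] by simp
  qed
  then have "h sums (?L / 2 powr s)"
  proof (rule sums_mono_reindex[THEN iffD1, rotated 2])
    show "strict_mono (\<lambda>m. 2 * m + 1 :: nat)" by (simp add: strict_mono_def)
    fix n assume n: "n \<notin> range (\<lambda>m. 2 * m + 1 :: nat)"
    have "even n"
    proof (rule ccontr)
      assume "odd n"
      then obtain m where "n = 2 * m + 1" by (rule oddE)
      then show False using n by auto
    qed
    then have "odd (Suc n)" by simp
    then show "h n = 0" by (simp add: h_def)
  qed
  then have "(\<lambda>n. \<omega> (int (Suc n)) / of_nat (Suc n) powr s - 2 * h n) sums (?L - 2 * (?L / 2 powr s))"
    by (intro sums_diff sums_mult L)
  then have "(\<lambda>n. c n / of_nat (Suc n) powr s) sums (?L - 2 * (?L / 2 powr s))"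
    by (simp add: c_def h_def diff_divide_distrib)
  then show "dirichlet_series c s = (1 - 2 / 2 powr s) * ?L"
    unfolding dirichlet_series_def by (simp add: sums_iff algebra_simps)
qed

text \<open>The zeros lie at the multiples of 2 pi / ln 2, which exceeds 4. Heights up to 4 are
  enough, since the inequality at height |t| \<le> 2 involves 2 t.\<close>

lemma two_powr_neq:
  assumes "t \<noteq> 0" "\<bar>t\<bar> \<le> 4"
  shows "1 - 2 / 2 powr (Complex 1 t) \<noteq> 0"
proof
  assume "1 - 2 / 2 powr (Complex 1 t) = 0"
  then have "2 powr (Complex 1 t) = (2 :: complex)"
    by (simp add: field_simps powr_def)
  moreover have "(2::complex) powr (Complex 1 t) = exp (of_real (ln 2) * Complex 1 t)"
    using Ln_of_real[of 2] by (simp add: powr_def mult.commute)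
  moreover have "\<dots> = of_real 2 * cis (t * ln 2)"
    by (simp add: exp_eq_polar mult.commute)
  ultimately have "cis (t * ln 2) = 1" by simp
  then have "cos (t * ln 2) = 1" by (metis cis.sel(1) one_complex.sel(1))
  then obtain n :: int where n: "t * ln 2 = of_int n * 2 * pi" by (auto simp: cos_one_2pi_int)
  have ln2: "0 < ln (2::real)" "ln (2::real) < 1" using ln_2_less_1 by auto
  have "\<bar>t * ln 2\<bar> \<le> 4 * 1" unfolding abs_mult using assms ln2 by (intro mult_mono) auto
  then have "\<bar>of_int n\<bar> * (2 * pi) \<le> 4" unfolding n by (simp add: abs_mult)
  moreover have "\<bar>of_int n\<bar> * 6 \<le> \<bar>of_int n\<bar> * (2 * pi)" using pi_gt3 by (intro mult_left_mono) auto
  ultimately have "\<bar>of_int n\<bar> * 6 < (6 :: real)" by linarith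
  then have "n = 0" by linarith
  then show False using n assms ln2 by simp
qed

text \<open>Supplies the finite limit of the series of the squared character in the 3-4-1
  inequality. That character may be principal, and then a nonzero height keeps away from the
  pole.\<close>

lemma L_series_tendsto_at_right:
  assumes dc: "dirichlet_character q \<omega>"
    and "(\<exists>u. coprime u (int q) \<and> \<omega> u \<noteq> 1) \<or> (t \<noteq> 0 \<and> \<bar>t\<bar> \<le> 4)"
  shows "\<exists>l. ((\<lambda>\<sigma>. L_series \<omega> (Complex \<sigma> t)) \<longlongrightarrow> l) (at_right 1)"
  using assms(2)
proof
  assume "\<exists>u. coprime u (int q) \<and> \<omega> u \<noteq> 1"
  then obtain u where u: "coprime u (int q)" "\<omega> u \<noteq> 1" by blast
  interpret bounded_partial_sums "\<lambda>n. \<omega> (int (Suc n))" "real q"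
    by unfold_locales (rule nonprincipal_partial_sums[OF dc u])
  have "isCont (L_series \<omega>) (Complex 1 t)"
    using holomorphic_on_imp_continuous_on[OF dirichlet_series_holomorphic]
    by (auto simp: continuous_on_eq_continuous_at open_halfspace_Re_gt)
  then show ?thesis using isCont_tendsto_compose[OF _ tendsto_Complex_at_right] by blast
next
  assume t: "t \<noteq> 0 \<and> \<bar>t\<bar> \<le> 4"
  define c where "c n = \<omega> (int (Suc n)) - 2 * (if even (Suc n) then \<omega> (int (Suc n div 2)) else 0)" for n
  interpret bounded_partial_sums c "6 * real q"
    by unfold_locales (use L_series_twisted(1)[OF dc] in \<open>simp add: c_def\<close>)
  have "isCont (dirichlet_series c) (Complex 1 t)"
    using holomorphic_on_imp_continuous_on[OF dirichlet_series_holomorphic]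
    by (auto simp: continuous_on_eq_continuous_at open_halfspace_Re_gt)
  moreover have "isCont (\<lambda>s. 1 - 2 / 2 powr s :: complex) (Complex 1 t)"
    by (intro continuous_intros) auto
  ultimately have "isCont (\<lambda>s. dirichlet_series c s / (1 - 2 / 2 powr s)) (Complex 1 t)"
    using two_powr_neq[of t] t by (intro continuous_divide) auto
  then have lim: "((\<lambda>\<sigma>. dirichlet_series c (Complex \<sigma> t) / (1 - 2 / 2 powr (Complex \<sigma> t)))
      \<longlongrightarrow> dirichlet_series c (Complex 1 t) / (1 - 2 / 2 powr (Complex 1 t))) (at_right 1)"
    by (rule isCont_tendsto_compose[OF _ tendsto_Complex_at_right])
  have nz: "1 - 2 / 2 powr (Complex \<sigma> t) \<noteq> 0" if "\<sigma> > 1" for \<sigma>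
  proof
    assume "1 - 2 / 2 powr (Complex \<sigma> t) = 0"
    then have "(2::complex) powr Complex \<sigma> t = 2" by (simp add: field_simps powr_def)
    then have "2 powr \<sigma> = (2::real)" using norm_powr_real_powr[of 2 "Complex \<sigma> t"] by simp
    moreover have "2 powr \<sigma> > (2::real) powr 1" using that by (intro powr_less_mono) auto
    ultimately show False by simp
  qed
  have "L_series \<omega> (Complex \<sigma> t) = dirichlet_series c (Complex \<sigma> t) / (1 - 2 / 2 powr (Complex \<sigma> t))" if "\<sigma> > 1" for \<sigma>
  proof -
    have "dirichlet_series c (Complex \<sigma> t) = (1 - 2 / 2 powr (Complex \<sigma> t)) * L_series \<omega> (Complex \<sigma> t)"
      using L_series_twisted(2)[OF dc, of "Complex \<sigma> t"] that by (simp add: c_def[abs_def])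
    then show ?thesis using nz[OF that] by simp
  qed
  then have "\<forall>\<^sub>F \<sigma> in at_right 1. dirichlet_series c (Complex \<sigma> t) / (1 - 2 / 2 powr (Complex \<sigma> t)) = L_series \<omega> (Complex \<sigma> t)"
    by (intro eventually_mono[OF eventually_at_right_gt]) auto
  from Lim_transform_eventually[OF lim this] show ?thesis by blast
qed

text \<open>A zero would make the series O(\<sigma> - 1) near it, and the fourth power outweighs the
  cube of the simple pole: what remains tends to 0 although it is at least 1. The condition
  \<open>alt\<close> keeps the squared character off its pole.\<close>

lemma L_series_nonzero_line:
  assumes dc: "dirichlet_character q chi" and u: "coprime u (int q)" "chi u \<noteq> 1"
    and alt: "(\<exists>v. coprime v (int q) \<and> (chi v)\<^sup>2 \<noteq> 1) \<or> (t \<noteq> 0 \<and> \<bar>t\<bar> \<le> 2)"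
  shows "L_series chi (Complex 1 t) \<noteq> 0"
proof
  assume zero: "L_series chi (Complex 1 t) = 0"
  interpret bounded_partial_sums "\<lambda>n. chi (int (Suc n))" "real q"
    by unfold_locales (rule nonprincipal_partial_sums[OF dc u])
  have "(\<exists>u. coprime u (int q) \<and> (chi u)\<^sup>2 \<noteq> 1) \<or> (2 * t \<noteq> 0 \<and> \<bar>2 * t\<bar> \<le> 4)" using alt by auto
  from L_series_tendsto_at_right[OF dirichlet_character_square[OF dc] this]
  obtain l where l: "((\<lambda>\<sigma>. L_series (\<lambda>x. (chi x)\<^sup>2) (Complex \<sigma> (2 * t))) \<longlongrightarrow> l) (at_right 1)" by blast
  have "(L_series chi has_field_derivative deriv (L_series chi) (Complex 1 t)) (at (Complex 1 t))"
    by (rule holomorphic_derivI[OF dirichlet_series_holomorphic open_halfspace_Re_gt]) simp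
  then have D: "((\<lambda>s. (L_series chi s - L_series chi (Complex 1 t)) / (s - Complex 1 t)) \<longlongrightarrow> deriv (L_series chi) (Complex 1 t)) (at (Complex 1 t))"
    by (simp add: has_field_derivative_iff)
  have fl: "filterlim (\<lambda>\<sigma>. Complex \<sigma> t) (at (Complex 1 t)) (at_right 1)"
  proof (rule filterlim_atI[OF tendsto_Complex_at_right])
    show "\<forall>\<^sub>F \<sigma> in at_right 1. Complex \<sigma> t \<noteq> Complex 1 t"
      using eventually_at_right_gt by eventually_elim auto
  qed
  have "((\<lambda>\<sigma>. L_series chi (Complex \<sigma> t) / of_real (\<sigma> - 1)) \<longlongrightarrow> deriv (L_series chi) (Complex 1 t)) (at_right 1)"
  proof -
    have "Complex \<sigma> t - Complex 1 t = of_real (\<sigma> - 1)" for \<sigma> by (simp add: complex_eq_iff)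
    then show ?thesis using filterlim_compose[OF D fl] by (simp only: zero diff_0_right)
  qed
  note Q = tendsto_norm[OF this]
  have "((\<lambda>\<sigma>. \<sigma> ^ 3 * cmod (L_series chi (Complex \<sigma> t) / of_real (\<sigma> - 1)) ^ 4
      * cmod (L_series (\<lambda>x. (chi x)\<^sup>2) (Complex \<sigma> (2 * t))) * (\<sigma> - 1))
      \<longlongrightarrow> 1 ^ 3 * cmod (deriv (L_series chi) (Complex 1 t)) ^ 4 * cmod l * (1 - 1)) (at_right 1)"
    by (intro tendsto_intros Q l)
  then have lim: "((\<lambda>\<sigma>. \<sigma> ^ 3 * cmod (L_series chi (Complex \<sigma> t) / of_real (\<sigma> - 1)) ^ 4
      * cmod (L_series (\<lambda>x. (chi x)\<^sup>2) (Complex \<sigma> (2 * t))) * (\<sigma> - 1)) \<longlongrightarrow> 0) (at_right 1)"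
    by simp
  have "\<sigma> ^ 3 * cmod (L_series chi (Complex \<sigma> t) / of_real (\<sigma> - 1)) ^ 4
      * cmod (L_series (\<lambda>x. (chi x)\<^sup>2) (Complex \<sigma> (2 * t))) * (\<sigma> - 1) \<ge> 1" if \<sigma>: "\<sigma> > 1" for \<sigma>
  proof -
    define A where "A = cmod (L_series chi (Complex \<sigma> t))"
    define B where "B = cmod (L_series (\<lambda>x. (chi x)\<^sup>2) (Complex \<sigma> (2 * t)))"
    have AB: "A \<ge> 0" "B \<ge> 0" by (auto simp: A_def B_def)
    have "1 \<le> cmod (L_series (\<lambda>_. 1) (of_real \<sigma>)) ^ 3 * A ^ 4 * B"
      unfolding A_def B_def by (rule L_series_341[OF dc \<sigma>])
    also have "\<dots> \<le> (\<sigma> / (\<sigma> - 1)) ^ 3 * A ^ 4 * B"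
      using norm_zeta_le[OF \<sigma>] AB by (intro mult_right_mono power_mono) auto
    also have "\<dots> = \<sigma> ^ 3 * (A / (\<sigma> - 1)) ^ 4 * B * (\<sigma> - 1)"
    proof -
      have "(\<sigma> - 1) ^ 4 = (\<sigma> - 1) ^ 3 * (\<sigma> - 1)" by (simp add: eval_nat_numeral)
      then show ?thesis unfolding power_divide using \<sigma> by simp
    qed
    also have "A / (\<sigma> - 1) = cmod (L_series chi (Complex \<sigma> t) / of_real (\<sigma> - 1))"
      using \<sigma> unfolding A_def norm_divide norm_of_real by simp
    finally show ?thesis by (simp add: B_def)
  qed
  then have "\<forall>\<^sub>F \<sigma> in at_right 1. 1 \<le> \<sigma> ^ 3 * cmod (L_series chi (Complex \<sigma> t) / of_real (\<sigma> - 1)) ^ 4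
      * cmod (L_series (\<lambda>x. (chi x)\<^sup>2) (Complex \<sigma> (2 * t))) * (\<sigma> - 1)"
    using eventually_at_right_gt by (rule eventually_mono[rotated]) auto
  then have "(1::real) \<le> 0" by (rule tendsto_lowerbound[OF lim]) simp
  then show False by simp
qed


section \<open>Nonvanishing at 1 for real characters\<close>

lemma sum_divisors_prime_power:
  fixes \<rho> :: "nat \<Rightarrow> real"
  assumes mult: "\<And>m n. \<rho> (m * n) = \<rho> m * \<rho> n" and one: "\<rho> 1 = 1"
    and p: "prime p" "\<not> p dvd m" and m: "m > 0"
  shows "(\<Sum>d | d dvd p ^ k * m. \<rho> d) = (\<Sum>i\<le>k. \<rho> p ^ i) * (\<Sum>d | d dvd m. \<rho> d)"
proof -
  have pow: "\<rho> (p ^ i) = \<rho> p ^ i" for i by (induction i) (use mult one in simp_all)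
  have "{d. d dvd p ^ k * m} = (\<lambda>(i, d). p ^ i * d) ` ({..k} \<times> {d. d dvd m})"
  proof (intro Set.set_eqI iffI)
    fix e assume "e \<in> {d. d dvd p ^ k * m}"
    then obtain u v where uv: "e = u * v" "u dvd p ^ k" "v dvd m" using division_decomp by blast
    then obtain i where "i \<le> k" "u = p ^ i" using divides_primepow_nat[OF p(1)] by blast
    then show "e \<in> (\<lambda>(i, d). p ^ i * d) ` ({..k} \<times> {d. d dvd m})" using uv by force
  next
    fix e assume "e \<in> (\<lambda>(i, d). p ^ i * d) ` ({..k} \<times> {d. d dvd m})"
    then show "e \<in> {d. d dvd p ^ k * m}" by (auto intro: mult_dvd_mono le_imp_power_dvd)
  qed
  moreover have "inj_on (\<lambda>(i, d). p ^ i * d) ({..k} \<times> {d. d dvd m})"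
  proof (rule inj_onI, clarify)
    fix i d j e assume ij: "d dvd m" "e dvd m" "p ^ i * d = p ^ j * e"
    have nd: "\<not> p dvd d" "\<not> p dvd e" using ij p(2) dvd_trans by blast+
    have aux: "i \<le> j" if "p ^ i * d = p ^ j * e" "\<not> p dvd e" for i j d e
    proof (rule ccontr)
      assume "\<not> i \<le> j"
      then have "p ^ i = p ^ j * p ^ (i - j)" by (simp add: power_add[symmetric])
      then have "p ^ (i - j) * d = e" using that(1) prime_gt_0_nat[OF p(1)] by simp
      moreover have "p dvd p ^ (i - j)" using \<open>\<not> i \<le> j\<close> by (simp add: dvd_power)
      ultimately show False using that(2) by (metis dvd_mult2)
    qed
    have "i = j" using aux[OF ij(3) nd(2)] aux[OF ij(3)[symmetric] nd(1)] by simp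
    then show "i = j \<and> d = e" using ij(3) prime_gt_0_nat[OF p(1)] by simp
  qed
  ultimately have "(\<Sum>d | d dvd p ^ k * m. \<rho> d) = (\<Sum>(i, d)\<in>{..k} \<times> {d. d dvd m}. \<rho> (p ^ i * d))"
    by (simp add: sum.reindex case_prod_unfold)
  also have "\<dots> = (\<Sum>i\<le>k. \<Sum>d | d dvd m. \<rho> p ^ i * \<rho> d)"
    unfolding sum.cartesian_product[symmetric] by (simp add: mult pow)
  also have "\<dots> = (\<Sum>i\<le>k. \<rho> p ^ i) * (\<Sum>d | d dvd m. \<rho> d)"
    by (simp add: sum_product)
  finally show ?thesis .
qed

text \<open>One prime power is split off at a time. Its factor is a sum of powers of -1, 0 or 1,
  hence nonnegative, and at least 1 when the exponent is even, as it is for squares.\<close>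

lemma sum_divisors_real_character:
  fixes \<rho> :: "nat \<Rightarrow> real"
  assumes mult: "\<And>m n. \<rho> (m * n) = \<rho> m * \<rho> n" and one: "\<rho> 1 = 1" and val: "\<And>n. \<rho> n \<in> {-1, 0, 1}"
    and N: "N > 0"
  shows "(\<Sum>d | d dvd N. \<rho> d) \<ge> 0 \<and> ((\<exists>m. N = m\<^sup>2) \<longrightarrow> (\<Sum>d | d dvd N. \<rho> d) \<ge> 1)"
  using N
proof (induction N rule: less_induct)
  case (less N)
  show ?case
  proof (cases "N = 1")
    case True
    then have "{d. d dvd N} = {1}" by auto
    then show ?thesis by (simp add: one[simplified])
  next
    case False
    then obtain p where p: "prime p" "p dvd N" using prime_factor_nat by blast
    define k where "k = multiplicity p N"
    obtain m where m: "N = p ^ k * m" "\<not> p dvd m"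
      using multiplicity_decompose'[of N p] less.prems p(1) unfolding k_def by (metis less_irrefl not_prime_unit)
    have m0: "m > 0" using m less.prems by (cases m) auto
    have k0: "k > 0" using p m by (cases k) auto
    have "p ^ k > 1" using k0 prime_gt_1_nat[OF p(1)] by (rule one_less_power[rotated])
    then have "m < N" using m(1) m0 by simp
    then have IH: "(\<Sum>d | d dvd m. \<rho> d) \<ge> 0" "(\<exists>j. m = j\<^sup>2) \<Longrightarrow> (\<Sum>d | d dvd m. \<rho> d) \<ge> 1"
      using less.IH[of m] m0 by auto
    have eq: "(\<Sum>d | d dvd N. \<rho> d) = (\<Sum>i\<le>k. \<rho> p ^ i) * (\<Sum>d | d dvd m. \<rho> d)"
      unfolding m(1) by (rule sum_divisors_prime_power[OF mult one p(1) m(2) m0])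
    have geo: "(\<Sum>i\<le>k. x ^ i) \<ge> 0 \<and> (even k \<longrightarrow> (\<Sum>i\<le>k. x ^ i) \<ge> 1)" if "x \<in> {-1, 0, 1}" for x :: real and k
    proof -
      have "(\<Sum>i\<le>k. (-1) ^ i) = (if even k then 1 else 0 :: real)" by (induction k) auto
      moreover have "(\<Sum>i\<le>k. 0 ^ i) = (1 :: real)" by (induction k) auto
      ultimately show ?thesis using that by auto
    qed
    have 1: "(\<Sum>i\<le>k. \<rho> p ^ i) \<ge> 0" "even k \<Longrightarrow> (\<Sum>i\<le>k. \<rho> p ^ i) \<ge> 1" using geo[OF val] by auto
    have "(\<Sum>d | d dvd N. \<rho> d) \<ge> 1" if sq: "N = j\<^sup>2" for j
    proof -
      have j0: "j \<noteq> 0" using sq less.prems by (cases j) auto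
      define l where "l = multiplicity p j"
      obtain i where i: "j = p ^ l * i" "\<not> p dvd i"
        using multiplicity_decompose'[of j p] j0 p(1) unfolding l_def by (metis not_prime_unit)
      have "k = 2 * l" unfolding k_def l_def sq using p(1) j0 by (simp add: prime_elem_multiplicity_power_distrib)
      moreover from this have "m = i\<^sup>2"
        using sq m(1) i(1) prime_gt_0_nat[OF p(1)] by (simp add: power_mult_distrib power_mult[symmetric] mult.commute)
      ultimately show ?thesis using eq 1 IH mult_mono[of 1 "\<Sum>i\<le>k. \<rho> p ^ i" 1 "\<Sum>d | d dvd m. \<rho> d"] by auto
    qed
    then show ?thesis using eq 1(1) IH(1) by auto
  qed
qed

text \<open>Expanding x^n / (1 - x^n) geometrically and collecting equal exponents turns the Lambert
  series into the power series whose coefficients are the divisor sums of \<rho>; all terms but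
  those at squares are discarded.\<close>

lemma lambert_lower_bound:
  fixes \<rho> :: "nat \<Rightarrow> real"
  assumes mult: "\<And>m n. \<rho> (m * n) = \<rho> m * \<rho> n" and one: "\<rho> 1 = 1" and val: "\<And>n. \<rho> n \<in> {-1, 0, 1}"
    and x: "0 < x" "x < 1"
  shows "summable (\<lambda>n. \<rho> (Suc n) * (x ^ Suc n / (1 - x ^ Suc n)))"
    and "(\<Sum>m=1..M. x ^ (m\<^sup>2)) \<le> (\<Sum>n. \<rho> (Suc n) * (x ^ Suc n / (1 - x ^ Suc n)))"
proof -
  define G where "G = (\<lambda>(n, k). \<rho> (Suc n) * x ^ (Suc n * Suc k))"
  have geo: "((\<lambda>k. c * y ^ k) has_sum (c * (1 / (1 - y)))) UNIV" if "0 \<le> y" "y < 1" for c y :: real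
  proof -
    have "((\<lambda>k. y ^ k) has_sum (1 / (1 - y))) UNIV"
      using that by (intro sums_nonneg_imp_has_sum geometric_sums) auto
    then show ?thesis by (rule has_sum_cmult_right)
  qed
  have "(\<lambda>(n, k). x ^ n * x ^ k) summable_on (UNIV \<times> UNIV)"
  proof (rule summable_on_SigmaI)
    show "((\<lambda>k. case (n, k) of (n, k) \<Rightarrow> x ^ n * x ^ k) has_sum (x ^ n * (1 / (1 - x)))) UNIV" for n
      using geo[of x "x ^ n"] x by simp
    have "((\<lambda>n. (1 / (1 - x)) * x ^ n) has_sum ((1 / (1 - x)) * (1 / (1 - x)))) UNIV"
      using geo[of x "1 / (1 - x)"] x by simp
    then show "(\<lambda>n. x ^ n * (1 / (1 - x))) summable_on UNIV"
      by (auto simp: summable_on_def mult.commute)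
  qed (use x in auto)
  then have "(\<lambda>z. norm (G z)) summable_on (UNIV \<times> UNIV)"
  proof (rule Infinite_Sum.abs_summable_on_comparison_test')
    fix z :: "nat \<times> nat"
    obtain n k where z: "z = (n, k)" by (cases z)
    have "\<bar>\<rho> (Suc n)\<bar> \<le> 1" using val[of "Suc n"] by auto
    moreover have "x ^ (Suc n * Suc k) \<le> x ^ (n + k)" using x by (intro power_decreasing) auto
    ultimately have "\<bar>\<rho> (Suc n)\<bar> * x ^ (Suc n * Suc k) \<le> 1 * x ^ (n + k)" using x by (intro mult_mono) auto
    then show "norm (G z) \<le> (case z of (n, k) \<Rightarrow> x ^ n * x ^ k)"
      using x by (simp add: G_def z abs_mult power_add)
  qed
  then have "G summable_on (UNIV \<times> UNIV)" by (rule Infinite_Sum.abs_summable_summable)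
  then obtain S where S: "(G has_sum S) (UNIV \<times> UNIV)" by (auto simp: summable_on_def)
  have "((\<lambda>n. \<rho> (Suc n) * (x ^ Suc n / (1 - x ^ Suc n))) has_sum S) UNIV"
  proof (rule has_sum_SigmaD[OF S])
    fix n
    have "x ^ Suc n < 1" using x by (intro power_Suc_less_one) auto
    moreover have "G (n, k) = (\<rho> (Suc n) * x ^ Suc n) * (x ^ Suc n) ^ k" for k
      unfolding G_def prod.case power_mult power_Suc[of "x ^ Suc n" k] by (simp only: mult.assoc)
    ultimately show "((\<lambda>k. G (n, k)) has_sum (\<rho> (Suc n) * (x ^ Suc n / (1 - x ^ Suc n)))) UNIV"
      using geo[of "x ^ Suc n" "\<rho> (Suc n) * x ^ Suc n"] x by simp
  qed
  then have sums: "(\<lambda>n. \<rho> (Suc n) * (x ^ Suc n / (1 - x ^ Suc n))) sums S" by (rule has_sum_imp_sums)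
  then show "summable (\<lambda>n. \<rho> (Suc n) * (x ^ Suc n / (1 - x ^ Suc n)))" by (rule sums_summable)
  \<comment> \<open>Exhausting the absolutely convergent double sum by the regions under hyperbolas
    yields exactly the partial sums of the power series.\<close>
  define F where "F T = {(n, k). Suc n * Suc k \<le> T}" for T
  have F_sub: "F T \<subseteq> {..<T} \<times> {..<T}" for T
  proof clarify
    fix n k assume "(n, k) \<in> F T"
    then have "Suc n * Suc k \<le> T" by (simp add: F_def)
    moreover have "Suc n \<le> Suc n * Suc k" "Suc k \<le> Suc n * Suc k" by simp_all
    ultimately show "n \<in> {..<T} \<and> k \<in> {..<T}" by auto
  qed
  have F_fin: "finite (F T)" for T using finite_subset[OF F_sub] by simp
  have lim: "(\<lambda>T. sum G (F T)) \<longlonglongrightarrow> S"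
  proof (rule filterlim_compose[OF S[unfolded has_sum_def]])
    show "filterlim F (finite_subsets_at_top (UNIV \<times> UNIV)) sequentially"
      unfolding filterlim_finite_subsets_at_top
    proof safe
      fix X :: "(nat \<times> nat) set" assume "finite X"
      then have "finite ((\<lambda>(n, k). Suc n * Suc k) ` X)" by simp
      then obtain B where B: "\<And>n k. (n, k) \<in> X \<Longrightarrow> Suc n * Suc k \<le> B"
        unfolding finite_nat_set_iff_bounded_le by fastforce
      show "\<forall>\<^sub>F T in sequentially. finite (F T) \<and> X \<subseteq> F T \<and> F T \<subseteq> UNIV \<times> UNIV"
        using eventually_ge_at_top[of B]
      proof eventually_elim
        case (elim T)
        have "X \<subseteq> F T" unfolding F_def using B elim by (force intro: order.trans)
        then show ?case using F_fin by auto
      qed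
    qed
  qed
  have sumF: "sum G (F T) = (\<Sum>N=1..T. (\<Sum>d | d dvd N. \<rho> d) * x ^ N)" for T
  proof -
    have "sum G (F T) = (\<Sum>(N, d)\<in>(SIGMA N:{1..T}. {d. d dvd N}). \<rho> d * x ^ N)"
    proof (rule sum.reindex_bij_witness[where i = "\<lambda>(N, d). (d - 1, N div d - 1)" and j = "\<lambda>(n, k). (Suc n * Suc k, Suc n)"])
      fix z assume z: "z \<in> F T"
      obtain n k where nk: "z = (n, k)" by (cases z)
      show "(case case z of (n, k) \<Rightarrow> (Suc n * Suc k, Suc n) of (N, d) \<Rightarrow> (d - 1, N div d - 1)) = z"
        unfolding nk by (simp del: mult_Suc mult_Suc_right)
      show "(case z of (n, k) \<Rightarrow> (Suc n * Suc k, Suc n)) \<in> (SIGMA N:{1..T}. {d. d dvd N})"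
        using z unfolding nk by (auto simp: F_def simp del: mult_Suc mult_Suc_right)
      show "(case case z of (n, k) \<Rightarrow> (Suc n * Suc k, Suc n) of (N, d) \<Rightarrow> \<rho> d * x ^ N) = G z"
        unfolding nk G_def by simp
    next
      fix z assume z: "z \<in> (SIGMA N:{1..T}. {d. d dvd N})"
      then obtain N d where nk: "z = (N, d)" "1 \<le> N" "N \<le> T" "d dvd N" by auto
      then obtain e where e: "N = d * e" by auto
      have "d > 0" "e > 0" using nk e by (auto intro!: Nat.gr0I)
      then have "Suc (d - 1) = d" "Suc (e - 1) = e" "N div d = e" using e by auto
      then show "(case case z of (N, d) \<Rightarrow> (d - 1, N div d - 1) of (n, k) \<Rightarrow> (Suc n * Suc k, Suc n)) = z"
        "(case z of (N, d) \<Rightarrow> (d - 1, N div d - 1)) \<in> F T"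
        using nk e by (simp_all add: F_def del: mult_Suc mult_Suc_right)
    qed
    also have "\<dots> = (\<Sum>N=1..T. (\<Sum>d | d dvd N. \<rho> d * x ^ N))"
      by (rule sum.Sigma[symmetric]) (auto intro: finite_divisors_nat)
    finally show ?thesis by (simp add: sum_distrib_right)
  qed
  have "(\<Sum>m=1..M. x ^ (m\<^sup>2)) \<le> sum G (F T)" if "T \<ge> M\<^sup>2" for T
  proof -
    have sq: "(\<lambda>m. m\<^sup>2) ` {1..M} \<subseteq> {1..T}"
    proof clarify
      fix m assume m: "m \<in> {1..M}"
      then have "m\<^sup>2 \<le> M\<^sup>2" by (intro power_mono) auto
      then have "m\<^sup>2 \<le> T" using that by (rule le_trans)
      then show "m\<^sup>2 \<in> {1..T}" using m by simp
    qed
    have "(\<Sum>m=1..M. x ^ (m\<^sup>2)) = (\<Sum>N\<in>(\<lambda>m. m\<^sup>2) ` {1..M}. x ^ N)"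
      by (subst sum.reindex) (auto simp: inj_on_def)
    also have "\<dots> \<le> (\<Sum>N\<in>(\<lambda>m. m\<^sup>2) ` {1..M}. (\<Sum>d | d dvd N. \<rho> d) * x ^ N)"
    proof (intro sum_mono)
      fix N assume N: "N \<in> (\<lambda>m. m\<^sup>2) ` {1..M}"
      then have "N > 0" "\<exists>m. N = m\<^sup>2" using sq by auto
      then have "(\<Sum>d | d dvd N. \<rho> d) \<ge> 1" using sum_divisors_real_character[OF mult one val] by blast
      then show "x ^ N \<le> (\<Sum>d | d dvd N. \<rho> d) * x ^ N" using x mult_right_mono[of 1 _ "x ^ N"] by simp
    qed
    also have "\<dots> \<le> (\<Sum>N=1..T. (\<Sum>d | d dvd N. \<rho> d) * x ^ N)"
    proof (rule sum_mono2[OF _ sq])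
      fix N assume "N \<in> {1..T} - (\<lambda>m. m\<^sup>2) ` {1..M}"
      then show "(\<Sum>d | d dvd N. \<rho> d) * x ^ N \<ge> 0"
        using sum_divisors_real_character[OF mult one val, of N] x by auto
    qed simp
    finally show ?thesis by (simp add: sumF)
  qed
  then have "(\<Sum>m=1..M. x ^ (m\<^sup>2)) \<le> S"
    by (intro LIMSEQ_le_const[OF lim]) auto
  then show "(\<Sum>m=1..M. x ^ (m\<^sup>2)) \<le> (\<Sum>n. \<rho> (Suc n) * (x ^ Suc n / (1 - x ^ Suc n)))"
    using sums_unique[OF sums] by simp
qed


text \<open>
  Monsky's argument: if \<open>L(1, chi) = 0\<close>, the Lambert series of \<open>chi\<close> stays bounded near \<open>1\<close>, while
  its power series coefficients are nonnegative and at least \<open>1\<close> at the squares.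
\<close>

lemma L_series_nonzero_real:
  assumes dc: "dirichlet_character q chi" and u: "coprime u (int q)" "chi u \<noteq> 1"
    and sq: "\<And>v. coprime v (int q) \<Longrightarrow> (chi v)\<^sup>2 = 1"
  shows "L_series chi 1 \<noteq> 0"
proof
  assume zero: "L_series chi 1 = 0"
  define \<rho> where "\<rho> n = Re (chi (int n))" for n
  have val: "chi v \<in> {-1, 0, 1}" for v
    using sq[of v] dirichlet_character_eq_0_iff[OF dc, of v] by (auto simp: power2_eq_1_iff)
  have chi: "chi (int n) = of_real (\<rho> n)" for n using val[of "int n"] by (auto simp: \<rho>_def)
  have \<rho>_mult: "\<rho> (m * n) = \<rho> m * \<rho> n" for m n
    using val[of "int m"] val[of "int n"] by (auto simp: \<rho>_def dirichlet_character_mult[OF dc])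
  have \<rho>_one: "\<rho> 1 = 1" using dirichlet_character_one[OF dc] by (simp add: \<rho>_def)
  have \<rho>_val: "\<rho> n \<in> {-1, 0, 1}" for n using val[of "int n"] by (auto simp: \<rho>_def)
  interpret bounded_partial_sums "\<lambda>n. chi (int (Suc n))" "real q"
    by unfold_locales (rule nonprincipal_partial_sums[OF dc u])
  have bound: "(\<Sum>m=1..M. x ^ (m\<^sup>2)) \<le> 2 * real q" if x: "0 < x" "x < 1" for x :: real and M :: nat
  proof -
    define S where "S n = (\<Sum>i<n. x ^ i)" for n
    have S: "1 - x ^ n = (1 - x) * S n" for n unfolding S_def by (rule one_diff_power_eq)
    have S_Suc: "S (Suc n) = 1 + x * S n" for n
      unfolding S_def sum.lessThan_Suc_shift by (simp add: sum_distrib_left)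
    define y where "y = sqrt x"
    have y: "0 < y" "y < 1" "y\<^sup>2 = x" using x by (auto simp: y_def)
    \<comment> \<open>Arithmetic-geometric mean applied to the pair x^i, x^(n - i).\<close>
    have S_ge: "S (Suc n) \<ge> real (Suc n) * y ^ n" for n
    proof -
      have "S (Suc n) = (\<Sum>i<Suc n. x ^ (n - i))"
        unfolding S_def using sum.nat_diff_reindex[of "\<lambda>i. x ^ i" "Suc n"] by simp
      then have "2 * S (Suc n) = (\<Sum>i<Suc n. x ^ i + x ^ (n - i))"
        unfolding sum.distrib by (simp add: S_def)
      also have "\<dots> \<ge> (\<Sum>i<Suc n. 2 * y ^ n)"
      proof (intro sum_mono)
        fix i assume i: "i \<in> {..<Suc n}"
        have "0 \<le> (y ^ i - y ^ (n - i))\<^sup>2" by simp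
        also have "\<dots> = x ^ i + x ^ (n - i) - 2 * (y ^ i * y ^ (n - i))"
          unfolding y(3)[symmetric] by (simp add: power2_diff power_mult[symmetric] mult.commute)
        also have "y ^ i * y ^ (n - i) = y ^ n" using i by (simp add: power_add[symmetric])
        finally show "2 * y ^ n \<le> x ^ i + x ^ (n - i)" by simp
      qed
      finally show ?thesis by simp
    qed
    have S_pos: "S (Suc n) > 0" for n
      using S_ge[of n] y by (intro less_le_trans[OF _ S_ge]) simp
    \<comment> \<open>The weight is 1/N - (1 - x) x^N / (1 - x^N) with N = n + 1. Summed against
      \<open>chi\<close> it gives L(1, chi) = 0 minus (1 - x) times the Lambert series. As the
      weights decrease from \<open>w 0 = 1 - x\<close>, Abel's inequality bounds the Lambert series
      by 2 q after division by 1 - x.\<close>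
    define w where "w n = 1 / real (Suc n) - x ^ Suc n / S (Suc n)" for n
    have w_anti: "w (Suc n) \<le> w n" for n
    proof -
      let ?A = "S (Suc n)" and ?B = "S (Suc (Suc n))"
      have "real (Suc n) * real (Suc (Suc n)) * x ^ Suc n \<le> (real (Suc n) * y ^ n) * (real (Suc (Suc n)) * y ^ Suc n)"
      proof -
        have "x ^ Suc n = y ^ (n + Suc n) * y" unfolding y(3)[symmetric] power_mult[symmetric]
          by (simp add: mult_2 power_add)
        also have "\<dots> \<le> y ^ (n + Suc n) * 1" using y by (intro mult_left_mono) auto
        finally have "x ^ Suc n \<le> y ^ n * y ^ Suc n" by (simp only: power_add mult_1_right)
        then have "real (Suc n) * real (Suc (Suc n)) * x ^ Suc n \<le> real (Suc n) * real (Suc (Suc n)) * (y ^ n * y ^ Suc n)"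
          by (intro mult_left_mono) auto
        then show ?thesis by (simp only: mult_ac)
      qed
      also have "\<dots> \<le> ?A * ?B" using S_ge[of n] S_ge[of "Suc n"] y less_imp_le[OF S_pos] by (intro mult_mono) auto
      finally have le: "real (Suc n) * real (Suc (Suc n)) * x ^ Suc n \<le> ?A * ?B" .
      have "x ^ Suc n / ?A - x ^ Suc (Suc n) / ?B = x ^ Suc n * (?B - x * ?A) / (?A * ?B)"
        using S_pos[of n] S_pos[of "Suc n"] by (simp add: field_simps)
      also have "?B - x * ?A = 1" using S_Suc[of "Suc n"] by simp
      finally have 1: "x ^ Suc n / ?A - x ^ Suc (Suc n) / ?B = x ^ Suc n / (?A * ?B)" by simp
      have 2: "1 / real (Suc n) - 1 / real (Suc (Suc n)) = 1 / (real (Suc n) * real (Suc (Suc n)))"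
        by (simp add: field_simps)
      have "x ^ Suc n / (?A * ?B) \<le> 1 / (real (Suc n) * real (Suc (Suc n)))"
        using le S_pos[of n] S_pos[of "Suc n"] by (simp add: divide_simps mult_ac)
      then show ?thesis using 1 2 unfolding w_def by linarith
    qed
    have w_nonneg: "w n \<ge> 0" for n
    proof -
      have "x ^ Suc n \<le> y ^ n"
      proof -
        have "x ^ Suc n = y ^ (2 * Suc n)" unfolding y(3)[symmetric] power_mult[symmetric] ..
        also have "\<dots> \<le> y ^ n" using y by (intro power_decreasing) auto
        finally show ?thesis .
      qed
      then have "real (Suc n) * x ^ Suc n \<le> real (Suc n) * y ^ n" by (intro mult_left_mono) auto
      also have "\<dots> \<le> S (Suc n)" by (rule S_ge)
      finally show ?thesis using S_pos[of n] unfolding w_def by (simp add: divide_simps mult_ac)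
    qed
    let ?f = "\<lambda>n. \<rho> (Suc n) * (x ^ Suc n / (1 - x ^ Suc n))"
    note lam = lambert_lower_bound[OF \<rho>_mult \<rho>_one \<rho>_val x]
    have "(\<lambda>n. chi (int (Suc n)) / of_nat (Suc n) powr 1 - of_real ((1 - x) * ?f n)) sums (0 - of_real ((1 - x) * suminf ?f))"
      using dirichlet_series_sums[of 1] zero
      by (intro sums_diff sums_of_real sums_mult summable_sums lam(1)) simp
    moreover have "chi (int (Suc n)) / of_nat (Suc n) powr 1 - of_real ((1 - x) * ?f n) = chi (int (Suc n)) * of_real (w n)" for n
    proof -
      have "(1 - x) * ?f n = \<rho> (Suc n) * (x ^ Suc n / S (Suc n))" unfolding S using x by simp
      then show ?thesis unfolding chi w_def by (simp add: algebra_simps del: power_Suc of_nat_Suc)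
    qed
    ultimately have lim: "(\<lambda>N. \<Sum>n<N. chi (int (Suc n)) * of_real (w n)) \<longlonglongrightarrow> - of_real ((1 - x) * suminf ?f)"
      by (simp add: sums_def)
    have "cmod (\<Sum>n=0..<N. chi (int (Suc n)) * of_real (w n)) \<le> 2 * real q * w 0" for N
      by (rule Abel_inequality[where w = w and B = "real q"]) (rule partial w_anti w_nonneg)+
    then have "cmod (- of_real ((1 - x) * suminf ?f)) \<le> 2 * real q * w 0"
      by (intro Lim_norm_ubound[OF trivial_limit_sequentially lim]) (simp add: lessThan_atLeast0)
    moreover have "w 0 = 1 - x" by (simp add: w_def S_def)
    ultimately have "(1 - x) * \<bar>suminf ?f\<bar> \<le> (1 - x) * (2 * real q)"
      unfolding norm_minus_cancel norm_of_real abs_mult using x by (simp add: mult_ac)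
    then have "suminf ?f \<le> 2 * real q" using x by simp
    then show ?thesis using lam(2)[of M] by linarith
  qed
  \<comment> \<open>One square more than the bound 2 q allows, since each term tends to 1 as x tends
    to 1.\<close>
  define M where "M = 2 * q + 1"
  have "((\<lambda>x::real. \<Sum>m=1..M. x ^ (m\<^sup>2)) \<longlongrightarrow> (\<Sum>m=1..M. 1 ^ (m\<^sup>2))) (at_left 1)"
    by (intro tendsto_intros)
  moreover have "\<forall>\<^sub>F x in at_left (1::real). (\<Sum>m=1..M. x ^ (m\<^sup>2)) \<le> 2 * real q"
    by (rule eventually_mono[OF eventually_at_left_real[of 0 1]]) (use bound[of _ M] in auto)
  ultimately have "(\<Sum>m=1..M. (1::real) ^ (m\<^sup>2)) \<le> 2 * real q"
    by (intro tendsto_upperbound) auto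
  then show False by (simp add: M_def)
qed

section \<open>Bounding the value at 1 under GRH\<close>

text \<open>The primes of the block exceed x, and their product divides the primorial of 2 x, which
  is at most 4^(2 x).\<close>

lemma prime_count_dyadic:
  fixes x :: nat
  assumes "x \<ge> 2"
  shows "real (card {p. prime p \<and> x < p \<and> p \<le> 2 * x}) * ln (real x) \<le> 2 * real x * ln 4"
proof -
  let ?B = "{p. prime p \<and> x < p \<and> p \<le> 2 * x}"
  have "x ^ card ?B = (\<Prod>p\<in>?B. x)" by simp
  also have "\<dots> \<le> \<Prod>?B" by (intro prod_mono) auto
  also have "\<dots> \<le> primorial (2 * x)"
    unfolding primorial_def by (intro dvd_imp_le prod_dvd_prod_subset) (auto intro!: prod_pos prime_gt_0_nat)
  also have "\<dots> \<le> 4 ^ (2 * x)" by (rule primorial_le)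
  finally have "real (x ^ card ?B) \<le> real (4 ^ (2 * x))" by (simp only: of_nat_le_iff)
  then have "ln (real x ^ card ?B) \<le> ln (4 ^ (2 * x))"
    using assms by (intro ln_mono) auto
  then show ?thesis using assms by (simp add: ln_realpow)
qed

lemma one_minus_exp_ge:
  fixes x :: real
  assumes "0 \<le> x" "x \<le> 1"
  shows "1 - exp (- x) \<ge> x / 2"
proof -
  have "exp (- x) \<le> 1 / (1 + x)"
    using exp_ge_add_one_self[of x] assms by (simp add: exp_minus field_simps)
  moreover have "1 - 1 / (1 + x) - x / 2 = x * (1 - x) / (2 * (1 + x))"
    using assms by (simp add: field_simps)
  moreover have "x * (1 - x) / (2 * (1 + x)) \<ge> 0" using assms by simp
  ultimately show ?thesis by linarith
qed

text \<open>The exponent is the one at the edge of the half-plane Re s \<ge> 1 + 1 / ln y; primes up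
  to y are left out because their Euler factors will cancel.\<close>

definition prime_tail :: "nat \<Rightarrow> nat \<Rightarrow> real" where
  "prime_tail y n = (if prime n \<and> y < n then real n powr (- 1 - 1 / ln (real y)) else 0)"

lemma prime_tail_nonneg: "prime_tail y n \<ge> 0"
  by (simp add: prime_tail_def)

text \<open>The j-th dyadic block contributes at most 4 ln 2 / ln y times \<rho>^j. The geometric
  series sums to at most 2 ln y / ln 2, because 1 - \<rho> is at least \<eta> ln 2 / 2; the
  logarithms of y cancel and 8 remains.\<close>

lemma prime_tail_sum_le:
  assumes y: "y \<ge> 8"
  shows "(\<Sum>n<N. prime_tail y n) \<le> 8"
proof -
  define \<eta> where "\<eta> = 1 / ln (real y)"
  have "exp (1::real) \<le> 8" using exp_le by linarith
  also have "\<dots> \<le> real y" using y by simp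
  finally have "1 \<le> ln (real y)" using y by (simp add: ln_ge_iff)
  then have \<eta>: "0 < \<eta>" "\<eta> \<le> 1" "\<eta> * ln (real y) = 1" by (auto simp: \<eta>_def)
  define \<rho> where "\<rho> = 2 powr (- \<eta>)"
  have \<rho>0: "\<rho> \<ge> 0" by (simp add: \<rho>_def)
  have \<rho>1: "1 - \<rho> \<ge> \<eta> * ln 2 / 2"
  proof -
    have "\<eta> * ln 2 \<le> 1 * 1" using \<eta> ln_2_less_1 by (intro mult_mono) auto
    then have "1 - exp (- (\<eta> * ln 2)) \<ge> \<eta> * ln 2 / 2"
      using \<eta> by (intro one_minus_exp_ge) auto
    then show ?thesis by (simp add: \<rho>_def powr_def)
  qed
  have ln2: "ln (2::real) > 0" by simp
  have "\<eta> * ln 2 / 2 > 0" using \<eta> ln2 by simp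
  then have \<rho>2: "\<rho> < 1" "1 - \<rho> > 0" using \<rho>1 by linarith+
  have block: "(\<Sum>n\<in>{2 ^ j * y<..2 ^ Suc j * y}. prime_tail y n) \<le> 4 * ln 2 / ln (real y) * \<rho> ^ j" for j
  proof -
    define x where "x = 2 ^ j * y"
    have xy: "y \<le> x" by (simp add: x_def)
    have x2: "x \<ge> 2" using xy y by simp
    let ?B = "{p. prime p \<and> x < p \<and> p \<le> 2 * x}"
    have "(\<Sum>n\<in>{x<..2 * x}. prime_tail y n) = (\<Sum>n\<in>?B. prime_tail y n)"
      by (rule sum.mono_neutral_right) (auto simp: prime_tail_def)
    also have "\<dots> \<le> (\<Sum>n\<in>?B. real x powr (- 1 - \<eta>))"
      using xy x2 \<eta> by (intro sum_mono) (auto simp: prime_tail_def \<eta>_def[symmetric] intro!: powr_mono2')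
    also have "\<dots> = real (card ?B) * real x powr (- 1 - \<eta>)" by simp
    also have "\<dots> \<le> (2 * real x * ln 4 / ln (real x)) * real x powr (- 1 - \<eta>)"
      using prime_count_dyadic[OF x2] x2 by (intro mult_right_mono) (auto simp: field_simps)
    also have "\<dots> = 2 * ln 4 / ln (real x) * real x powr (- \<eta>)"
    proof -
      have "real x powr (- 1 - \<eta>) = real x powr (- 1) * real x powr (- \<eta>)" by (subst powr_add[symmetric]) simp
      also have "real x powr (- 1) = 1 / real x" using x2 by (simp add: powr_minus_divide)
      finally show ?thesis using x2 by simp
    qed
    also have "\<dots> \<le> 2 * ln 4 / ln (real y) * \<rho> ^ j"
    proof (intro mult_mono divide_left_mono)
      show "ln (real y) \<le> ln (real x)" using xy y by (simp add: ln_mono)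
      have "real x powr (- \<eta>) = (2 ^ j) powr (- \<eta>) * real y powr (- \<eta>)"
        by (simp add: x_def powr_mult)
      also have "(2 ^ j :: real) powr (- \<eta>) = \<rho> ^ j"
        by (simp add: \<rho>_def powr_powr powr_realpow[symmetric] mult.commute)
      also have "real y powr (- \<eta>) \<le> real y powr 0" using y \<eta> by (intro powr_mono) auto
      finally show "real x powr (- \<eta>) \<le> \<rho> ^ j" using \<rho>0 y by (simp add: mult_left_mono)
      show "0 < ln (real x) * ln (real y)" using x2 y by simp
    qed (use y \<rho>0 in auto)
    also have "ln (4::real) = 2 * ln 2" using ln_realpow[of "2::real" 2] by simp
    finally show ?thesis by (simp add: x_def mult.assoc)
  qed
  have full: "(\<Sum>n\<le>2 ^ J * y. prime_tail y n) \<le> (\<Sum>j<J. 4 * ln 2 / ln (real y) * \<rho> ^ j)" for J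
  proof (induction J)
    case 0
    have "(\<Sum>n\<le>y. prime_tail y n) = 0" by (intro sum.neutral) (auto simp: prime_tail_def)
    then show ?case by simp
  next
    case (Suc J)
    have "{..2 ^ Suc J * y} = {..2 ^ J * y} \<union> {2 ^ J * y<..2 ^ Suc J * y}" by auto
    then have "(\<Sum>n\<le>2 ^ Suc J * y. prime_tail y n)
        = (\<Sum>n\<le>2 ^ J * y. prime_tail y n) + (\<Sum>n\<in>{2 ^ J * y<..2 ^ Suc J * y}. prime_tail y n)"
      by (simp only:) (rule sum.union_disjoint, auto)
    then show ?case using Suc block[of J] by simp
  qed
  have "N \<le> 2 ^ N * y"
  proof -
    have "N < 2 ^ N" by simp
    also have "2 ^ N \<le> 2 ^ N * y" using y by simp
    finally show ?thesis by simp
  qed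
  then have "{..<N} \<subseteq> {..2 ^ N * y}" by auto
  then have "(\<Sum>n<N. prime_tail y n) \<le> (\<Sum>n\<le>2 ^ N * y. prime_tail y n)"
    by (intro sum_mono2 prime_tail_nonneg) auto
  also have "\<dots> \<le> (\<Sum>j<N. 4 * ln 2 / ln (real y) * \<rho> ^ j)" by (rule full)
  also have "\<dots> = 4 * ln 2 / ln (real y) * (\<Sum>j<N. \<rho> ^ j)" by (simp add: sum_distrib_left)
  also have "\<dots> \<le> 4 * ln 2 / ln (real y) * (2 / (\<eta> * ln 2))"
  proof (rule mult_left_mono)
    have "(\<Sum>j<N. \<rho> ^ j) = (1 - \<rho> ^ N) / (1 - \<rho>)"
      using one_diff_power_eq[of \<rho> N] \<rho>2 by (simp add: field_simps)
    also have "\<dots> \<le> 1 / (1 - \<rho>)" using \<rho>2 \<rho>0 by (intro divide_right_mono) auto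
    also have "\<dots> \<le> 1 / (\<eta> * ln 2 / 2)" using \<rho>1 \<rho>2 \<eta> ln2 by (intro divide_left_mono mult_pos_pos) auto
    finally show "(\<Sum>j<N. \<rho> ^ j) \<le> 2 / (\<eta> * ln 2)" by simp
  qed (use y in auto)
  also have "\<dots> = 8" using \<eta> ln2 by (simp add: \<eta>_def)
  finally show ?thesis .
qed

section \<open>The logarithm of L(s, chi) / L(s, psi)\<close>

definition log_euler_factor :: "(int \<Rightarrow> complex) \<Rightarrow> complex \<Rightarrow> nat \<Rightarrow> complex" where
  "log_euler_factor chi s p = Ln (1 - chi (int p) / of_nat p powr s)"

text \<open>\<open>log_euler_factor\<close> is the logarithm of the reciprocal of an Euler factor,
  hence psi comes first. The value 0 at non-primes lets the series run over all naturals.\<close>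

definition log_quotient_term :: "(int \<Rightarrow> complex) \<Rightarrow> (int \<Rightarrow> complex) \<Rightarrow> nat \<Rightarrow> complex \<Rightarrow> complex" where
  "log_quotient_term psi chi p s = (if prime p then log_euler_factor psi s p - log_euler_factor chi s p else 0)"

text \<open>Below 1/2 the principal logarithm is continuous and Ln (1 + z) is at most 2 |z| in
  modulus.\<close>

lemma euler_factor_small:
  assumes dc: "dirichlet_character q chi" and p: "prime p" and s: "Re s > 1"
  shows "cmod (chi (int p) / of_nat p powr s) \<le> real p powr (- Re s)"
    and "cmod (chi (int p) / of_nat p powr s) < 1 / 2"
proof -
  have p2: "p \<ge> 2" using prime_ge_2_nat[OF p] .
  have "cmod (chi (int p) / of_nat p powr s) = cmod (chi (int p)) / real p powr Re s"
    using p2 by (simp add: norm_divide norm_powr_real_powr)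
  also have "\<dots> \<le> 1 / real p powr Re s"
    by (intro divide_right_mono dirichlet_character_norm_le[OF dc]) auto
  finally show 1: "cmod (chi (int p) / of_nat p powr s) \<le> real p powr (- Re s)"
    by (simp add: powr_minus_divide)
  have "real p powr (- Re s) \<le> 2 powr (- Re s)" using p2 s by (intro powr_mono2') auto
  also have "\<dots> < 2 powr (-1)" using s by (intro powr_less_mono) auto
  finally show "cmod (chi (int p) / of_nat p powr s) < 1 / 2" using 1 by (simp add: powr_minus_divide)
qed

lemma norm_log_euler_factor:
  assumes dc: "dirichlet_character q chi" and p: "prime p" and s: "Re s > 1"
  shows "cmod (log_euler_factor chi s p) \<le> 2 * real p powr (- Re s)"
    and "exp (log_euler_factor chi s p) = 1 - chi (int p) / of_nat p powr s"
    and "1 - chi (int p) / of_nat p powr s \<notin> \<real>\<^sub>\<le>\<^sub>0"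
proof -
  define z where "z = - (chi (int p) / of_nat p powr s)"
  have z: "cmod z \<le> real p powr (- Re s)" "cmod z < 1 / 2"
    using euler_factor_small[OF assms] by (auto simp: z_def)
  have eq: "1 - chi (int p) / of_nat p powr s = 1 + z" by (simp add: z_def)
  have "cmod (Ln (1 + z)) \<le> 2 * cmod z" by (rule norm_Ln_le[OF z(2)])
  then show "cmod (log_euler_factor chi s p) \<le> 2 * real p powr (- Re s)"
    unfolding log_euler_factor_def eq using z(1) by linarith
  have "Re (1 + z) > 0" using z(2) abs_Re_le_cmod[of z] by simp
  then show nr: "1 - chi (int p) / of_nat p powr s \<notin> \<real>\<^sub>\<le>\<^sub>0"
    unfolding eq by (auto simp: complex_nonpos_Reals_iff)
  then show "exp (log_euler_factor chi s p) = 1 - chi (int p) / of_nat p powr s"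
    unfolding log_euler_factor_def by (intro exp_Ln) auto
qed

text \<open>Terms with p \<le> y vanish because the characters agree there; the others are dominated
  by 4 times \<open>prime_tail\<close>, of sum at most 8, whence 32 for every \<open>y\<close>. The
  same majorant gives uniform convergence and so continuity.\<close>

lemma log_quotient:
  assumes dcp: "dirichlet_character b psi" and dc: "dirichlet_character q chi"
    and agree: "\<And>n. 0 < n \<Longrightarrow> n \<le> y \<Longrightarrow> chi (int n) = psi (int n)" and y: "y \<ge> 8"
  defines "D \<equiv> {s. Re s \<ge> 1 + 1 / ln (real y)}"
  shows "continuous_on D (\<lambda>s. \<Sum>p. log_quotient_term psi chi p s)"
    and "s \<in> D \<Longrightarrow> cmod (\<Sum>p. log_quotient_term psi chi p s) \<le> 32"
    and "s \<in> D \<Longrightarrow> exp (\<Sum>p. log_quotient_term psi chi p s) = L_series chi s / L_series psi s"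
proof -
  have lny: "ln (real y) > 0" using y by simp
  have D: "Re s > 1" if "s \<in> D" for s using that lny by (simp add: D_def) (smt (verit) divide_pos_pos)
  have bound: "cmod (log_quotient_term psi chi p s) \<le> 4 * prime_tail y p" if s: "s \<in> D" for p s
  proof (cases "prime p \<and> y < p")
    case True
    then have p: "prime p" by simp
    have "cmod (log_quotient_term psi chi p s) \<le> cmod (log_euler_factor psi s p) + cmod (log_euler_factor chi s p)"
      using p by (simp add: log_quotient_term_def norm_triangle_ineq4)
    also have "\<dots> \<le> 2 * real p powr (- Re s) + 2 * real p powr (- Re s)"
      by (intro add_mono norm_log_euler_factor(1)[OF dcp p D[OF s]] norm_log_euler_factor(1)[OF dc p D[OF s]])
    also have "\<dots> \<le> 4 * real p powr (- 1 - 1 / ln (real y))"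
      using s prime_ge_1_nat[OF p] by (auto simp: D_def intro!: powr_mono)
    finally show ?thesis using True by (simp add: prime_tail_def)
  next
    case False
    have "log_quotient_term psi chi p s = 0"
    proof (cases "prime p")
      case True
      then have "chi (int p) = psi (int p)" using False agree[of p] prime_gt_0_nat[OF True] by simp
      then show ?thesis by (simp add: log_quotient_term_def log_euler_factor_def)
    qed (simp add: log_quotient_term_def)
    then show ?thesis using prime_tail_nonneg by simp
  qed
  have sm: "summable (prime_tail y)"
    by (rule summableI_nonneg_bounded[OF prime_tail_nonneg prime_tail_sum_le[OF y]])
  have sm4: "summable (\<lambda>p. 4 * prime_tail y p)" using sm by (rule summable_mult)
  have ul: "uniform_limit D (\<lambda>N s. \<Sum>p<N. log_quotient_term psi chi p s) (\<lambda>s. \<Sum>p. log_quotient_term psi chi p s) sequentially"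
    by (rule Weierstrass_m_test[OF bound sm4])
  have cont1: "continuous_on D (\<lambda>s. log_euler_factor chi s p)" if p: "prime p" and dc: "dirichlet_character q chi" for p q chi
    unfolding log_euler_factor_def
    using norm_log_euler_factor(3)[OF dc p D] prime_gt_0_nat[OF p]
    by (intro continuous_on_Ln continuous_intros) auto
  show "continuous_on D (\<lambda>s. \<Sum>p. log_quotient_term psi chi p s)"
  proof (rule uniform_limit_theorem[OF _ ul])
    have "continuous_on D (\<lambda>s. log_quotient_term psi chi p s)" for p
      using cont1[OF _ dcp, of p] cont1[OF _ dc, of p]
      by (cases "prime p") (auto simp: log_quotient_term_def intro: continuous_intros)
    then show "\<forall>\<^sub>F N in sequentially. continuous_on D (\<lambda>s. \<Sum>p<N. log_quotient_term psi chi p s)"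
      by (intro always_eventually allI continuous_on_sum) auto
  qed simp
  assume s: "s \<in> D"
  have "cmod (\<Sum>p. log_quotient_term psi chi p s) \<le> (\<Sum>p. 4 * prime_tail y p)"
    by (rule norm_suminf_le[OF bound[OF s] sm4])
  also have "\<dots> = 4 * (\<Sum>p. prime_tail y p)" using sm by (rule suminf_mult)
  also have "(\<Sum>p. prime_tail y p) \<le> 8" by (rule suminf_le_const[OF sm prime_tail_sum_le[OF y]])
  finally show "cmod (\<Sum>p. log_quotient_term psi chi p s) \<le> 32" by simp
  define Ep where "Ep P = (\<Prod>p\<in>{p. prime p \<and> p \<le> P}. 1 - psi (int p) / of_nat p powr s)" for P
  define Ec where "Ec P = (\<Prod>p\<in>{p. prime p \<and> p \<le> P}. 1 - chi (int p) / of_nat p powr s)" for P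
  let ?Lp = "L_series psi s" and ?Lc = "L_series chi s"
  have nz: "?Lp \<noteq> 0" "?Lc \<noteq> 0" using L_series_nonzero dcp dc D[OF s] by blast+
  have fin: "finite {p::nat. prime p \<and> p \<le> P}" for P by simp
  have Ec0: "Ec P \<noteq> 0" for P
  proof -
    have "1 - chi (int p) / of_nat p powr s \<noteq> 0" if "prime p" for p
      using norm_log_euler_factor(3)[OF dc that D[OF s]] by (metis nonpos_Reals_zero_I)
    then show ?thesis unfolding Ec_def prod_zero_iff[OF fin] by blast
  qed
  have "exp (\<Sum>p<Suc P. log_quotient_term psi chi p s) = Ep P / Ec P" for P
  proof -
    have "(\<Sum>p<Suc P. log_quotient_term psi chi p s)
        = (\<Sum>p\<in>{p. prime p \<and> p \<le> P}. log_euler_factor psi s p - log_euler_factor chi s p)"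
      by (rule sum.mono_neutral_cong_right) (auto simp: log_quotient_term_def)
    then have "exp (\<Sum>p<Suc P. log_quotient_term psi chi p s)
        = (\<Prod>p\<in>{p. prime p \<and> p \<le> P}. exp (log_euler_factor psi s p) / exp (log_euler_factor chi s p))"
      by (simp only: exp_sum[OF fin] exp_diff)
    also have "\<dots> = (\<Prod>p\<in>{p. prime p \<and> p \<le> P}. (1 - psi (int p) / of_nat p powr s) / (1 - chi (int p) / of_nat p powr s))"
      using norm_log_euler_factor(2)[OF dcp _ D[OF s]] norm_log_euler_factor(2)[OF dc _ D[OF s]]
      by (intro prod.cong) auto
    finally show ?thesis by (simp add: Ep_def Ec_def prod_dividef)
  qed
  \<comment> \<open>Each finite product is paired with its series, so that numerator and denominator
    both tend to 1.\<close>
  then have eq: "exp (\<Sum>p<Suc P. log_quotient_term psi chi p s) = (Ep P * ?Lp) / (Ec P * ?Lc) * (?Lc / ?Lp)" for P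
    using nz Ec0[of P] by simp
  have "(\<lambda>P. (Ep P * ?Lp) / (Ec P * ?Lc) * (?Lc / ?Lp)) \<longlonglongrightarrow> 1 / 1 * (?Lc / ?Lp)"
    unfolding Ep_def Ec_def
    by (intro tendsto_intros L_series_euler[OF dcp D[OF s]] L_series_euler[OF dc D[OF s]]) auto
  then have "(\<lambda>P. exp (\<Sum>p<Suc P. log_quotient_term psi chi p s)) \<longlonglongrightarrow> ?Lc / ?Lp" using eq by simp
  moreover have "summable (\<lambda>p. log_quotient_term psi chi p s)"
    by (rule summable_comparison_test'[OF sm4]) (use bound[OF s] in auto)
  then have "(\<lambda>P. \<Sum>p<P. log_quotient_term psi chi p s) \<longlonglongrightarrow> (\<Sum>p. log_quotient_term psi chi p s)"
    by (rule summable_LIMSEQ)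
  then have "(\<lambda>P. exp (\<Sum>p<Suc P. log_quotient_term psi chi p s)) \<longlonglongrightarrow> exp (\<Sum>p. log_quotient_term psi chi p s)"
    by (intro tendsto_exp filterlim_compose[OF _ filterlim_Suc])
  ultimately show "exp (\<Sum>p. log_quotient_term psi chi p s) = ?Lc / ?Lp" using LIMSEQ_unique by blast
qed

section \<open>Two tools from complex analysis\<close>

text \<open>With g = f - f(\<xi>) and Re g < A', the function g / (2 A' - g) maps into the unit disc
  and vanishes at the centre, so Schwarz's lemma applies. The 1 added in A' makes the bound on Re g
  strict and A' positive.\<close>

lemma Borel_Caratheodory:
  assumes holo: "f holomorphic_on ball \<xi> R" and R: "0 < R" and z: "cmod (z - \<xi>) \<le> r" "r < R"
    and A: "\<And>w. w \<in> ball \<xi> R \<Longrightarrow> Re (f w) \<le> A" and C: "cmod (f \<xi>) \<le> C" and pos: "A + C \<ge> 0"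
  shows "cmod (f z) \<le> 2 * (A + C + 1) * r / (R - r) + C"
proof -
  define A' where "A' = A + C + 1"
  have A': "A' > 0" using pos by (simp add: A'_def)
  have r0: "r \<ge> 0" using z(1) norm_ge_zero order_trans by blast
  define g where "g w = f w - f \<xi>" for w
  have Reg: "Re (g w) < A'" if "w \<in> ball \<xi> R" for w
    using A[OF that] C abs_Re_le_cmod[of "f \<xi>"] by (simp add: g_def A'_def)
  have den: "2 * of_real A' - g w \<noteq> 0" if "w \<in> ball \<xi> R" for w
  proof
    assume "2 * of_real A' - g w = 0"
    then have "Re (g w) = 2 * A'" by (simp add: complex_eq_iff)
    then show False using Reg[OF that] A' by simp
  qed
  define h where "h \<zeta> = g (\<xi> + of_real R * \<zeta>) / (2 * of_real A' - g (\<xi> + of_real R * \<zeta>))" for \<zeta>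
  have inb: "\<xi> + of_real R * \<zeta> \<in> ball \<xi> R" if "cmod \<zeta> < 1" for \<zeta>
    using that R by (simp add: dist_norm norm_mult)
  have "h holomorphic_on ball 0 1"
  proof -
    have "(\<lambda>\<zeta>. f (\<xi> + of_real R * \<zeta>)) holomorphic_on ball 0 1"
      by (rule holomorphic_on_compose_gen[OF _ holo, unfolded comp_def])
        (auto intro!: holomorphic_intros inb)
    then show ?thesis unfolding h_def using den inb
      by (intro holomorphic_intros) (auto simp: g_def intro!: holomorphic_intros)
  qed
  moreover have "h 0 = 0" by (simp add: h_def g_def)
  moreover have "cmod (h \<zeta>) < 1" if "cmod \<zeta> < 1" for \<zeta>
  proof -
    define v where "v = g (\<xi> + of_real R * \<zeta>)"
    have v: "Re v < A'" "2 * of_real A' - v \<noteq> 0" unfolding v_def using Reg den inb[OF that] by auto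
    have "(cmod v)\<^sup>2 < (cmod (2 * of_real A' - v))\<^sup>2"
    proof -
      have "(cmod (2 * of_real A' - v))\<^sup>2 - (cmod v)\<^sup>2 = 4 * A' * (A' - Re v)"
        unfolding cmod_power2 by (simp add: power2_eq_square algebra_simps)
      then show ?thesis using v A' by (smt (verit) mult_pos_pos)
    qed
    then have "cmod v < cmod (2 * of_real A' - v)" by (rule power2_less_imp_less) simp
    then show ?thesis using v(2) by (simp add: h_def v_def[symmetric] norm_divide)
  qed
  ultimately have schwarz: "cmod (h \<zeta>) \<le> cmod \<zeta>" if "cmod \<zeta> < 1" for \<zeta>
    using Schwarz_Lemma(1)[of h \<zeta>] that by blast
  define \<zeta> where "\<zeta> = (z - \<xi>) / of_real R"
  define \<theta> where "\<theta> = r / R"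
  have \<theta>: "0 \<le> \<theta>" "\<theta> < 1" using z R r0 by (auto simp: \<theta>_def)
  have n\<zeta>: "cmod \<zeta> \<le> \<theta>" using z R by (simp add: \<zeta>_def \<theta>_def norm_divide divide_right_mono)
  define u where "u = h \<zeta>"
  have u: "cmod u \<le> \<theta>" using schwarz[of \<zeta>] n\<zeta> \<theta> by (simp add: u_def)
  have zz: "\<xi> + of_real R * \<zeta> = z" using R by (simp add: \<zeta>_def)
  have "z \<in> ball \<xi> R" using z by (simp add: dist_norm norm_minus_commute)
  then have "u * (2 * of_real A' - g z) = g z" using den by (simp add: u_def h_def zz)
  then have "g z = u * (2 * of_real A') - u * g z" by (simp add: algebra_simps)
  then have "cmod (g z) \<le> cmod (u * (2 * of_real A')) + cmod (u * g z)"
    by (metis norm_triangle_ineq4)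
  also have "\<dots> \<le> \<theta> * (2 * A') + \<theta> * cmod (g z)"
    using u A' by (intro add_mono) (auto simp: norm_mult mult_right_mono)
  finally have "(1 - \<theta>) * cmod (g z) \<le> \<theta> * (2 * A')" by (simp add: algebra_simps)
  then have "cmod (g z) \<le> \<theta> * (2 * A') / (1 - \<theta>)" using \<theta> by (simp add: field_simps)
  also have "\<dots> = 2 * A' * r / (R - r)" using R z by (simp add: \<theta>_def field_simps)
  finally have "cmod (g z) \<le> 2 * A' * r / (R - r)" .
  moreover have "cmod (f z) \<le> cmod (g z) + cmod (f \<xi>)"
    using norm_triangle_ineq[of "g z" "f \<xi>"] by (simp add: g_def)
  ultimately show ?thesis using C by (simp add: A'_def)
qed

text \<open>Maximum principle for f(w) / (w - \<xi>)^k on the annulus. An integer exponent avoids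
  multivalued powers; the optimal real exponent is only rounded.\<close>

lemma three_circles:
  assumes holo: "f holomorphic_on U" "open U" "cball \<xi> r3 \<subseteq> U" and r: "0 < r1" "r1 < cmod (z - \<xi>)" "cmod (z - \<xi>) < r3"
    and inner: "\<And>w. cmod (w - \<xi>) = r1 \<Longrightarrow> cmod (f w) \<le> M * r1 ^ k"
    and outer: "\<And>w. cmod (w - \<xi>) = r3 \<Longrightarrow> cmod (f w) \<le> M * r3 ^ k"
  shows "cmod (f z) \<le> M * cmod (z - \<xi>) ^ k"
proof -
  define S where "S = ball \<xi> r3 - cball \<xi> r1"
  define G where "G w = f w / (w - \<xi>) ^ k" for w
  have opn: "open S" unfolding S_def by (intro open_Diff) auto
  have cl: "closure S \<subseteq> cball \<xi> r3 - ball \<xi> r1"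
    by (rule closure_minimal) (auto simp: S_def intro: closed_Diff)
  have "G holomorphic_on (U - {\<xi>})"
    unfolding G_def using holo(1) by (intro holomorphic_intros holomorphic_on_subset[OF holo(1)]) auto
  moreover have sub: "closure S \<subseteq> U - {\<xi>}" using cl holo(3) r(1) by auto
  ultimately have hol: "G holomorphic_on closure S" by (rule holomorphic_on_subset)
  have "cmod (G z) \<le> M"
  proof (rule maximum_modulus_frontier[where S = S and f = G and \<xi> = z])
    show "G holomorphic_on interior S" using hol interior_subset closure_subset by (meson holomorphic_on_subset order_trans)
    show "continuous_on (closure S) G" using hol by (rule holomorphic_on_imp_continuous_on)
    show "bounded S" unfolding S_def by (rule bounded_subset[OF bounded_ball]) auto
    show "z \<in> S" using r by (auto simp: S_def dist_norm norm_minus_commute)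
    fix w assume "w \<in> frontier S"
    then have "w \<in> closure S" "w \<notin> S" using opn by (auto simp: frontier_def interior_open)
    then have "cmod (w - \<xi>) = r1 \<or> cmod (w - \<xi>) = r3"
      using cl by (auto simp: S_def dist_norm norm_minus_commute)
    then show "cmod (G w) \<le> M"
    proof
      assume e: "cmod (w - \<xi>) = r1"
      then show ?thesis using inner[OF e] r(1) by (simp add: G_def norm_divide norm_power field_simps)
    next
      assume e: "cmod (w - \<xi>) = r3"
      have "r3 > 0" using r by linarith
      then show ?thesis using outer[OF e] e by (simp add: G_def norm_divide norm_power field_simps)
    qed
  qed
  moreover have "z \<noteq> \<xi>" using r by auto
  ultimately show ?thesis by (simp add: G_def norm_divide norm_power field_simps)
qed

section \<open>The bound at 1\<close>

text \<open>The Euler product covers Re s > 1 and the hypothesis covers Re s < 1. The line between,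
  on which the hypothesis is silent, is covered by the 3-4-1 argument and, for a real character at
  the point 1, by the Lambert series.\<close>

lemma L_series_zero_free:
  assumes grh: generalized_riemann_hypothesis
    and dc: "dirichlet_character q chi" and u: "coprime u (int q)" "chi u \<noteq> 1"
    and s: "Re s > 1 / 2" "\<bar>Im s\<bar> \<le> 2"
  shows "L_series chi s \<noteq> 0"
proof -
  consider "Re s > 1" | "Re s = 1" | "Re s < 1" by linarith
  then show ?thesis
  proof cases
    case 1
    then show ?thesis using L_series_nonzero[OF dc] by blast
  next
    case 2
    then have sc: "s = Complex 1 (Im s)" by (simp add: complex_eq_iff)
    show ?thesis
    proof (cases "(\<exists>v. coprime v (int q) \<and> (chi v)\<^sup>2 \<noteq> 1) \<or> Im s \<noteq> 0")
      case True
      then show ?thesis using L_series_nonzero_line[OF dc u, of "Im s"] s(2) sc by metis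
    next
      case False
      then have "s = 1" using 2 by (simp add: complex_eq_iff)
      then show ?thesis using L_series_nonzero_real[OF dc u] False by blast
    qed
  next
    case 3
    have "dirichlet_L chi s = L_series chi s"
      by (rule dirichlet_L_eq_series[OF nonprincipal_partial_sums[OF dc u]]) (use s in simp)
    moreover have "dirichlet_L chi s \<noteq> 0"
    proof
      assume "dirichlet_L chi s = 0"
      moreover have "0 < Re s" using s by simp
      ultimately have "Re s = 1 / 2" using grh dc 3 unfolding generalized_riemann_hypothesis_def by blast
      then show False using s by simp
    qed
    ultimately show ?thesis by simp
  qed
qed

text \<open>
  The bound \<open>O(1)\<close> on the circle of radius \<open>1 - 1 / ln y\<close> around \<open>2\<close> and the bound \<open>O(y)\<close> on a larger one
  are interpolated at \<open>1\<close>, at the cost of a factor \<open>y powr O(1 / ln y) = O(1)\<close> only.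
\<close>

lemma L_series_at_1_bounded:
  assumes grh: generalized_riemann_hypothesis
    and dcp: "dirichlet_character b psi" and v: "coprime v (int b)" "psi v \<noteq> 1" and C: "C > 0"
  shows "\<exists>K. \<forall>q chi u y. dirichlet_character q chi \<longrightarrow> coprime u (int q) \<longrightarrow> chi u \<noteq> 1 \<longrightarrow>
      (\<forall>n. 0 < n \<longrightarrow> n \<le> y \<longrightarrow> chi (int n) = psi (int n)) \<longrightarrow> y \<ge> 8 \<longrightarrow>
      ln (real q) \<le> C * real y \<longrightarrow> cmod (L_series chi 1) \<le> K"
proof -
  \<comment> \<open>Open and convex, so nonvanishing holomorphic functions have logarithms on it. It
    contains the discs around 2 of radii 1 - \<eta> < 13/10 < 7/5; the second radius must exceed 1,
    the third stay below 3/2.\<close>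
  define U where "U = {s. Re s > 1 / 2} \<inter> {s. Im s < 2} \<inter> {s. Im s > - 2}"
  have U_iff: "s \<in> U \<longleftrightarrow> Re s > 1 / 2 \<and> Im s < 2 \<and> Im s > - 2" for s by (auto simp: U_def)
  have U_open: "open U"
    unfolding U_def by (intro open_Int open_halfspace_Re_gt open_halfspace_Im_gt open_halfspace_Im_lt)
  have U_convex: "convex U"
    unfolding U_def by (intro convex_Int convex_halfspace_Re_gt convex_halfspace_Im_gt convex_halfspace_Im_lt)
  have ball: "Re s \<ge> 3/5 \<and> s \<in> U" if "s \<in> cball 2 (7/5)" for s
  proof -
    have "cmod (2 - s) \<le> 7/5" using that by (simp add: dist_norm)
    then have "\<bar>Re (2 - s)\<bar> \<le> 7/5" "\<bar>Im (2 - s)\<bar> \<le> 7/5"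
      using abs_Re_le_cmod[of "2 - s"] abs_Im_le_cmod[of "2 - s"] by linarith+
    moreover have "2 - Re s \<le> \<bar>Re (2 - s)\<bar>" "\<bar>Im (2 - s)\<bar> = \<bar>Im s\<bar>" by simp_all
    ultimately have "2 - Re s \<le> 7/5" "\<bar>Im s\<bar> \<le> 7/5" by linarith+
    then show ?thesis unfolding U_iff by linarith
  qed
  interpret psi: bounded_partial_sums "\<lambda>n. psi (int (Suc n))" "real b"
    by unfold_locales (rule nonprincipal_partial_sums[OF dcp v])
  have psi_holo: "L_series psi holomorphic_on U"
    by (rule holomorphic_on_subset[OF psi.dirichlet_series_holomorphic]) (auto simp: U_iff)
  have psi_nz: "L_series psi s \<noteq> 0" if "s \<in> U" for s
    using that by (intro L_series_zero_free[OF grh dcp v]) (auto simp: U_iff)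
  have "compact (cball (2::complex) (7/5))" by simp
  moreover have "continuous_on (cball 2 (7/5)) (\<lambda>s. inverse (cmod (L_series psi s)))"
  proof (intro continuous_intros ballI)
    show "continuous_on (cball 2 (7/5)) (L_series psi)"
      by (rule holomorphic_on_imp_continuous_on[OF holomorphic_on_subset[OF psi_holo]]) (use ball in blast)
    show "cmod (L_series psi s) \<noteq> 0" if "s \<in> cball 2 (7/5)" for s
      using psi_nz ball[OF that] by simp
  qed
  ultimately have "bounded ((\<lambda>s. inverse (cmod (L_series psi s))) ` cball 2 (7/5))"
    by (intro compact_imp_bounded compact_continuous_image)
  then obtain m where "\<forall>x\<in>(\<lambda>s. inverse (cmod (L_series psi s))) ` cball 2 (7/5). norm x \<le> m"
    unfolding bounded_iff by blast
  then have m: "inverse (cmod (L_series psi s)) \<le> m" if "s \<in> cball 2 (7/5)" for s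
    using that by fastforce
  define m' where "m' = max m 1"
  have m': "m' \<ge> 1" "\<And>s. s \<in> cball 2 (7/5) \<Longrightarrow> inverse (cmod (L_series psi s)) \<le> m'"
    unfolding m'_def by (simp, rule order.trans[OF m max.cobounded1])
  \<comment> \<open>On the disc of radius 7/5 the series of chi is at most 10 q and the reciprocal
    of that of psi at most m', so the real part of the logarithm is at most ln q + K0.\<close>
  define K0 where "K0 = ln (10 * m')"
  have K0: "K0 \<ge> 0" using m'(1) by (simp add: K0_def)
  define K1 where \<comment> \<open>\<open>K1 * y\<close> bounds the logarithm on the outer circle\<close>
    "K1 = 26 * (C + K0 + 33) + 32"
  have K1: "K1 \<ge> 1" using C K0 by (simp add: K1_def)
  define c where "c = ln (13/10 :: real)"
  have c: "c > 0" by (simp add: c_def)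
  \<comment> \<open>A bound for \<eta> k when (13/10)^k is about K1 y. On the inner circle (1 -
    \<eta>)^k is then at least exp(-2 K2), which explains K3.\<close>
  define K2 where "K2 = 1 + (ln K1 + 1) / c"
  define K3 where "K3 = max 1 (32 * exp (2 * K2))"
  have key: "cmod (L_series chi 1) \<le> cmod (L_series psi 1) * exp K3"
    if dc: "dirichlet_character q chi" and u: "coprime u (int q)" "chi u \<noteq> 1"
      and agree: "\<And>n. 0 < n \<Longrightarrow> n \<le> y \<Longrightarrow> chi (int n) = psi (int n)" and y: "y \<ge> 8" and lnq: "ln (real q) \<le> C * real y"
    for q chi u y
  proof -
    interpret chi: bounded_partial_sums "\<lambda>n. chi (int (Suc n))" "real q"
      by unfold_locales (rule nonprincipal_partial_sums[OF dc u])
    have q: "q > 0" using dc by (simp add: dirichlet_character_def)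
    define \<eta> where "\<eta> = 1 / ln (real y)"
    \<comment> \<open>From y \<ge> 8 comes \<eta> \<le> 1/2, the range in which 1 - \<eta> is at
      least exp(-2 \<eta>).\<close>
    have "exp (2::real) \<le> 8"
    proof -
      have "exp (2::real) = exp 1 * exp 1" by (simp add: exp_add[symmetric])
      also have "\<dots> \<le> (272/100) * (272/100)" using e_less_272 by (intro mult_mono) auto
      finally show ?thesis by simp
    qed
    also have "\<dots> \<le> real y" using y by simp
    finally have lny: "2 \<le> ln (real y)" using y by (simp add: ln_ge_iff)
    then have \<eta>: "0 < \<eta>" "\<eta> \<le> 1/2" "\<eta> * ln (real y) = 1" by (auto simp: \<eta>_def field_simps)
    define Q where "Q s = L_series chi s / L_series psi s" for s
    have "Q holomorphic_on U" unfolding Q_def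
      using psi_nz by (intro holomorphic_intros psi_holo holomorphic_on_subset[OF chi.dirichlet_series_holomorphic]) (auto simp: U_iff)
    moreover have "Q s \<noteq> 0" if "s \<in> U" for s
    proof -
      have "L_series chi s \<noteq> 0" using that by (intro L_series_zero_free[OF grh dc u]) (auto simp: U_iff)
      then show ?thesis unfolding Q_def using psi_nz[OF that] by simp
    qed
    moreover have two_U: "2 \<in> U" by (simp add: U_iff)
    ultimately obtain F where F: "F holomorphic_on U" "\<And>s. s \<in> U \<Longrightarrow> exp (F s) = Q s"
      using holomorphic_logarithm_exists[OF U_convex U_open] by metis
    define E where "E s = (\<Sum>p. log_quotient_term psi chi p s)" for s
    let ?B = "cball (2::complex) (1 - \<eta>)"
    have BD: "Re s \<ge> 1 + 1 / ln (real y)" if "s \<in> ?B" for s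
    proof -
      have "Re (2 - s) \<le> cmod (2 - s)" by (rule complex_Re_le_cmod)
      then show ?thesis using that by (simp add: dist_norm \<eta>_def)
    qed
    have BU: "?B \<subseteq> U"
    proof
      fix s assume "s \<in> ?B"
      then have "s \<in> cball 2 (7/5)" using \<eta> by simp
      then show "s \<in> U" using ball by blast
    qed
    note lq = log_quotient[OF dcp dc agree y]
    have E_cont: "continuous_on ?B E"
      unfolding E_def by (rule continuous_on_subset[OF lq(1)]) (use BD in auto)
    have E_bound: "cmod (E s) \<le> 32" "exp (E s) = Q s" if "s \<in> ?B" for s
      using lq(2,3)[of s] BD[OF that] by (auto simp: E_def Q_def)
    \<comment> \<open>The holomorphic logarithm and the one from the Euler product differ by a
      continuous function with values in 2 pi i Z. Subtracting this constant gives the branch that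
      is small on the inner disc.\<close>
    have "(\<lambda>s. F s - E s) constant_on ?B"
    proof (rule continuous_discrete_range_constant)
      show "continuous_on ?B (\<lambda>s. F s - E s)"
        using holomorphic_on_imp_continuous_on[OF holomorphic_on_subset[OF F(1) BU]] E_cont
        by (intro continuous_intros)
      have mult: "\<exists>n::int. F s - E s = 2 * of_int n * of_real pi * \<i>" if "s \<in> ?B" for s
      proof -
        have "exp (F s - E s) = 1" using F(2) E_bound(2)[OF that] BU that by (auto simp: exp_diff)
        then have "Re (F s - E s) = 0 \<and> (\<exists>n::int. Im (F s - E s) = of_int (2 * n) * pi)"
          by (simp only: exp_eq_1)
        then obtain n :: int where "Re (F s - E s) = 0" "Im (F s - E s) = of_int (2 * n) * pi" by blast
        then show ?thesis by (intro exI[of _ n]) (simp add: complex_eq_iff)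
      qed
      fix s assume s: "s \<in> ?B"
      show "\<exists>e>0. \<forall>w. w \<in> ?B \<and> F w - E w \<noteq> F s - E s \<longrightarrow> e \<le> cmod (F w - E w - (F s - E s))"
      proof (intro exI[of _ "2 * pi"] conjI allI impI)
        fix w assume w: "w \<in> ?B \<and> F w - E w \<noteq> F s - E s"
        obtain n n' :: int where n: "F s - E s = 2 * of_int n * of_real pi * \<i>" "F w - E w = 2 * of_int n' * of_real pi * \<i>"
          using mult s w by meson
        have "n' \<noteq> n" using n w by auto
        then have "\<bar>real_of_int (n' - n)\<bar> \<ge> 1" by linarith
        then have "2 * pi * 1 \<le> 2 * pi * \<bar>real_of_int (n' - n)\<bar>" by (intro mult_left_mono) auto
        also have "\<dots> = cmod (2 * of_real pi * of_int (n' - n) * \<i>)" by (simp only: norm_mult norm_of_int) simp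
        also have "2 * of_real pi * of_int (n' - n) * \<i> = F w - E w - (F s - E s)"
          unfolding n by (simp add: algebra_simps)
        finally show "2 * pi \<le> cmod (F w - E w - (F s - E s))" by simp
      qed simp
    qed simp
    then obtain \<kappa> where \<kappa>: "\<And>s. s \<in> ?B \<Longrightarrow> F s - E s = \<kappa>" by (auto simp: constant_on_def)
    have two: "(2::complex) \<in> ?B" using \<eta> by simp
    have exp\<kappa>: "exp \<kappa> = 1"
    proof -
      have "exp (F 2) = exp (E 2)" using F(2)[OF two_U] E_bound(2)[OF two] by simp
      then show ?thesis unfolding \<kappa>[OF two, symmetric] exp_diff by simp
    qed
    define f where "f s = F s - \<kappa>" for s
    have f_holo: "f holomorphic_on U" unfolding f_def by (intro holomorphic_intros F)
    have f_exp: "exp (f s) = Q s" if "s \<in> U" for s using F(2)[OF that] by (simp add: f_def exp_diff exp\<kappa>)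
    have f_in: "cmod (f s) \<le> 32" if "s \<in> ?B" for s
    proof -
      have "f s = E s" unfolding f_def \<kappa>[OF that, symmetric] by simp
      then show ?thesis using E_bound(1)[OF that] by simp
    qed
    have f_Re: "Re (f s) \<le> K0 + C * real y" if s: "s \<in> ball 2 (7/5)" for s
    proof -
      have sb: "s \<in> cball 2 (7/5)" using s by simp
      then have sU: "s \<in> U" and sR: "Re s \<ge> 3/5" using ball by auto
      have "cmod s \<le> cmod 2 + cmod (2 - s)" by (metis norm_minus_commute norm_triangle_sub)
      then have ns: "cmod s \<le> 17/5" using sb by (simp add: dist_norm)
      have "exp (Re (f s)) = cmod (Q s)" using f_exp[OF sU] by (metis norm_exp_eq_Re)
      also have "\<dots> = cmod (L_series chi s) * inverse (cmod (L_series psi s))"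
        by (simp only: Q_def norm_divide) (simp only: divide_inverse)
      also have "\<dots> \<le> (real q * 10) * m'"
      proof (rule mult_mono)
        have "cmod (L_series chi s) \<le> real q * cmod s * (1 + 1 / Re s)"
          using sR by (intro chi.norm_dirichlet_series_le) simp
        also have "\<dots> \<le> real q * (17/5) * (1 + 1 / (3/5))"
          using ns sR by (intro mult_mono add_mono divide_left_mono) auto
        also have "\<dots> \<le> real q * 10" by simp
        finally show "cmod (L_series chi s) \<le> real q * 10" .
      qed (use m'(2)[OF sb] m'(1) in auto)
      finally have "Re (f s) \<le> ln (real q * 10 * m')"
        using q m'(1) by (metis exp_gt_zero ln_exp ln_mono order_less_le_trans)
      also have "\<dots> = ln (real q) + K0" using q m'(1) unfolding K0_def by (simp add: ln_mult)
      finally show ?thesis using lnq by simp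
    qed
    have y1: "real y \<ge> 1" using y by simp
    \<comment> \<open>Borel-Caratheodory with r = 13/10 and R = 7/5, where 2 r / (R - r) =
      26.\<close>
    have f_out: "cmod (f s) \<le> K1 * real y" if s: "cmod (s - 2) \<le> 13/10" for s
    proof -
      have "cmod (f s) \<le> 2 * (K0 + C * real y + 32 + 1) * (13/10) / (7/5 - 13/10) + 32"
      proof (rule Borel_Caratheodory[OF _ _ s _ f_Re])
        show "f holomorphic_on ball 2 (7/5)" by (rule holomorphic_on_subset[OF f_holo]) (use ball in force)
        show "cmod (f 2) \<le> 32" by (rule f_in[OF two])
        show "0 \<le> K0 + C * real y + 32" using K0 C by simp
      qed auto
      also have "\<dots> = 26 * (K0 + C * real y + 33) + 32" by simp
      also have "\<dots> \<le> K1 * real y"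
      proof -
        have "26 * K0 * 1 \<le> 26 * K0 * real y" "(26 * 33 + 32) * 1 \<le> (26 * 33 + 32) * real y"
          using K0 y1 by (intro mult_left_mono; simp)+
        then show ?thesis unfolding K1_def by (simp add: algebra_simps)
      qed
      finally show ?thesis .
    qed
    \<comment> \<open>The least exponent for which (13/10)^k reaches K1 y, so the outer bound holds
      with a constant; it is O(ln y), which keeps \<eta> k bounded.\<close>
    define k where "k = nat \<lceil>ln (K1 * real y) / c\<rceil>"
    have Ky: "K1 * real y \<ge> 1" using mult_mono[OF K1 y1] K1 by simp
    have k1: "ln (K1 * real y) / c \<le> real k" unfolding k_def using real_nat_ceiling_ge by blast
    have "real k < ln (K1 * real y) / c + 1"
    proof -
      have "ln (K1 * real y) / c \<ge> 0" using Ky c by simp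
      then have "real k = of_int \<lceil>ln (K1 * real y) / c\<rceil>" unfolding k_def by simp
      then show ?thesis using ceiling_correct[of "ln (K1 * real y) / c"] by linarith
    qed
    then have k2: "\<eta> * real k \<le> K2"
    proof -
      assume k: "real k < ln (K1 * real y) / c + 1"
      have "\<eta> * real k \<le> \<eta> * (ln (K1 * real y) / c + 1)" using k \<eta> by (intro mult_left_mono) auto
      also have "\<dots> = (\<eta> * ln K1 + \<eta> * ln (real y)) / c + \<eta>"
        using K1 y1 c by (simp add: ln_mult field_simps)
      also have "\<dots> \<le> (1 * ln K1 + 1) / c + 1"
        using \<eta> c K1 by (intro add_mono divide_right_mono mult_right_mono) auto
      finally show ?thesis by (simp add: K2_def)
    qed
    \<comment> \<open>The point 1 has distance exactly 1 from the centre, so the power contributes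
      nothing.\<close>
    have "cmod (f 1) \<le> K3 * cmod (1 - 2) ^ k"
    proof (rule three_circles[OF f_holo U_open])
      show "cball 2 (13/10) \<subseteq> U"
      proof
        fix s :: complex assume "s \<in> cball 2 (13/10)"
        then have "s \<in> cball 2 (7/5)" by simp
        then show "s \<in> U" using ball by blast
      qed
      show "0 < 1 - \<eta>" "1 - \<eta> < cmod (1 - 2)" using \<eta> by auto
      show "cmod (1 - 2 :: complex) < 13/10" by simp
      fix w :: complex
      show "cmod (f w) \<le> K3 * (1 - \<eta>) ^ k" if w: "cmod (w - 2) = 1 - \<eta>"
      proof -
        have "cmod (f w) \<le> 32" using w by (intro f_in) (simp add: dist_norm norm_minus_commute)
        also have "32 \<le> K3 * (1 - \<eta>) ^ k"
        proof -
          have "exp (- 2 * \<eta>) \<le> 1 - \<eta>"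
            using one_minus_exp_ge[of "2 * \<eta>"] \<eta> by simp
          then have "exp (- 2 * \<eta>) ^ k \<le> (1 - \<eta>) ^ k" by (intro power_mono) auto
          moreover have "exp (- 2 * \<eta>) ^ k = exp (- (2 * (\<eta> * real k)))" by (simp add: exp_of_nat_mult[symmetric] mult_ac)
          moreover have "exp (- (2 * (\<eta> * real k))) \<ge> exp (- (2 * K2))" using k2 by simp
          ultimately have ge: "(1 - \<eta>) ^ k \<ge> exp (- (2 * K2))" by linarith
          have "32 = 32 * exp (2 * K2) * exp (- (2 * K2))" by (simp add: exp_add[symmetric] mult.assoc)
          also have "\<dots> \<le> K3 * (1 - \<eta>) ^ k" using ge by (intro mult_mono) (auto simp: K3_def)
          finally show ?thesis .
        qed
        finally show ?thesis .
      qed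
      show "cmod (f w) \<le> K3 * (13/10) ^ k" if w: "cmod (w - 2) = 13/10"
      proof -
        have "cmod (f w) \<le> K1 * real y" using w by (intro f_out) simp
        also have "\<dots> = exp (ln (K1 * real y))" using Ky by simp
        also have "\<dots> \<le> exp (c * real k)" using k1 c by (simp add: field_simps)
        also have "\<dots> = (13/10) ^ k" by (simp add: c_def mult.commute exp_of_nat_mult)
        also have "\<dots> \<le> K3 * (13/10) ^ k" using mult_right_mono[of 1 K3 "(13/10) ^ k"] by (simp add: K3_def)
        finally show ?thesis .
      qed
    qed
    then have f1: "cmod (f 1) \<le> K3" by simp
    have one: "(1::complex) \<in> U" by (simp add: U_iff)
    have "cmod (L_series chi 1) = cmod (L_series psi 1) * cmod (exp (f 1))"
      unfolding f_exp[OF one] Q_def using psi_nz[OF one] by (simp add: norm_divide)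
    also have "cmod (exp (f 1)) \<le> exp K3" unfolding norm_exp_eq_Re using f1 complex_Re_le_cmod[of "f 1"] by simp
    finally show ?thesis by (simp add: mult_left_mono)
  qed
  show ?thesis
    by (intro exI[of _ "cmod (L_series psi 1) * exp K3"] allI impI, rule key) auto
qed

section \<open>Construction of the characters\<close>

text \<open>Every prime of \<open>s\<close> exceeds y \<ge> b, so the moduli are coprime:
  primitivity and order pass to the product, and the odd quadratic factor reverses the
  parity.\<close>

lemma character_construction:
  assumes prim: "primitive_character b psi" and y: "y \<ge> b" "y \<ge> 2"
  obtains q chi where "primitive_character q chi" "chi (-1) = - psi (-1)"
    "character_order q chi = lcm 2 (character_order b psi)"
    "\<And>n. 0 < n \<Longrightarrow> n \<le> y \<Longrightarrow> chi (int n) = psi (int n)"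
    "y < q" "ln (real q) \<le> (ln (real b) + 2 * ln 4) * real y"
proof -
  have dcp: "dirichlet_character b psi" using prim by (simp add: primitive_character_def)
  have b: "b > 0" using dcp by (simp add: dirichlet_character_def)
  obtain s where s: "odd s" "squarefree s" "s > 1" "s \<le> 4 ^ Suc y"
    "\<And>p. prime p \<Longrightarrow> p \<le> y \<Longrightarrow> \<not> p dvd s"
    "jacobi_char s (-1) = -1" "\<And>n. 0 < n \<Longrightarrow> n \<le> y \<Longrightarrow> jacobi_char s (int n) = 1"
    by (rule jacobi_char_near_trivial[OF y(2)]) (rule that)
  have dcj: "dirichlet_character s (jacobi_char s)" by (rule dirichlet_character_jacobi[OF s(1)])
  have cop: "coprime b s"
  proof (rule ccontr)
    assume "\<not> coprime b s"
    then have "gcd b s \<noteq> 1" by (metis coprime_iff_gcd_eq_1)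
    then obtain p where p: "prime p" "p dvd gcd b s" using prime_factor_nat by blast
    then have "p dvd b" "p dvd s" by auto
    then have "p \<le> y" using dvd_imp_le[of p b] b y(1) by simp
    then show False using s(5)[OF p(1)] \<open>p dvd s\<close> by blast
  qed
  define chi where "chi x = psi x * jacobi_char s x" for x
  \<comment> \<open>The symbol is 1 up to y but -1 at s - 1, which is -1 modulo s.\<close>
  have ys: "y < s"
  proof (rule ccontr)
    assume "\<not> y < s"
    then have "jacobi_char s (int (s - 1)) = 1" using s(3) by (intro s(7)) auto
    moreover have "jacobi_char s (int (s - 1)) = jacobi_char s (-1)"
      using s(3) by (intro dirichlet_character_cong[OF dcj]) (simp add: cong_iff_dvd_diff of_nat_diff)
    ultimately show False using s(6) by simp
  qed
  show ?thesis
  proof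
    show "primitive_character (b * s) chi"
      unfolding chi_def by (rule primitive_character_product[OF prim primitive_character_jacobi[OF s(1,2)] cop])
    show "chi (-1) = - psi (-1)" by (simp add: chi_def s(6))
    show "character_order (b * s) chi = lcm 2 (character_order b psi)"
      unfolding chi_def character_order_product[OF dcp dcj cop] character_order_jacobi[OF s(1,6)]
      by (rule lcm.commute)
    show "chi (int n) = psi (int n)" if "0 < n" "n \<le> y" for n
      using s(7)[OF that] by (simp add: chi_def)
    show "y < b * s" using ys b by (metis less_le_trans mult_le_mono1 mult_1 Suc_leI One_nat_def)
    have "ln (real (b * s)) = ln (real b) + ln (real s)" using b s(3) by (simp add: ln_mult)
    also have "ln (real s) \<le> ln (4 ^ Suc y)"
    proof (rule ln_mono)
      have "real s \<le> real (4 ^ Suc y)" using s(4) by (simp only: of_nat_le_iff)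
      then show "real s \<le> 4 ^ Suc y" by simp
    qed (use s(3) in simp)
    also have "ln (4 ^ Suc y :: real) = (real y + 1) * ln 4" using ln_realpow[of "4::real" "Suc y"] by simp
    also have "\<dots> \<le> (2 * real y) * ln 4" using y(2) by (intro mult_right_mono) auto
    also have "ln (real b) + 2 * real y * ln 4 \<le> ln (real b) * real y + 2 * real y * ln 4"
      using b y(2) mult_left_mono[of 1 "real y" "ln (real b)"] by simp
    finally show "ln (real (b * s)) \<le> (ln (real b) + 2 * ln 4) * real y" by (simp add: algebra_simps)
  qed
qed

lemma norm_char_A_le:
  assumes prim: "primitive_character q chi" and q1: "q > 1"
  shows "cmod (char_A q chi) \<le> cmod (L_series (\<lambda>n. cnj (chi n)) 1) * sqrt (real q)"
proof -
  have dc: "dirichlet_character q chi" using prim by (simp add: primitive_character_def)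
  obtain u where u: "coprime u (int q)" "chi u \<noteq> 1" using primitive_character_nontrivial[OF prim q1] by blast
  have L: "dirichlet_L (\<lambda>n. cnj (chi n)) 1 = L_series (\<lambda>n. cnj (chi n)) 1"
    by (rule dirichlet_L_eq_series[OF nonprincipal_partial_sums[OF dirichlet_character_cnj[OF dc] u(1)]]) (use u in auto)
  have "cmod (1 - chi (-1)) \<le> 2"
    using dirichlet_character_minus_one[OF dc] by auto
  then have "cmod (1 - chi (-1)) / (2 * pi) \<le> 1" using pi_gt3 by (simp add: divide_le_eq)
  then have "cmod (1 - chi (-1)) / (2 * pi) * (sqrt (real q) * cmod (L_series (\<lambda>n. cnj (chi n)) 1))
      \<le> 1 * (sqrt (real q) * cmod (L_series (\<lambda>n. cnj (chi n)) 1))" by (rule mult_right_mono) simp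
  then show ?thesis unfolding char_A_def L
    using norm_gauss_sum[OF prim] by (simp add: norm_mult norm_divide mult_ac)
qed

theorem theorem4:
  fixes b g :: nat and psi :: "int \<Rightarrow> complex"
  assumes "b \<ge> 1"
    and "primitive_character b psi"
    and "character_order b psi = g"
  shows "\<exists>(q :: nat \<Rightarrow> nat) (chi :: nat \<Rightarrow> int \<Rightarrow> complex).
    strict_mono q \<and>
    (\<forall>k. primitive_character (q k) (chi k) \<and>
         chi k (-1) = - psi (-1) \<and>
         character_order (q k) (chi k) = lcm 2 g) \<and>
    (\<exists>(C :: real) (\<epsilon> :: nat \<Rightarrow> real). \<epsilon> \<longlonglongrightarrow> 0 \<and>
      (\<forall>k. \<forall>a :: int. coprime a (int b) \<longrightarrow>
        (\<exists>\<alpha> :: real.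
          \<bar>\<alpha> - real_of_int a / real b\<bar> \<le> C / ln (real (q k)) \<and>
          cmod (char_sum (chi k) (\<alpha> * real (q k)) - char_A (q k) (chi k))
            \<ge> sqrt (real (q k)) / (pi * sqrt (real b)) * (1 + \<epsilon> k) * ln (ln (real (q k)))))) \<and>
    ((\<forall>k. chi k (-1) = -1) \<and> b > 1 \<and> generalized_riemann_hypothesis \<longrightarrow>
      (\<exists>C :: real. \<forall>k. cmod (char_A (q k) (chi k)) \<le> C * sqrt (real (q k))))"
proof -
  note prim = assms(2)
  have dcp: "dirichlet_character b psi" using prim by (simp add: primitive_character_def)
  \<comment> \<open>From ln q \<le> C y. The same C fixes the width of the averaging, so 1 / (C y)
    \<le> 1 / ln q and the implied constant is 1.\<close>
  define C where "C = ln (real b) + 2 * ln 4"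
  have "exp 1 \<le> (4::real)" using exp_le by simp
  then have "ln (4::real) \<ge> 1" by (simp add: ln_ge_iff)
  moreover have "ln (real b) \<ge> 0" using assms(1) by simp
  ultimately have C: "C \<ge> 1" by (simp add: C_def)
  define C1 where "C1 = sqrt (real b) * (8 * real b + 2 * pi / C + C / pi + 1) / 2"
  have C1: "C1 \<ge> 0" using C by (simp add: C1_def)
  obtain y1 :: nat where y1: "exp C1 < real y1" using reals_Archimedean2 by blast
  \<comment> \<open>\<open>b\<close> is needed for coprimality, 8 for the bound at 1, and
    \<open>y1\<close> ensures ln y > C1, which makes 1 + \<epsilon> positive.\<close>
  define y0 where "y0 = max (max b 8) y1"
  have "\<forall>y. \<exists>q chi. y \<ge> y0 \<longrightarrow> primitive_character q chi \<and> chi (-1) = - psi (-1) \<and>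
      character_order q chi = lcm 2 g \<and> (\<forall>n. 0 < n \<longrightarrow> n \<le> y \<longrightarrow> chi (int n) = psi (int n)) \<and>
      y < q \<and> ln (real q) \<le> C * real y"
  proof safe
    fix y
    show "\<exists>q chi. y \<ge> y0 \<longrightarrow> primitive_character q chi \<and> chi (-1) = - psi (-1) \<and>
      character_order q chi = lcm 2 g \<and> (\<forall>n. 0 < n \<longrightarrow> n \<le> y \<longrightarrow> chi (int n) = psi (int n)) \<and>
      y < q \<and> ln (real q) \<le> C * real y"
    proof (cases "y \<ge> y0")
      case True
      then have "y \<ge> b" "y \<ge> 2" by (auto simp: y0_def)
      from character_construction[OF prim this] show ?thesis
        unfolding assms(3) C_def by metis
    qed auto
  qed
  then obtain Q X where QX: "\<And>y. y \<ge> y0 \<Longrightarrow> primitive_character (Q y) (X y) \<and> X y (-1) = - psi (-1) \<and>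
      character_order (Q y) (X y) = lcm 2 g \<and> (\<forall>n. 0 < n \<longrightarrow> n \<le> y \<longrightarrow> X y (int n) = psi (int n)) \<and>
      y < Q y \<and> ln (real (Q y)) \<le> C * real y"
    by metis
  \<comment> \<open>The next y is the previous modulus; since Q y > y, the moduli increase
    strictly.\<close>
  define ys where "ys k = (Q ^^ k) y0" for k
  have ys0: "ys k \<ge> y0 + k" for k
  proof (induction k)
    case (Suc k)
    then have "ys k \<ge> y0" by simp
    then have "ys k < Q (ys k)" using QX by blast
    then show ?case using Suc by (simp add: ys_def)
  qed (simp add: ys_def)
  have ys_ge: "ys k \<ge> y0" for k using ys0[of k] by simp
  note G = QX[OF ys_ge]
  define q where "q k = Q (ys k)" for k
  define chi where "chi k = X (ys k)" for k
  have ysb: "ys k \<ge> 8" "real (ys k) > exp C1" "ys k \<ge> 1" for k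
    using ys_ge[of k] y1 by (auto simp: y0_def)
  have q_mono: "strict_mono q"
  proof (rule strict_mono_Suc_iff[THEN iffD2], rule allI)
    fix k
    have "q k = ys (Suc k)" by (simp add: q_def ys_def)
    also have "\<dots> < q (Suc k)" unfolding q_def using G[of "Suc k"] by blast
    finally show "q k < q (Suc k)" .
  qed
  have chi: "primitive_character (q k) (chi k)" "chi k (-1) = - psi (-1)" "character_order (q k) (chi k) = lcm 2 g"
    "\<And>n. 0 < n \<Longrightarrow> n \<le> ys k \<Longrightarrow> chi k (int n) = psi (int n)" "ys k < q k" "ln (real (q k)) \<le> C * real (ys k)" for k
    using G[of k] by (auto simp: q_def chi_def)
  have q8: "q k > 8" for k using chi(5)[of k] ysb(1)[of k] by simp
  have lnq: "ln (real (q k)) > 1" for k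
  proof -
    have "exp 1 < real (q k)" using exp_le q8[of k] by (simp add: le_less_trans[of "exp 1" 3])
    then show ?thesis using q8[of k] ln_less_cancel_iff[of "exp 1" "real (q k)"] by simp
  qed
  \<comment> \<open>Chosen so that (1 + \<epsilon>) (ln y + ln C) = ln y - C1, while ln ln q \<le>
    ln y + ln C.\<close>
  define \<epsilon> where "\<epsilon> k = (ln (real (ys k)) - C1) / (ln (real (ys k)) + ln C) - 1" for k
  have ln_ys: "ln (real (ys k)) > C1" for k
    using ysb[of k] ln_less_cancel_iff[of "exp C1" "real (ys k)"] by simp
  have "filterlim (\<lambda>k. real (ys k)) at_top sequentially"
  proof (rule filterlim_at_top_mono[OF filterlim_real_sequentially])
    show "\<forall>\<^sub>F k in sequentially. real k \<le> real (ys k)"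
      using add_leD2[OF ys0] by (intro always_eventually allI) simp
  qed
  then have lim: "filterlim (\<lambda>k. ln (real (ys k))) at_top sequentially"
    by (rule filterlim_compose[OF ln_at_top])
  have "((\<lambda>x::real. (x - C1) / (x + ln C) - 1) \<longlongrightarrow> 0) at_top" by real_asymp
  then have eps: "\<epsilon> \<longlonglongrightarrow> 0" unfolding \<epsilon>_def by (rule filterlim_compose[OF _ lim])
  have main: "\<exists>\<alpha>. \<bar>\<alpha> - real_of_int a / real b\<bar> \<le> 1 / ln (real (q k)) \<and>
      cmod (char_sum (chi k) (\<alpha> * real (q k)) - char_A (q k) (chi k))
        \<ge> sqrt (real (q k)) / (pi * sqrt (real b)) * (1 + \<epsilon> k) * ln (ln (real (q k)))"
    if a: "coprime a (int b)" for k a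
  proof -
    have q1: "q k > 1" using q8[of k] by simp
    have C0: "C > 0" using C by simp
    obtain \<alpha> where \<alpha>: "\<bar>\<alpha> - of_int a / real b\<bar> \<le> 1 / (C * real (ys k))"
      "cmod (char_sum (chi k) (\<alpha> * real (q k)) - char_A (q k) (chi k))
         \<ge> sqrt (real (q k)) / (pi * sqrt (real b)) * (ln (real (ys k)) - C1)"
      using large_char_sum[OF prim chi(1) q1 chi(4) chi(2) a ysb(3) C0] unfolding C1_def by blast
    have "1 / (C * real (ys k)) \<le> 1 / ln (real (q k))"
      using chi(6)[of k] lnq[of k] by (intro frac_le) auto
    moreover have "(1 + \<epsilon> k) * ln (ln (real (q k))) \<le> ln (real (ys k)) - C1"
    proof -
      have pos: "ln (real (ys k)) + ln C > 0" using ln_ys[of k] C1 C by (simp add: add_pos_nonneg)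
      have "ln (ln (real (q k))) \<le> ln (C * real (ys k))"
        using chi(6)[of k] lnq[of k] by (intro ln_mono) auto
      also have "\<dots> = ln (real (ys k)) + ln C" using C ysb(3)[of k] by (simp add: ln_mult)
      finally have "(1 + \<epsilon> k) * ln (ln (real (q k))) \<le> (1 + \<epsilon> k) * (ln (real (ys k)) + ln C)"
        using ln_ys[of k] pos by (intro mult_left_mono) (auto simp: \<epsilon>_def)
      also have "\<dots> = ln (real (ys k)) - C1" using pos by (simp add: \<epsilon>_def)
      finally show ?thesis .
    qed
    then have "sqrt (real (q k)) / (pi * sqrt (real b)) * ((1 + \<epsilon> k) * ln (ln (real (q k))))
        \<le> sqrt (real (q k)) / (pi * sqrt (real b)) * (ln (real (ys k)) - C1)"
      by (intro mult_left_mono) auto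
    ultimately show ?thesis using \<alpha> by (intro exI[of _ \<alpha>]) (auto simp: mult.assoc)
  qed
  have grh: "\<exists>K. \<forall>k. cmod (char_A (q k) (chi k)) \<le> K * sqrt (real (q k))"
    if b1: "b > 1" and grh: generalized_riemann_hypothesis
  proof -
    obtain v where v: "coprime v (int b)" "psi v \<noteq> 1" using primitive_character_nontrivial[OF prim b1] by blast
    have C0: "C > 0" using C by simp
    \<comment> \<open>A(chi) involves L(1) of the conjugate character, so the bound at 1 is applied
      with the conjugate of psi.\<close>
    have v': "(\<lambda>x. cnj (psi x)) v \<noteq> 1" using v(2) by simp
    obtain K where K: "\<forall>q chi u y. dirichlet_character q chi \<longrightarrow> coprime u (int q) \<longrightarrow> chi u \<noteq> 1 \<longrightarrow>
      (\<forall>n. 0 < n \<longrightarrow> n \<le> y \<longrightarrow> chi (int n) = cnj (psi (int n))) \<longrightarrow> y \<ge> 8 \<longrightarrow>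
      ln (real q) \<le> C * real y \<longrightarrow> cmod (L_series chi 1) \<le> K"
      using L_series_at_1_bounded[OF grh dirichlet_character_cnj[OF dcp] v(1) v' C0] by blast
    have "cmod (char_A (q k) (chi k)) \<le> K * sqrt (real (q k))" for k
    proof -
      have q1: "q k > 1" using q8[of k] by simp
      have dc: "dirichlet_character (q k) (chi k)" using chi(1) by (simp add: primitive_character_def)
      obtain u where u: "coprime u (int (q k))" "chi k u \<noteq> 1" using primitive_character_nontrivial[OF chi(1) q1] by blast
      have "cmod (L_series (\<lambda>n. cnj (chi k n)) 1) \<le> K"
        using K[rule_format, OF dirichlet_character_cnj[OF dc] u(1) _ _ ysb(1) chi(6)] u(2) chi(4) by simp
      then have "cmod (L_series (\<lambda>n. cnj (chi k n)) 1) * sqrt (real (q k)) \<le> K * sqrt (real (q k))"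
        by (rule mult_right_mono) simp
      then show ?thesis using norm_char_A_le[OF chi(1) q1] by linarith
    qed
    then show ?thesis by blast
  qed
  show ?thesis
  proof (intro exI[of _ q] exI[of _ chi] conjI allI impI)
    show "\<exists>C \<epsilon>. \<epsilon> \<longlonglongrightarrow> 0 \<and> (\<forall>k a. coprime a (int b) \<longrightarrow>
        (\<exists>\<alpha>. \<bar>\<alpha> - real_of_int a / real b\<bar> \<le> C / ln (real (q k)) \<and>
          cmod (char_sum (chi k) (\<alpha> * real (q k)) - char_A (q k) (chi k))
            \<ge> sqrt (real (q k)) / (pi * sqrt (real b)) * (1 + \<epsilon> k) * ln (ln (real (q k)))))"
      using eps main by blast
  qed (use q_mono chi grh in auto)
qed

end
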